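(* For $N\ge 1$ let $Q_N^{(0)}$ be the set of triples $a=(a_1,a_2,a_3)$ of positive integers with $a_j\le N$ for $j=1,2,3$, $\gcd(a_1,a_2,a_3)=1$ and $\gcd(a_1,a_3)=1$, equipped with the uniform probability measure. For $a\in Q_N^{(0)}$ let $a_1^{-1}$ denote the inverse of $a_1$ modulo $a_3$, let $a_{12}$ be the integer with $0\le a_{12}<a_3$ and $a_{12}\equiv a_1^{-1}a_2 \pmod{a_3}$, and put $\rho=\rho(a)=a_{12}/a_3$. Write the (finite) continued fraction expansion $\rho=[h_1,h_2,\dots,h_{s_0}]$ (i.e. $\rho=1/(h_1+1/(h_2+\cdots))$ with integers $h_j\ge1$), with convergent denominators $q_s$ defined by $q_{-1}=0$, $q_0=1$, $q_s=h_sq_{s-1}+q_{s-2}$, and let $s_1$ be the index with $q_{s_1-1}<\sqrt N<q_{s_1}$. Then for every fixed $k>0$, as $N\to\infty$ the joint distribution of $$\Big(\frac{q_{s_1}}{\sqrt N},\,h_{s_1-k},\dots,h_{s_1+k}\Big)$$ on $Q_N^{(0)}$ converges to a limiting probability distribution, and this limit coincides with the limit $\mu_k$ described in the context.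
   Context: Gauss measure: the probability measure on $(0,1)$ with density $\frac{1}{\ln 2\,(1+x)}$. For $\rho\in(0,1)$ with continued fraction $\rho=[h_1,h_2,\dots]$ and denominators $q_s$ (given by $q_{-1}=0$, $q_0=1$, $q_s=h_sq_{s-1}+q_{s-2}$), and for $R>0$, let $s(R)$ be the smallest $s$ with $q_s\ge R$. For $\rho$ distributed according to the Gauss measure, the joint distribution of $\big(q_{s(R)}/R,\,h_{s(R)-k},\dots,h_{s(R)+k}\big)$ converges as $R\to\infty$ to a limiting probability distribution; this limit is denoted $\mu_k$. *)

theory Defs
  imports "HOL-Probability.Probability" "HOL-Number_Theory.Number_Theory"
begin

definition weakly_converges ::
  "('i \<Rightarrow> 'a::topological_space measure) \<Rightarrow> 'a measure \<Rightarrow> 'i filter \<Rightarrow> bool" where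
  "weakly_converges M L F \<longleftrightarrow>
     (\<forall>f :: 'a \<Rightarrow> real. continuous_on UNIV f \<and> bounded (range f) \<longrightarrow>
        ((\<lambda>i. \<integral>x. f x \<partial>M i) \<longlongrightarrow> (\<integral>x. f x \<partial>L)) F)"

definition gauss_measure :: "real measure" where
  "gauss_measure =
     density lborel (\<lambda>x. ennreal (indicator {0<..<1} x / (ln 2 * (1 + x))))"

definition gauss_map :: "real \<Rightarrow> real" where
  "gauss_map x = frac (1 / x)"

text \<open>
  The digit \<open>h\<^sub>j\<close> of a number in \<open>[0,1)\<close>, with \<open>j \<ge> 1\<close>. Since \<open>1 / 0 = 0\<close>,
  the digits of a rational number are \<open>0\<close> after its finite expansion (the one whose last
  digit is at least 2) has ended; the digits with index \<open>j \<le> 0\<close> are \<open>0\<close> by convention.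
  Genuine digits are positive.
\<close>
definition cf_digit :: "real \<Rightarrow> int \<Rightarrow> nat" where
  "cf_digit \<rho> j = (if 1 \<le> j then nat \<lfloor>1 / (gauss_map ^^ nat (j - 1)) \<rho>\<rfloor> else 0)"

lemma cf_digit_expansion:
  assumes "0 \<le> \<rho>" "\<rho> < 1"
  shows "\<rho> = foldr (\<lambda>j x. 1 / (real (cf_digit \<rho> (int j)) + x)) [1..<Suc n] ((gauss_map ^^ n) \<rho>)"
proof (induction n)
  case 0
  show ?case by simp
next
  case (Suc n)
  let ?x = "(gauss_map ^^ n) \<rho>"
  have "0 \<le> ?x"
    using assms by (cases n) (auto simp: gauss_map_def)
  then have "real (cf_digit \<rho> (int (Suc n))) + gauss_map ?x = 1 / ?x"
    by (simp add: cf_digit_def gauss_map_def frac_def)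
  then have "1 / (real (cf_digit \<rho> (int (Suc n))) + (gauss_map ^^ Suc n) \<rho>) = ?x"
    by simp
  with Suc.IH show ?case by simp
qed

text \<open>
  The denominators \<open>q\<^sub>s\<close> for \<open>s \<ge> 0\<close>; the second equation is \<open>q\<^sub>1 = h\<^sub>1 q\<^sub>0 + q\<^sub>-\<^sub>1\<close>
  with \<open>q\<^sub>-\<^sub>1 = 0\<close>. For rational numbers only the \<open>q\<^sub>s\<close> with
  \<open>s = 0\<close> or \<open>cf_digit \<rho> s \<noteq> 0\<close> are meaningful.
\<close>
fun cf_denom :: "real \<Rightarrow> nat \<Rightarrow> nat" where
  "cf_denom \<rho> 0 = 1"
| "cf_denom \<rho> (Suc 0) = cf_digit \<rho> 1"
| "cf_denom \<rho> (Suc (Suc s)) =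
     cf_digit \<rho> (int (Suc (Suc s))) * cf_denom \<rho> (Suc s) + cf_denom \<rho> s"

text \<open>
  The tuple \<open>(h\<^bsub>s-k\<^esub>, \<dots>, h\<^bsub>s+k\<^esub>)\<close>, indexed by the offset \<open>j\<close> from \<open>-k\<close> to \<open>k\<close> and padded
  with \<open>0\<close>. Thus the space of \<open>(2k+1)\<close>-tuples is embedded as a closed subspace of the
  functions on the integers (product of discrete spaces), which does not affect weak
  convergence.
\<close>
definition cf_window :: "nat \<Rightarrow> real \<Rightarrow> nat \<Rightarrow> (int \<Rightarrow> nat)" where
  "cf_window k \<rho> s = (\<lambda>j. if \<bar>j\<bar> \<le> int k then cf_digit \<rho> (int s + j) else 0)"

definition renewal_index :: "real \<Rightarrow> real \<Rightarrow> nat" where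
  "renewal_index R \<rho> = (LEAST s. R \<le> real (cf_denom \<rho> s))"

definition renewal_vector :: "nat \<Rightarrow> real \<Rightarrow> real \<Rightarrow> real \<times> (int \<Rightarrow> nat)" where
  "renewal_vector k R \<rho> =
     (let s = renewal_index R \<rho> in (real (cf_denom \<rho> s) / R, cf_window k \<rho> s))"

definition gauss_law :: "nat \<Rightarrow> real \<Rightarrow> (real \<times> (int \<Rightarrow> nat)) measure" where
  "gauss_law k R = distr gauss_measure borel (renewal_vector k R)"

definition Q0 :: "nat \<Rightarrow> (int \<times> int \<times> int) set" where
  "Q0 N = {(a1, a2, a3). a1 \<in> {1..int N} \<and> a2 \<in> {1..int N} \<and> a3 \<in> {1..int N} \<and>
             gcd a1 (gcd a2 a3) = 1 \<and> gcd a1 a3 = 1}"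

definition rho_of :: "int \<times> int \<times> int \<Rightarrow> real" where
  "rho_of = (\<lambda>(a1, a2, a3).
     let a12 = (modular_inverse a3 a1 * a2) mod a3 in real_of_int a12 / real_of_int a3)"

text \<open>
  \<open>q\<^bsub>s-1\<^esub> < R < q\<^sub>s\<close>, where \<open>s\<close> is the index of a genuine digit. For \<open>R \<ge> 1\<close> the index
  \<open>s = 0\<close> cannot occur because \<open>q\<^sub>0 = 1\<close>, and there is at most one such \<open>s\<close>.
\<close>
definition straddles :: "real \<Rightarrow> real \<Rightarrow> nat \<Rightarrow> bool" where
  "straddles R \<rho> s \<longleftrightarrow>
     1 \<le> s \<and> cf_digit \<rho> (int s) \<noteq> 0 \<and>
     real (cf_denom \<rho> (s - 1)) < R \<and> R < real (cf_denom \<rho> s)"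

text \<open>
  If no index straddles \<open>R\<close> (because \<open>R\<close> equals some denominator or exceeds them all), the
  vector is given the value \<open>0\<close>.
\<close>
definition straddle_vector :: "nat \<Rightarrow> real \<Rightarrow> real \<Rightarrow> real \<times> (int \<Rightarrow> nat)" where
  "straddle_vector k R \<rho> =
     (if \<exists>s. straddles R \<rho> s
      then let s = (THE s. straddles R \<rho> s) in (real (cf_denom \<rho> s) / R, cf_window k \<rho> s)
      else (0, \<lambda>_. 0))"

definition Q0_law :: "nat \<Rightarrow> nat \<Rightarrow> (real \<times> (int \<Rightarrow> nat)) measure" where
  "Q0_law k N =
     distr (measure_pmf (pmf_of_set (Q0 N))) borel (\<lambda>a. straddle_vector k (sqrt (real N)) (rho_of a))"

end

theory Submission
  imports Defs "HOL-Computational_Algebra.Squarefree"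
begin

text \<open>
  If \<open>q' = q\<^bsub>s-1\<^esub> < R < q = q\<^sub>s\<close>, all digits in the window are read off from
  \<open>u = q' / R\<close>, \<open>v = q / R\<close> and \<open>\<tau> = R\<^sup>2 \<bar>\<rho> - p\<^sub>s / q\<^sub>s\<bar>\<close>: those after \<open>s\<close> are the digits of the
  tail, a function of \<open>(u, v, \<tau>)\<close>, and those up to \<open>s\<close> are the digits of \<open>u / v\<close> in reverse order.
  For both models the law of \<open>(u, v, \<tau>)\<close> converges to the uniform distribution on
  \<open>0 < u < 1 < v\<close>, \<open>0 < \<tau> < 1 / (v (v + u))\<close>. This region has volume \<open>\<pi>\<^sup>2 / 12\<close>, so it suffices to bound
  the lower limits of the probabilities of small boxes from below by \<open>12 / \<pi>\<^sup>2\<close> times the volume;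
  no tightness and no upper bounds are needed.

  For Lebesgue measure the bound is the count of coprime pairs \<open>(q', q)\<close>, each of which belongs to one
  word of each length parity. Gauss measure reduces to this case: almost every \<open>\<rho>\<close> has a digit at least
  \<open>H\<close>, and beyond it the tail is Lebesgue distributed and the denominators are proportional to
  those of the tail, both up to a factor \<open>1 + O(1 / H)\<close>.

  For the triples put \<open>\<rho> = b / c\<close> with \<open>c = x q + y q'\<close> and \<open>b = x p + y p'\<close>. The lattice
  \<open>a\<^sub>2 \<equiv> b a\<^sub>1 (mod c)\<close> has the basis \<open>(q, -\<sigma> y)\<close>, \<open>(q', \<sigma> x)\<close>, so the triples correspond to integer
  sextuples \<open>(q', q, y, x, n, m)\<close> with \<open>a\<^sub>1 = m q + n q'\<close> and \<open>a\<^sub>2 = \<sigma> (n x - m y)\<close>, in a region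
  scaling with \<open>\<surd>N\<close>, subject to \<open>gcd(q', q) = 1\<close> and \<open>gcd(a\<^sub>1, c) = 1\<close>; the latter is sieved, the
  sextuples with \<open>e\<close> dividing both \<open>a\<^sub>1\<close> and \<open>c\<close> having density \<open>1 / e\<^sup>2\<close>.
\<close>

section \<open>Lower limits of set functions and weak convergence\<close>

text \<open>The laws and the limit have mass one, so a lower limit on open sets already gives weak
  convergence. Exceptional \<open>\<rho>\<close> and triples (a denominator equal to
  \<open>R\<close>, an expansion that ends early) therefore need no estimate: they merely contribute
  nothing to a lower bound. The coordinate \<open>\<tau>\<close> is chosen because it makes the
  limit uniform. For a fixed word, \<open>\<rho>\<close> is affine in \<open>\<tau>\<close> with
  factor \<open>1 / R\<^sup>2\<close> up to sign, so Lebesgue measure turns into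
  \<open>d\<tau> / R\<^sup>2\<close> whatever the word. For sextuples, integrating out the other
  three dimensions leaves the weight 1 at every \<open>(u, v, \<tau>)\<close>. The constant
  \<open>12 / \<pi>\<^sup>2\<close> is \<open>2 * 6 / \<pi>\<^sup>2\<close> in both models; the 2
  stands for the two length parities, which for triples are the two signs \<open>\<sigma>\<close>.
  In the Gauss model \<open>6 / \<pi>\<^sup>2\<close> is the density of coprime pairs. For triples
  this density enters twice, for \<open>(q', q)\<close> and for \<open>(a\<^sub>1, c)\<close>, and
  is divided out once by the number of triples, about
  \<open>6 / \<pi>\<^sup>2 * N\<^sup>3\<close>.\<close>

definition lim_ge :: "('i \<Rightarrow> real) \<Rightarrow> real \<Rightarrow> 'i filter \<Rightarrow> bool" where
  "lim_ge f L F \<longleftrightarrow> (\<forall>r<L. eventually (\<lambda>i. r < f i) F)"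

lemma lim_geI: "(\<And>r. r < L \<Longrightarrow> eventually (\<lambda>i. r < f i) F) \<Longrightarrow> lim_ge f L F"
  by (simp add: lim_ge_def)

lemma lim_geD: "lim_ge f L F \<Longrightarrow> r < L \<Longrightarrow> eventually (\<lambda>i. r < f i) F"
  by (simp add: lim_ge_def)

lemma tendsto_imp_lim_ge: "(f \<longlongrightarrow> L) F \<Longrightarrow> lim_ge f L F"
  by (auto simp: lim_ge_def dest: order_tendstoD)

lemma lim_ge_mono:
  assumes "lim_ge f L F" "eventually (\<lambda>i. f i \<le> g i) F" "M \<le> L"
  shows "lim_ge g M F"
proof (rule lim_geI)
  fix r assume "r < M"
  with assms(3) have "eventually (\<lambda>i. r < f i) F" by (intro lim_geD[OF assms(1)]) simp
  with assms(2) show "eventually (\<lambda>i. r < g i) F" by eventually_elim auto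
qed

lemma lim_ge_add:
  assumes "lim_ge f L F" "lim_ge g M F"
  shows "lim_ge (\<lambda>i. f i + g i) (L + M) F"
proof (rule lim_geI)
  fix r assume r: "r < L + M"
  define d where "d = (L + M - r) / 2"
  have d: "d > 0" using r by (simp add: d_def)
  have "eventually (\<lambda>i. L - d < f i) F" "eventually (\<lambda>i. M - d < g i) F"
    using lim_geD[OF assms(1), of "L - d"] lim_geD[OF assms(2), of "M - d"] d by simp_all
  then show "eventually (\<lambda>i. r < f i + g i) F"
    by eventually_elim (simp add: d_def field_simps)
qed

lemma lim_ge_sum:
  assumes "\<And>a. a \<in> A \<Longrightarrow> lim_ge (f a) (L a) F"
  shows "lim_ge (\<lambda>i. \<Sum>a\<in>A. f a i) (\<Sum>a\<in>A. L a) F"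
  using assms
  by (induction A rule: infinite_finite_induct)
     (simp_all add: tendsto_imp_lim_ge lim_ge_add)

lemma lim_ge_mult_left:
  assumes "lim_ge f L F" "c \<ge> 0"
  shows "lim_ge (\<lambda>i. c * f i) (c * L) F"
proof (cases "c = 0")
  case False
  with assms have c: "c > 0" by simp
  show ?thesis
  proof (rule lim_geI)
    fix r assume "r < c * L"
    with c have "r / c < L" by (simp add: field_simps)
    with assms(1) have "eventually (\<lambda>i. r / c < f i) F" by (rule lim_geD)
    then show "eventually (\<lambda>i. r < c * f i) F"
      by eventually_elim (use c in \<open>simp add: field_simps\<close>)
  qed
qed (simp add: lim_ge_def)

text \<open>Each single \<open>L' n\<close> is already a lower bound, so no uniformity in
  \<open>n\<close> is involved. This is how a cutoff or an \<open>\<epsilon>\<close> is removed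
  after the limit along \<open>F\<close> has been taken.\<close>

lemma lim_ge_LIMSEQ:
  assumes "\<And>n::nat. lim_ge f (L' n) F" "L' \<longlonglongrightarrow> L"
  shows "lim_ge f L F"
proof (rule lim_geI)
  fix r assume "r < L"
  with assms(2) have "eventually (\<lambda>n. r < L' n) sequentially" by (rule order_tendstoD)
  then obtain n where "r < L' n" by (auto simp: eventually_sequentially)
  with assms(1)[of n] show "eventually (\<lambda>i. r < f i) F" by (rule lim_geD)
qed

text \<open>Serves to divide a count by the size of the sample space. Nonnegativity of
  \<open>f\<close> disposes of \<open>r < 0\<close>; for \<open>r \<ge> 0\<close> the bound
  \<open>L\<close> is positive, and a value strictly between \<open>r / M\<close> and
  \<open>L\<close> splits the estimate.\<close>

lemma lim_ge_mult_tendsto: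
  assumes "lim_ge f L F" "(g \<longlongrightarrow> M) F" "0 < M" "eventually (\<lambda>i. 0 \<le> f i) F"
  shows "lim_ge (\<lambda>i. f i * g i) (L * M) F"
proof (rule lim_geI)
  fix r assume r: "r < L * M"
  have gp: "eventually (\<lambda>i. 0 < g i) F" using assms by (auto dest: order_tendstoD)
  show "eventually (\<lambda>i. r < f i * g i) F"
  proof (cases "r < 0")
    case True
    from gp assms(4) show ?thesis
      by eventually_elim (use True in \<open>auto intro: less_le_trans\<close>)
  next
    case False
    with r have L: "L > 0" using assms(3)
      by (smt (verit) mult_nonpos_nonneg)
    have "r / M < L" using r assms(3) by (simp add: field_simps)
    then obtain s where s: "r / M < s" "s < L" using dense by blast
    have s0: "s > 0" using s(1) False assms(3)
      by (smt (verit) divide_nonneg_pos)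
    have "r / s < M" using s s0 assms(3) by (simp add: field_simps)
    with assms(2) have "eventually (\<lambda>i. r / s < g i) F" by (rule order_tendstoD)
    moreover have "eventually (\<lambda>i. s < f i) F" using assms(1) s(2) by (rule lim_geD)
    ultimately show ?thesis using gp
    proof eventually_elim
      case (elim i)
      have "r < s * g i" using elim(1) s0 by (simp add: field_simps)
      also have "\<dots> \<le> f i * g i" using elim by (intro mult_right_mono) auto
      finally show ?case .
    qed
  qed
qed

section \<open>From boxes to open sets, and from open sets to weak convergence\<close>

lemma superadditive_finite_union:
  fixes P :: "'a::topological_space set \<Rightarrow> real"
  assumes nn: "\<And>A. 0 \<le> P A"
    and super: "\<And>A B. open A \<Longrightarrow> open B \<Longrightarrow> A \<inter> B = {} \<Longrightarrow> P A + P B \<le> P (A \<union> B)"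
    and "finite \<D>" "\<And>K. K \<in> \<D> \<Longrightarrow> open (h K)"
    and "\<And>K K'. K \<in> \<D> \<Longrightarrow> K' \<in> \<D> \<Longrightarrow> K \<noteq> K' \<Longrightarrow> h K \<inter> h K' = {}"
  shows "(\<Sum>K\<in>\<D>. P (h K)) \<le> P (\<Union>K\<in>\<D>. h K)"
  using assms(3,4,5)
proof (induction \<D> rule: finite_induct)
  case empty
  then show ?case using nn by simp
next
  case (insert K \<D>)
  have "(\<Sum>K\<in>insert K \<D>. P (h K)) \<le> P (h K) + P (\<Union>K\<in>\<D>. h K)"
    using insert by simp
  also have "\<dots> \<le> P (h K \<union> (\<Union>K\<in>\<D>. h K))"
    using insert.prems insert.hyps by (intro super) auto
  finally show ?case by simp
qed

text \<open>\<open>U\<close> is an increasing union of finite unions of closed boxes. Each finite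
  union is divided into non-overlapping boxes, whose interiors are disjoint, lie in \<open>U\<close>
  and lose no volume; superadditivity and monotonicity then bound \<open>P i U\<close> from below.
  \<open>P\<close> is a bare set function, so that it may be a normalised count or the probability
  that some state lies in the set.\<close>

theorem lim_ge_open_of_boxes:
  fixes P :: "'i \<Rightarrow> 'a::euclidean_space set \<Rightarrow> real"
  assumes nn: "\<And>i A. 0 \<le> P i A"
    and super: "\<And>i A B. open A \<Longrightarrow> open B \<Longrightarrow> A \<inter> B = {} \<Longrightarrow> P i A + P i B \<le> P i (A \<union> B)"
    and mono: "\<And>i A B. open A \<Longrightarrow> open B \<Longrightarrow> A \<subseteq> B \<Longrightarrow> P i A \<le> P i B"
    and U: "open U" "emeasure lborel U < \<infinity>"
    and box: "\<And>a b. box a b \<noteq> {} \<Longrightarrow> cbox a b \<subseteq> U \<Longrightarrow> lim_ge (\<lambda>i. P i (box a b)) (\<kappa> * measure lborel (box a b)) F"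
    and \<kappa>: "\<kappa> \<ge> 0"
  shows "lim_ge (\<lambda>i. P i U) (\<kappa> * measure lborel U) F"
proof (cases "U = {}")
  case True
  then show ?thesis using nn by (auto simp: lim_ge_def intro!: always_eventually less_le_trans[of _ 0])
next
  case False
  obtain \<C> where \<C>: "countable \<C>" "\<C> \<subseteq> Pow U" "\<And>X. X \<in> \<C> \<Longrightarrow> \<exists>a b. X = cbox a b" "\<Union>\<C> = U"
    using open_countable_Union_open_cbox[OF U(1)] by metis
  have ne: "\<C> \<noteq> {}" using False \<C>(4) by auto
  define D where "D n = from_nat_into \<C> n" for n
  have rD: "range D = \<C>" unfolding D_def using range_from_nat_into[OF ne \<C>(1)] .
  define K where "K n = (\<Union>i<n. D i)" for n
  have Kin: "lim_ge (\<lambda>i. P i U) (\<kappa> * measure lborel (K n)) F" for n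
  proof -
    have fin: "finite (D ` {..<n})" by simp
    have "\<exists>a b. s = cbox a b" if "s \<in> D ` {..<n}" for s
      using that rD \<C>(3) by blast
    then obtain p where p: "p division_of \<Union> (D ` {..<n})"
      using elementary_unions_intervals[OF fin] by blast
    note pD = division_ofD[OF p]
    have KU: "K n \<subseteq> U" unfolding K_def using rD \<C>(4) by blast
    \<comment> \<open>Degenerate boxes of the division are dropped: they carry no volume, and the
      hypothesis \<open>box\<close> speaks of nonempty open boxes only.\<close>
    define p' where "p' = {k \<in> p. interior k \<noteq> {}}"
    have finp': "finite p'" using pD(1) by (simp add: p'_def)
    have each: "lim_ge (\<lambda>i. P i (interior k)) (\<kappa> * measure lborel (interior k)) F" if kp: "k \<in> p'" for k
    proof -
      obtain a b where k: "k = cbox a b" using kp pD(4) unfolding p'_def by blast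
      have "interior k = box a b" by (simp add: k interior_cbox)
      moreover have "cbox a b \<subseteq> U" using that pD(2) k KU unfolding p'_def K_def by blast
      ultimately show ?thesis using box[of a b] that by (auto simp: p'_def)
    qed
    have "measure lborel (K n) = (\<Sum>k\<in>p. measure lborel k)"
    proof -
      have "(\<Sum>k\<in>p. measure lebesgue k) = measure lebesgue (\<Union> (D ` {..<n}))"
        using content_division[OF p] .
      moreover have "measure lebesgue k = measure lborel k" if "k \<in> p" for k
        using pD(4)[OF that] by (auto simp: measure_completion)
      moreover have "closed (K n)" unfolding K_def using rD \<C>(3)
        by (intro closed_UN) (auto, metis closed_cbox rangeI)
      ultimately show ?thesis by (simp add: K_def measure_completion borel_closed)
    qed
    also have "\<dots> = (\<Sum>k\<in>p. measure lborel (interior k))"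
    proof (rule sum.cong)
      fix k assume "k \<in> p"
      then obtain a b where "k = cbox a b" using pD(4) by blast
      then show "measure lborel k = measure lborel (interior k)"
        by (simp add: interior_cbox measure_lborel_box_eq measure_lborel_cbox_eq)
    qed simp
    also have "\<dots> = (\<Sum>k\<in>p'. measure lborel (interior k))"
      unfolding p'_def by (rule sum.mono_neutral_right) (use pD(1) in auto)
    finally have meas: "measure lborel (K n) = (\<Sum>k\<in>p'. measure lborel (interior k))" .
    have "lim_ge (\<lambda>i. \<Sum>k\<in>p'. P i (interior k)) (\<Sum>k\<in>p'. \<kappa> * measure lborel (interior k)) F"
      by (rule lim_ge_sum) (rule each)
    then show ?thesis
    proof (rule lim_ge_mono)
      show "eventually (\<lambda>i. (\<Sum>k\<in>p'. P i (interior k)) \<le> P i U) F"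
      proof (rule always_eventually, rule allI)
        fix i
        have "(\<Sum>k\<in>p'. P i (interior k)) \<le> P i (\<Union>k\<in>p'. interior k)"
          by (rule superadditive_finite_union[OF nn super finp'])
             (use pD(5) in \<open>auto simp: p'_def\<close>)
        also have "\<dots> \<le> P i U"
        proof (rule mono)
          have "k \<subseteq> K n" if "k \<in> p'" for k using that pD(2) by (auto simp: p'_def K_def)
          then show "(\<Union>k\<in>p'. interior k) \<subseteq> U" using KU interior_subset by blast
        qed (use U in auto)
        finally show "(\<Sum>k\<in>p'. P i (interior k)) \<le> P i U" .
      qed
      show "\<kappa> * measure lborel (K n) \<le> (\<Sum>k\<in>p'. \<kappa> * measure lborel (interior k))"
        by (simp add: meas sum_distrib_left)
    qed
  qed
  have Kc: "K n \<in> sets lborel" for n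
    unfolding K_def using rD \<C>(3) by (auto intro!: sets.finite_UN) (metis borel_closed closed_cbox rangeI)
  have "(\<lambda>n. measure lborel (K n)) \<longlonglongrightarrow> measure lborel (\<Union>n. K n)"
  proof (rule Lim_measure_incseq)
    show "range K \<subseteq> sets lborel" using Kc by auto
    show "incseq K" unfolding K_def incseq_def by fastforce
    have "(\<Union>n. K n) = U" unfolding K_def using rD \<C>(4) by (auto simp: lessThan_iff)
    then show "emeasure lborel (\<Union>i. K i) \<noteq> \<infinity>" using U(2) by simp
  qed
  moreover have "(\<Union>n. K n) = U"
    unfolding K_def using rD \<C>(4) by (auto simp: lessThan_iff)
  ultimately have "(\<lambda>n. \<kappa> * measure lborel (K n)) \<longlonglongrightarrow> \<kappa> * measure lborel U"
    by (intro tendsto_mult_left) simp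
  with Kin show ?thesis by (rule lim_ge_LIMSEQ)
qed

text \<open>One direction of the portmanteau theorem, proved by layers: for
  \<open>0 \<le> f \<le> 1\<close> the average of \<open>measure N {x. j / n < f x}\<close> over
  \<open>j = 1..n\<close> lies between the integral of \<open>f\<close> minus \<open>1 / n\<close>
  and the integral itself. This gives a lower limit for integrals; the upper limit is the same
  statement for \<open>- f\<close>, since all masses are one.\<close>

theorem weakly_converges_of_open:
  fixes M :: "'i \<Rightarrow> 'a::topological_space measure"
  assumes M: "\<And>i. prob_space (M i)" "\<And>i. sets (M i) = sets borel"
    and L: "prob_space L" "sets L = sets borel"
    and open_ge: "\<And>G. open G \<Longrightarrow> lim_ge (\<lambda>i. measure (M i) G) (measure L G) F"
  shows "weakly_converges M L F"
proof -
  have level: "(\<integral>x. f x \<partial>N) - 1 / n \<le> (1 / n) * (\<Sum>j=1..n. measure N {x. real j / n < f x})"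
    "(1 / n) * (\<Sum>j=1..n. measure N {x. real j / n < f x}) \<le> (\<integral>x. f x \<partial>N)"
    if N: "prob_space N" "sets N = sets borel" and f: "continuous_on UNIV f" "\<And>x. 0 \<le> f x" "\<And>x. f x \<le> 1" and n: "n \<ge> 1"
    for N :: "'a measure" and f :: "'a \<Rightarrow> real" and n :: nat
  proof -
    interpret prob_space N by fact
    have sp: "space N = UNIV" using sets_eq_imp_space_eq[OF N(2)] by simp
    have fb: "f \<in> borel_measurable N" using borel_measurable_continuous_onI[OF f(1)] N(2) measurable_cong_sets by blast
    have ms: "{x. real j / n < f x} \<in> sets N" for j
      using N(2) f(1) by (auto intro!: borel_open open_Collect_less continuous_on_const)
    have fi: "integrable N f" using fb f by (intro integrable_const_bound[of _ 1]) auto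
    define g where "g x = (1 / n) * (\<Sum>j=1..n. indicator {x. real j / n < f x} x)" for x :: 'a
    have gi: "integrable N g" unfolding g_def using ms by (intro integrable_mult_right Bochner_Integration.integrable_sum) (auto simp: emeasure_eq_measure)
    have "(\<integral>x. g x \<partial>N) = (1 / n) * (\<Sum>j=1..n. measure N {x. real j / n < f x})"
      unfolding g_def using ms sp by (simp add: Bochner_Integration.integral_sum emeasure_eq_measure)
    moreover have gb: "f x - 1 / n \<le> g x \<and> g x \<le> f x" for x
    proof -
      \<comment> \<open>\<open>m\<close> counts the \<open>j \<ge> 1\<close> with
        \<open>j < n * f x\<close>. Strictness gives the ceiling minus one, and \<open>nat\<close>
        truncates the value -1 that occurs when \<open>f x = 0\<close>.\<close>
      define m where "m = nat (\<lceil>n * f x\<rceil> - 1)"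
      have "(\<Sum>j=1..n. indicator {x. real j / n < f x} x) = (\<Sum>j=1..n. if j \<in> {j. real j < n * f x} then 1 else (0::real))"
        using n by (intro sum.cong) (auto simp: indicator_def field_simps)
      also have "\<dots> = card {j \<in> {1..n}. real j < n * f x}"
        by (simp add: sum.If_cases Int_def)
      also have "{j \<in> {1..n}. real j < n * f x} = {1..m}"
      proof -
        have "j \<le> n" if "real j < n * f x" for j
        proof -
          have "real j < real n" using that f(3)[of x] n by (smt (verit) mult_left_le of_nat_0_le_iff)
          then show ?thesis by simp
        qed
        moreover have "real j < n * f x \<longleftrightarrow> j \<le> m" if "j \<ge> 1" for j
          using that unfolding m_def by (simp add: le_nat_iff) linarith
        ultimately show ?thesis by auto
      qed
      finally have "g x = real m / n" unfolding g_def by simp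
      moreover have "real m \<le> n * f x" "n * f x - 1 \<le> real m"
      proof -
        have "0 \<le> n * f x" using f(2)[of x] by simp
        then show "real m \<le> n * f x" "n * f x - 1 \<le> real m" unfolding m_def by linarith+
      qed
      ultimately have "n * g x \<le> n * f x" "n * (f x - 1 / n) \<le> n * g x"
        using n by (simp_all add: right_diff_distrib)
      then show ?thesis using n by simp
    qed
    ultimately show "(1 / n) * (\<Sum>j=1..n. measure N {x. real j / n < f x}) \<le> (\<integral>x. f x \<partial>N)"
      using integral_mono[OF gi fi] by simp
    have "(\<integral>x. f x - 1 / n \<partial>N) \<le> (\<integral>x. g x \<partial>N)"
      by (rule integral_mono) (use fi gi gb in auto)
    then show "(\<integral>x. f x \<partial>N) - 1 / n \<le> (1 / n) * (\<Sum>j=1..n. measure N {x. real j / n < f x})"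
      using fi \<open>(\<integral>x. g x \<partial>N) = _\<close> by (simp add: prob_space)
  qed
  have ge01: "lim_ge (\<lambda>i. \<integral>x. f x \<partial>M i) (\<integral>x. f x \<partial>L) F"
    if f: "continuous_on UNIV f" "\<And>x. 0 \<le> f x" "\<And>x. f x \<le> 1" for f :: "'a \<Rightarrow> real"
  proof (rule lim_ge_LIMSEQ)
    fix n :: nat
    let ?n = "Suc n"
    have "lim_ge (\<lambda>i. (1 / ?n) * (\<Sum>j=1..?n. measure (M i) {x. real j / ?n < f x}))
        ((1 / ?n) * (\<Sum>j=1..?n. measure L {x. real j / ?n < f x})) F"
      by (intro lim_ge_mult_left lim_ge_sum open_ge open_Collect_less continuous_on_const f) auto
    then show "lim_ge (\<lambda>i. \<integral>x. f x \<partial>M i) ((\<integral>x. f x \<partial>L) - 1 / ?n) F"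
      using level(1)[OF L f, of ?n] level(2)[OF M f, of ?n]
      by (elim lim_ge_mono) (auto intro!: always_eventually)
    have "(\<lambda>n. (\<integral>x. f x \<partial>L) - 1 / real (Suc n)) \<longlonglongrightarrow> (\<integral>x. f x \<partial>L) - 0"
      by (intro tendsto_intros lim_1_over_n[THEN LIMSEQ_Suc])
    then show "(\<lambda>n. (\<integral>x. f x \<partial>L) - 1 / real (Suc n)) \<longlonglongrightarrow> (\<integral>x. f x \<partial>L)" by simp
  qed
  show ?thesis
    unfolding weakly_converges_def
  proof (intro allI impI, elim conjE)
    fix f :: "'a \<Rightarrow> real"
    assume f: "continuous_on UNIV f" "bounded (range f)"
    then obtain B where B: "B > 0" "\<And>x. \<bar>f x\<bar> \<le> B"
      by (auto simp: bounded_pos)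
    have int: "integrable N f" "space N = UNIV" if "prob_space N" "sets N = sets borel" for N :: "'a measure"
    proof -
      interpret prob_space N by fact
      have "f \<in> borel_measurable N" using borel_measurable_continuous_onI[OF f(1)] that(2) measurable_cong_sets by blast
      then show "integrable N f" using B by (intro integrable_const_bound[of _ B]) auto
      show "space N = UNIV" using sets_eq_imp_space_eq[OF that(2)] by simp
    qed
    have aff: "(\<integral>x. (s * f x + B) / (2 * B) \<partial>N) = (s * (\<integral>x. f x \<partial>N) + B) / (2 * B)"
      if "prob_space N" "sets N = sets borel" for N :: "'a measure" and s :: real
    proof -
      interpret prob_space N by fact
      show ?thesis using int[OF that] prob_space by simp
    qed
    \<comment> \<open>The rescaled function \<open>(s * f + B) / (2 * B)\<close> takes values in the
      unit interval; \<open>s = 1\<close> yields the lower and \<open>s = -1\<close> the upper limit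
      of the integrals of \<open>f\<close>.\<close>
    have *: "lim_ge (\<lambda>i. s * (\<integral>x. f x \<partial>M i)) (s * (\<integral>x. f x \<partial>L)) F" if "s = 1 \<or> s = -1" for s :: real
    proof -
      have "lim_ge (\<lambda>i. \<integral>x. (s * f x + B) / (2 * B) \<partial>M i) (\<integral>x. (s * f x + B) / (2 * B) \<partial>L) F"
        using B that by (intro ge01 continuous_intros f) (auto simp: field_simps abs_le_iff, (smt (verit))+)
      then have "lim_ge (\<lambda>i. (s * (\<integral>x. f x \<partial>M i) + B) / (2 * B)) ((s * (\<integral>x. f x \<partial>L) + B) / (2 * B)) F"
        unfolding aff[OF M] aff[OF L] .
      from lim_ge_add[OF lim_ge_mult_left[OF this, of "2 * B"] tendsto_imp_lim_ge[OF tendsto_const[of "- B"]]]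
      show ?thesis using B by simp
    qed
    show "((\<lambda>i. \<integral>x. f x \<partial>M i) \<longlongrightarrow> (\<integral>x. f x \<partial>L)) F"
    proof (rule order_tendstoI)
      show "eventually (\<lambda>i. a < (\<integral>x. f x \<partial>M i)) F" if "a < (\<integral>x. f x \<partial>L)" for a
        using *[of 1] that by (auto dest: lim_geD)
      show "eventually (\<lambda>i. (\<integral>x. f x \<partial>M i) < a) F" if "(\<integral>x. f x \<partial>L) < a" for a
        using lim_geD[OF *[of "-1"], of "- a"] that by simp
    qed
  qed
qed

section \<open>Continued fraction words\<close>

text \<open>This is \<open>[h\<^sub>1, ..., h\<^sub>s + x]\<close>. For \<open>x\<close> in the open
  unit interval it is the number with initial digits \<open>w\<close> whose \<open>s\<close>-th
  image under the Gauss map is \<open>x\<close>.\<close>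

fun cfe :: "nat list \<Rightarrow> real \<Rightarrow> real" where
  "cfe [] x = x"
| "cfe (h # w) x = 1 / (real h + cfe w x)"

text \<open>Numerator and denominator of the convergent of the whole word. They are built from the
  front, as suits \<open>cfe\<close>; the usual recursion, which appends a digit, reappears as
  \<open>cden_snoc\<close>.\<close>

fun cnum :: "nat list \<Rightarrow> nat" and cden :: "nat list \<Rightarrow> nat" where
  "cnum [] = 0"
| "cnum (h # w) = cden w"
| "cden [] = 1"
| "cden (h # w) = h * cden w + cnum w"

text \<open>The convergent before the last digit, \<open>p(s-1)\<close> and \<open>q(s-1)\<close>.
  The values on the empty word are \<open>p(-1) = 1\<close> and \<open>q(-1) = 0\<close>.\<close>

fun cnum' :: "nat list \<Rightarrow> nat" and cden' :: "nat list \<Rightarrow> nat" where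
  "cnum' [] = 1"
| "cnum' (h # w) = cden' w"
| "cden' [] = 0"
| "cden' (h # w) = h * cden' w + cnum' w"

abbreviation pos_word :: "nat list \<Rightarrow> bool" where
  "pos_word w \<equiv> (\<forall>h\<in>set w. 0 < h)"

lemma cfe_append: "cfe (v @ w) x = cfe v (cfe w x)"
  by (induction v) auto

text \<open>The matrix with rows \<open>(cnum', cnum)\<close> and \<open>(cden', cden)\<close> is
  the product over the digits \<open>h\<close> of the matrices with rows \<open>(0, 1)\<close> and
  \<open>(1, h)\<close>; concatenation of words is matrix multiplication.\<close>

lemma cnum_cden_append:
  "cnum (v @ w) = cnum' v * cnum w + cnum v * cden w \<and>
   cden (v @ w) = cden' v * cnum w + cden v * cden w"
  by (induction v) (auto simp: algebra_simps)

lemma cnum_cden'_append: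
  "cnum' (v @ w) = cnum' v * cnum' w + cnum v * cden' w \<and>
   cden' (v @ w) = cden' v * cnum' w + cden v * cden' w"
  by (induction v) (auto simp: algebra_simps)

lemmas cden_append = cnum_cden_append[THEN conjunct2]
lemmas cden'_append = cnum_cden'_append[THEN conjunct2]
lemma cden_snoc: "cden (w @ [h]) = h * cden w + cden' w" "cden' (w @ [h]) = cden w"
  by (simp_all add: cden_append cden'_append)

lemma cden_pos: "pos_word w \<Longrightarrow> 0 < cden w"
  by (induction w) auto

lemma cnum'_le_cden': "pos_word w \<Longrightarrow> w \<noteq> [] \<Longrightarrow> cnum' w \<le> cden' w"
proof (induction w)
  case (Cons h w)
  then show ?case by (cases w) (auto intro: trans_le_add1)
qed simp

lemma cnum_le_cden: "pos_word w \<Longrightarrow> cnum w \<le> cden w"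
proof (induction w)
  case (Cons h w)
  then show ?case by (auto intro: trans_le_add1)
qed simp

text \<open>Every digit contributes a matrix of determinant -1. Through this identity the parity of
  the length becomes the sign \<open>\<sigma>\<close> of a triple.\<close>

lemma cnum_cden_det:
  "int (cnum w) * int (cden' w) - int (cnum' w) * int (cden w) = (-1) ^ Suc (length w)"
  by (induction w) (auto simp: algebra_simps)

lemma cfe_eq:
  assumes "pos_word w" "0 \<le> x"
  shows "cfe w x = (real (cnum w) + x * real (cnum' w)) / (real (cden w) + x * real (cden' w))"
  using assms(1)
proof (induction w)
  case (Cons h w)
  have "0 < cden w" using Cons.prems by (intro cden_pos) auto
  then have D: "real (cden w) + x * real (cden' w) > 0" using assms(2) by (intro add_pos_nonneg) auto
  have "real h + cfe w x = (real h * (real (cden w) + x * real (cden' w)) + (real (cnum w) + x * real (cnum' w)))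
      / (real (cden w) + x * real (cden' w))"
    using Cons D by (simp add: add_divide_distrib)
  then show ?case by (simp add: algebra_simps)
qed simp

text \<open>\<open>cfe w\<close> is a Moebius transformation of determinant
  \<open>\<plusminus>1\<close>, so its differences are explicit. All lengths of cylinders and of
  their parts come from this formula.\<close>

lemma cfe_diff:
  assumes "pos_word w" "0 \<le> x" "0 \<le> y"
  shows "cfe w y - cfe w x = (-1) ^ length w * (y - x) /
     ((real (cden w) + x * real (cden' w)) * (real (cden w) + y * real (cden' w)))"
proof -
  have c: "0 < real (cden w)" using cden_pos[OF assms(1)] by simp
  have p: "real (cden w) + x * real (cden' w) > 0" "real (cden w) + y * real (cden' w) > 0"
    using assms(2,3) c by (auto intro: add_pos_nonneg)
  have "real_of_int (int (cnum w) * int (cden' w) - int (cnum' w) * int (cden w)) = (-1) ^ Suc (length w)"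
    by (simp only: cnum_cden_det) simp
  then have d: "real (cnum' w) * real (cden w) - real (cnum w) * real (cden' w) = (-1) ^ length w" by simp
  have "cfe w y - cfe w x = (real (cnum' w) * real (cden w) - real (cnum w) * real (cden' w)) * (y - x) /
     ((real (cden w) + x * real (cden' w)) * (real (cden w) + y * real (cden' w)))"
    using p by (simp add: cfe_eq assms diff_frac_eq) (simp add: algebra_simps)
  then show ?thesis by (simp add: d)
qed

lemma cfe_in_01:
  assumes "pos_word w" "0 < x" "x < 1"
  shows "0 < cfe w x \<and> cfe w x < 1"
  using assms(1)
proof (induction w)
  case (Cons h w)
  then have "0 < cfe w x" "1 \<le> h" by auto
  then show ?case by (auto simp: field_simps)
qed (use assms in auto)

lemma gauss_map_cfe_Cons:
  assumes "0 < y" "y < 1"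
  shows "gauss_map (1 / (real h + y)) = y" "\<lfloor>1 / (1 / (real h + y))\<rfloor> = int h"
proof -
  show f: "\<lfloor>1 / (1 / (real h + y))\<rfloor> = int h" using assms by (simp add: floor_eq_iff)
  then show "gauss_map (1 / (real h + y)) = y" by (simp add: gauss_map_def frac_def)
qed

lemma cf_digit_Suc: "1 \<le> j \<Longrightarrow> cf_digit x (j + 1) = cf_digit (gauss_map x) j"
proof -
  assume "1 \<le> j"
  then have "nat (j + 1 - 1) = Suc (nat (j - 1))" by simp
  then show ?thesis using \<open>1 \<le> j\<close> unfolding cf_digit_def by (simp add: funpow_swap1)
qed

lemma cf_digit_add: "1 \<le> j \<Longrightarrow> cf_digit x (int n + j) = cf_digit ((gauss_map ^^ n) x) j"
proof (induction n arbitrary: x)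
  case (Suc n)
  have "cf_digit x (int (Suc n) + j) = cf_digit x ((int n + j) + 1)" by (simp add: algebra_simps)
  also have "\<dots> = cf_digit (gauss_map x) (int n + j)" using Suc.prems by (intro cf_digit_Suc) simp
  finally show ?case using Suc by (simp add: funpow_swap1)
qed simp

lemma gauss_map_cfe:
  assumes "pos_word w" "0 < x" "x < 1"
  shows "(gauss_map ^^ length w) (cfe w x) = x"
  using assms(1)
proof (induction w)
  case (Cons h w)
  then show ?case using gauss_map_cfe_Cons(1)[of "cfe w x" h] cfe_in_01[of w x] assms
    by (simp add: funpow_swap1)
qed simp

lemma cf_digit_cfe:
  assumes "pos_word w" "0 < x" "x < 1" "i < length w"
  shows "cf_digit (cfe w x) (int (Suc i)) = w ! i"
  using assms(1,4)
proof (induction w arbitrary: i)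
  case (Cons h w)
  have y: "0 < cfe w x" "cfe w x < 1" using cfe_in_01[of w x] Cons.prems assms by auto
  show ?case
  proof (cases i)
    case 0
    then show ?thesis using gauss_map_cfe_Cons(2)[OF y, of h] by (simp add: cf_digit_def)
  next
    case (Suc j)
    have "cf_digit (cfe (h # w) x) (int (Suc i)) = cf_digit (gauss_map (cfe (h # w) x)) (int (Suc j))"
      using cf_digit_Suc[of "int (Suc j)" "cfe (h # w) x"] by (simp add: Suc algebra_simps)
    also have "gauss_map (cfe (h # w) x) = cfe w x" using gauss_map_cfe_Cons(1)[OF y, of h] by simp
    also have "cf_digit (cfe w x) (int (Suc j)) = w ! j" using Cons Suc by auto
    finally show ?thesis by (simp add: Suc)
  qed
qed simp

lemma cf_denom_Suc: "cf_denom \<rho> (Suc s) = cf_digit \<rho> (int (Suc s)) * cf_denom \<rho> s + (if s = 0 then 0 else cf_denom \<rho> (s - 1))"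
  by (cases s) auto

lemma cf_denom_digits:
  assumes "\<And>i. i < length w \<Longrightarrow> cf_digit \<rho> (int (Suc i)) = w ! i"
  shows "cf_denom \<rho> (length w) = cden w \<and> (w \<noteq> [] \<longrightarrow> cf_denom \<rho> (length w - 1) = cden' w)"
  using assms
proof (induction w rule: rev_induct)
  case (snoc h w)
  have "cf_digit \<rho> (int (Suc i)) = w ! i" if "i < length w" for i
    using snoc.prems[of i] that by (simp add: nth_append)
  then have IH: "cf_denom \<rho> (length w) = cden w" "w \<noteq> [] \<longrightarrow> cf_denom \<rho> (length w - 1) = cden' w"
    using snoc.IH by auto
  have "cf_digit \<rho> (int (Suc (length w))) = h" using snoc.prems[of "length w"] by simp
  then show ?case using IH by (cases "w = []") (auto simp: cden_snoc cf_denom_Suc)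
qed simp

lemma cf_denom_cfe:
  assumes "pos_word w" "0 < x" "x < 1"
  shows "cf_denom (cfe w x) (length w) = cden w" "w \<noteq> [] \<Longrightarrow> cf_denom (cfe w x) (length w - 1) = cden' w"
  using cf_denom_digits[of w "cfe w x"] cf_digit_cfe[OF assms] by auto

lemma gauss_map_range: "0 \<le> gauss_map x" "gauss_map x < 1"
  by (auto simp: gauss_map_def frac_lt_1)

lemma gauss_map_0 [simp]: "gauss_map 0 = 0"
  by (simp add: gauss_map_def)

lemma gauss_map_funpow_0 [simp]: "(gauss_map ^^ n) 0 = 0"
  by (induction n) auto

lemma gauss_map_funpow_nonzero:
  assumes "(gauss_map ^^ n) x \<noteq> 0" "m \<le> n"
  shows "(gauss_map ^^ m) x \<noteq> 0"
proof
  assume "(gauss_map ^^ m) x = 0"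
  moreover have "(gauss_map ^^ n) x = (gauss_map ^^ (n - m)) ((gauss_map ^^ m) x)"
    using assms(2) by (metis funpow_add le_add_diff_inverse2 o_apply)
  ultimately show False using assms(1) by simp
qed

lemma gauss_map_funpow_range:
  assumes "0 \<le> x" "x < 1"
  shows "0 \<le> (gauss_map ^^ n) x \<and> (gauss_map ^^ n) x < 1"
  using assms by (cases n) (auto simp: gauss_map_range)

definition cf_word :: "real \<Rightarrow> nat \<Rightarrow> nat list" where
  "cf_word \<rho> s = map (\<lambda>i. cf_digit \<rho> (int (Suc i))) [0..<s]"

lemma cf_word_Suc: "cf_word \<rho> (Suc s) = cf_digit \<rho> 1 # cf_word (gauss_map \<rho>) s"
proof -
  have "map (\<lambda>i. cf_digit \<rho> (int (Suc i))) [0..<Suc s] = cf_digit \<rho> 1 # map (\<lambda>i. cf_digit \<rho> (int (Suc (Suc i)))) [0..<s]"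
    by (simp only: upt_conv_Cons[OF zero_less_Suc] map_Suc_upt[symmetric] map_map o_def list.map) simp
  then show ?thesis unfolding cf_word_def
    using cf_digit_Suc[of "int (Suc i)" \<rho> for i] by (simp add: algebra_simps)
qed

text \<open>Converse to reading the digits off a word. A nonzero image after \<open>s\<close> steps
  means that the expansion has not ended by then, a genuine condition for rational
  \<open>\<rho>\<close>.\<close>

lemma cf_word_expansion:
  assumes "0 \<le> \<rho>" "\<rho> < 1" "(gauss_map ^^ s) \<rho> \<noteq> 0"
  shows "pos_word (cf_word \<rho> s) \<and> \<rho> = cfe (cf_word \<rho> s) ((gauss_map ^^ s) \<rho>)"
  using assms
proof (induction s arbitrary: \<rho>)
  case 0
  then show ?case by (simp add: cf_word_def)
next
  case (Suc s)
  have nz: "\<rho> \<noteq> 0" using gauss_map_funpow_nonzero[OF Suc.prems(3), of 0] by simp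
  with Suc.prems have r: "0 < \<rho>" "\<rho> < 1" by auto
  have "1 \<le> 1 / \<rho>" using r by (simp add: field_simps)
  then have "1 \<le> \<lfloor>1 / \<rho>\<rfloor>" by simp
  moreover from this have "real (nat \<lfloor>1 / \<rho>\<rfloor>) = real_of_int \<lfloor>1 / \<rho>\<rfloor>"
    by (intro of_nat_nat) linarith
  ultimately have d: "cf_digit \<rho> 1 > 0" "real (cf_digit \<rho> 1) + gauss_map \<rho> = 1 / \<rho>"
    by (simp_all add: cf_digit_def gauss_map_def frac_def)
  have "pos_word (cf_word (gauss_map \<rho>) s) \<and> gauss_map \<rho> = cfe (cf_word (gauss_map \<rho>) s) ((gauss_map ^^ s) (gauss_map \<rho>))"
    using Suc.prems(3) by (intro Suc.IH gauss_map_range) (simp add: funpow_swap1)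
  then show ?case using d nz by (simp add: cf_word_Suc funpow_swap1)
qed

lemma length_cf_word [simp]: "length (cf_word \<rho> s) = s"
  by (simp add: cf_word_def)

text \<open>The Euclidean algorithm for \<open>(a, b)\<close> yields the word from its last digit
  backwards, the quotient \<open>b div a\<close> being appended last. The free choice of parity
  comes from the final division: for \<open>a = 1\<close> both \<open>[b]\<close> and
  \<open>[1, b - 1]\<close> have the right denominators.\<close>

lemma exists_word:
  fixes a b :: nat
  assumes "coprime a b" "0 < a" "a < b"
  shows "\<exists>w. pos_word w \<and> w \<noteq> [] \<and> even (length w) = e \<and> cden' w = a \<and> cden w = b"
  using assms
proof (induction b arbitrary: a e rule: less_induct)
  case (less b)
  show ?case
  proof (cases "a = 1")
    case True
    show ?thesis
    proof (cases e)
      case True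
      have "cden' [1, b - 1] = a \<and> cden [1, b - 1] = b" using \<open>a = 1\<close> less.prems by simp
      with True show ?thesis using less.prems by (intro exI[of _ "[1, b - 1]"]) auto
    next
      case False
      have "cden' [b] = a \<and> cden [b] = b" using \<open>a = 1\<close> by simp
      with False show ?thesis using less.prems by (intro exI[of _ "[b]"]) auto
    qed
  next
    case False
    have r0: "b mod a \<noteq> 0"
    proof
      assume "b mod a = 0"
      then have "a dvd b" by auto
      with less.prems(1) have "a = 1" using coprime_common_divisor_nat[of a b a] by simp
      with False show False by simp
    qed
    have "coprime (b mod a) a" using less.prems(1) less.prems(2) coprime_commute coprime_mod_left_iff[of a b] by blast
    then obtain w where w: "pos_word w" "w \<noteq> []" "even (length w) = (\<not> e)" "cden' w = b mod a" "cden w = a"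
      using less.IH[of a "b mod a" "\<not> e"] less.prems r0 by auto
    have "b div a > 0" using less.prems by (simp add: div_greater_zero_iff)
    then show ?thesis using w by (intro exI[of _ "w @ [b div a]"]) (simp add: cden_snoc)
  qed
qed

text \<open>The mirror formula: \<open>q(s-1) / q(s)\<close> has the digits of the word in reverse
  order. It makes the digits up to index \<open>s\<close> a function of the ratio
  \<open>u / v\<close>.\<close>

lemma cfe_rev_0:
  assumes "pos_word w"
  shows "cfe (rev w) 0 = real (cden' w) / real (cden w)"
  using assms
proof (induction w rule: rev_induct)
  case (snoc h w)
  have c: "0 < cden w" using snoc.prems by (intro cden_pos) auto
  then have "real h + cfe (rev w) 0 = (real h * real (cden w) + real (cden' w)) / real (cden w)"
    using snoc by (simp add: add_divide_distrib)
  then show ?case by (simp add: cden_snoc)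
qed simp

text \<open>A rational number has two expansions, so its first digit agrees with the word only away
  from the end. A nonzero image under the Gauss map excludes \<open>w = [h]\<close> and
  \<open>w = [h, 1]\<close>, and the remaining word then has a value strictly between 0 and
  1.\<close>

lemma cfe_0_Cons:
  assumes w: "pos_word w" "cfe w 0 \<noteq> 0" "gauss_map (cfe w 0) \<noteq> 0"
  obtains h w' where "w = h # w'" "w' \<noteq> []" "0 < cfe w' 0" "cfe w' 0 < 1"
proof -
  obtain h w' where w': "w = h # w'" using w by (cases w) auto
  have ne: "w' \<noteq> []"
  proof
    assume "w' = []"
    then have "gauss_map (cfe w 0) = frac (of_nat h)" by (simp add: w' gauss_map_def)
    then show False using w(3) frac_of_int[of "int h"] by simp
  qed
  then obtain h2 w2 where w2: "w' = h2 # w2" by (cases w') auto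
  have ge: "0 \<le> cfe v 0" for v by (induction v) auto
  have "1 \<le> real h2" using w(1) by (auto simp: w' w2)
  then have pos: "0 < cfe w' 0" "cfe w' 0 \<le> 1" using ge[of w2] by (auto simp: w2 field_simps)
  have "cfe w' 0 \<noteq> 1"
  proof
    assume "cfe w' 0 = 1"
    then have "gauss_map (cfe w 0) = frac (of_nat (Suc h))" by (simp add: w' gauss_map_def add.commute)
    then show False using w(3) frac_of_int[of "int (Suc h)"] by simp
  qed
  with pos w' ne show ?thesis by (intro that) auto
qed

text \<open>One nonzero image more than digits to be read keeps the ambiguous end of
  \<open>w\<close> out of sight. Reading \<open>k + 1\<close> digits this way is the origin of the
  index \<open>k + 1\<close> in \<open>good_dom\<close>.\<close>

lemma cf_digit_cfe_0:
  assumes "pos_word w" "\<And>i. i \<le> k + 1 \<Longrightarrow> (gauss_map ^^ i) (cfe w 0) \<noteq> 0"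
  shows "k + 1 < length w \<and> (\<forall>i\<le>k. cf_digit (cfe w 0) (int (Suc i)) = w ! i)"
  using assms
proof (induction k arbitrary: w)
  case 0
  obtain h w' where w': "w = h # w'" "w' \<noteq> []" "0 < cfe w' 0" "cfe w' 0 < 1"
    using cfe_0_Cons[of w] 0(1) 0(2)[of 0] 0(2)[of 1] by auto
  have "\<lfloor>1 / cfe w 0\<rfloor> = int h" using gauss_map_cfe_Cons(2)[OF w'(3,4)] by (simp add: w'(1))
  then show ?case using w' by (simp add: cf_digit_def)
next
  case (Suc k)
  obtain h w' where w': "w = h # w'" "w' \<noteq> []" "0 < cfe w' 0" "cfe w' 0 < 1"
    using cfe_0_Cons[of w] Suc.prems(1) Suc.prems(2)[of 0] Suc.prems(2)[of 1] by auto
  have g: "gauss_map (cfe w 0) = cfe w' 0" using gauss_map_cfe_Cons(1)[OF w'(3,4)] by (simp add: w'(1))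
  have IH: "k + 1 < length w' \<and> (\<forall>i\<le>k. cf_digit (cfe w' 0) (int (Suc i)) = w' ! i)"
  proof (rule Suc.IH)
    show "pos_word w'" using Suc.prems w' by auto
    show "(gauss_map ^^ i) (cfe w' 0) \<noteq> 0" if "i \<le> k + 1" for i
      using Suc.prems(2)[of "Suc i"] that by (simp add: funpow_Suc_right g del: funpow.simps)
  qed
  have "cf_digit (cfe w 0) (int (Suc i)) = w ! i" if "i \<le> Suc k" for i
  proof (cases i)
    case 0
    have "\<lfloor>1 / cfe w 0\<rfloor> = int h" using gauss_map_cfe_Cons(2)[OF w'(3,4)] by (simp add: w'(1))
    then show ?thesis by (simp add: cf_digit_def 0 w'(1))
  next
    case (Suc j)
    have "cf_digit (cfe w 0) (int (Suc j) + 1) = cf_digit (cfe w' 0) (int (Suc j))"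
      using cf_digit_Suc[of "int (Suc j)" "cfe w 0"] by (simp add: g)
    moreover have "int (Suc j) + 1 = int (Suc i)" by (simp add: Suc)
    ultimately show ?thesis using IH that by (simp add: Suc w'(1))
  qed
  then show ?case using IH w' by auto
qed

section \<open>A sieve for greatest common divisors\<close>

definition moebius_mu :: "nat \<Rightarrow> int" where
  "moebius_mu n = (if squarefree n then (-1) ^ card (prime_factors n) else 0)"

lemma abs_moebius_mu: "\<bar>moebius_mu n\<bar> \<le> 1"
  by (simp add: moebius_mu_def power_abs)

lemma moebius_mu_mult_prime:
  assumes "prime p" "\<not> p dvd n" "n > 0"
  shows "moebius_mu (p * n) = - moebius_mu n"
proof -
  have cop: "coprime p n" using assms by (simp add: prime_imp_coprime)
  have sf: "squarefree (p * n) \<longleftrightarrow> squarefree n"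
    using squarefree_mult_coprime[OF cop squarefree_prime[OF assms(1)]] squarefree_multD(2)[of p n] by (rule iffI[rotated])
  have "p \<noteq> 0" using prime_gt_0_nat[OF assms(1)] by simp
  then have pf: "prime_factors (p * n) = insert p (prime_factors n)"
    using assms prime_factors_product[of p n] prime_prime_factors[of p] by simp
  have "p \<notin> prime_factors n" using assms by (simp add: in_prime_factors_iff)
  then have "card (insert p (prime_factors n)) = Suc (card (prime_factors n))" by simp
  then show ?thesis unfolding moebius_mu_def sf pf by simp
qed

text \<open>For a prime \<open>p\<close> dividing \<open>n\<close>, the divisors prime to
  \<open>p\<close> cancel against their products with \<open>p\<close>; the divisors left over are
  multiples of \<open>p\<^sup>2\<close> and contribute nothing.\<close>

lemma sum_moebius_mu_divisors:
  assumes "n > 0"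
  shows "(\<Sum>d | d dvd n. moebius_mu d) = (if n = 1 then 1 else 0)"
proof (cases "n = 1")
  case True
  then have "{d. d dvd n} = {1}" by auto
  then show ?thesis using True by (simp add: moebius_mu_def)
next
  case False
  with assms obtain p where p: "prime p" "p dvd n" using prime_factor_nat by blast
  have fin: "finite {d. d dvd n}" using assms by simp
  define A where "A = {d. d dvd n \<and> \<not> p dvd d}"
  define B where "B = {d. d dvd n \<and> p dvd d}"
  have "(\<Sum>d\<in>B. moebius_mu d) = (\<Sum>d\<in>(\<lambda>d. p * d) ` {d \<in> A. p * d dvd n}. moebius_mu d)"
  proof (rule sum.mono_neutral_right)
    show "finite B" using fin by (simp add: B_def)
    show "(\<lambda>d. p * d) ` {d \<in> A. p * d dvd n} \<subseteq> B" by (auto simp: B_def)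
    show "\<forall>d\<in>B - (\<lambda>d. p * d) ` {d \<in> A. p * d dvd n}. moebius_mu d = 0"
    proof
      fix d assume d: "d \<in> B - (\<lambda>d. p * d) ` {d \<in> A. p * d dvd n}"
      then have "p dvd d" "d dvd n" by (simp_all add: B_def)
      then obtain e where e: "d = p * e" by (elim dvdE)
      have "e dvd n" using \<open>d dvd n\<close> unfolding e by (rule dvd_mult_right)
      have "p dvd e"
      proof (rule ccontr)
        assume "\<not> p dvd e"
        then have "e \<in> {d \<in> A. p * d dvd n}" using \<open>e dvd n\<close> \<open>d dvd n\<close> e by (simp add: A_def)
        then show False using d e by blast
      qed
      then have "p ^ 2 dvd d" by (simp add: e power2_eq_square mult_dvd_mono)
      then have "\<not> squarefree d" using p(1) squarefreeD[of d p] not_prime_unit[of p] by blast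
      then show "moebius_mu d = 0" by (simp add: moebius_mu_def)
    qed
  qed
  also have "{d \<in> A. p * d dvd n} = A"
  proof -
    have "p * d dvd n" if "d \<in> A" for d
      using that p prime_imp_coprime[of p d] divides_mult[of p n d] by (simp add: A_def)
    then show ?thesis by auto
  qed
  also have "(\<Sum>d\<in>(\<lambda>d. p * d) ` A. moebius_mu d) = (\<Sum>d\<in>A. moebius_mu (p * d))"
    using prime_gt_0_nat[OF p(1)] by (subst sum.reindex) (simp_all add: inj_on_def)
  also have "\<dots> = (\<Sum>d\<in>A. - moebius_mu d)"
    using p assms dvd_pos_nat[of n] by (intro sum.cong refl moebius_mu_mult_prime) (simp_all add: A_def)
  finally have "(\<Sum>d\<in>B. moebius_mu d) + (\<Sum>d\<in>A. moebius_mu d) = 0" by (simp add: sum_negf)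
  moreover have "{d. d dvd n} = B \<union> A" by (auto simp: A_def B_def)
  moreover have "finite A" "finite B" "B \<inter> A = {}" using fin by (auto simp: A_def B_def)
  ultimately show ?thesis using False by (simp add: sum.union_disjoint)
qed

lemma sums_inverse_squares_Suc: "(\<lambda>n. 1 / (real (Suc n))\<^sup>2) sums (pi\<^sup>2 / 6)"
  using inverse_squares_sums by (simp add: add.commute)

lemma summable_moebius_mu: "summable (\<lambda>e. real_of_int (moebius_mu (Suc e)) * (1 / (real (Suc e))\<^sup>2))"
proof (rule summable_comparison_test')
  show "summable (\<lambda>e. 1 / (real (Suc e))\<^sup>2)" using sums_inverse_squares_Suc by (rule sums_summable)
  show "norm (real_of_int (moebius_mu (Suc e)) * (1 / (real (Suc e))\<^sup>2)) \<le> 1 / (real (Suc e))\<^sup>2" for e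
  proof -
    have "\<bar>real_of_int (moebius_mu (Suc e))\<bar> \<le> 1" using abs_moebius_mu[of "Suc e"] by linarith
    then show ?thesis by (simp add: abs_mult mult_left_le_one_le divide_right_mono)
  qed
qed

text \<open>Moebius inversion, written as an infinite series with finitely many nonzero terms, so
  that limits can be taken termwise by dominated convergence.\<close>

lemma card_coprime_eq_suminf:
  fixes g :: "'a \<Rightarrow> nat"
  assumes "finite S" "\<And>x. x \<in> S \<Longrightarrow> g x > 0"
  shows "(\<lambda>e. real_of_int (moebius_mu (Suc e)) * real (card {x\<in>S. Suc e dvd g x})) sums real (card {x\<in>S. g x = 1})"
proof -
  define M where "M = Max (insert 0 (g ` S))"
  have M: "g x \<le> M" if "x \<in> S" for x using that assms(1) by (auto simp: M_def)
  have dv: "{d. d dvd g x} = Suc ` {e. e < M \<and> Suc e dvd g x}" if "x \<in> S" for x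
  proof (intro equalityI subsetI)
    fix d assume d: "d \<in> {d. d dvd g x}"
    then have "0 < d" "d \<le> g x" using assms(2)[OF that] by (auto intro: dvd_imp_le Nat.gr0I)
    then show "d \<in> Suc ` {e. e < M \<and> Suc e dvd g x}"
      using M[OF that] d by (intro image_eqI[of _ _ "d - 1"]) auto
  qed auto
  have "(\<Sum>e<M. moebius_mu (Suc e) * int (card {x\<in>S. Suc e dvd g x})) =
      (\<Sum>e<M. \<Sum>x\<in>S. if Suc e dvd g x then moebius_mu (Suc e) else 0)"
    using assms(1) by (intro sum.cong refl) (simp add: sum.If_cases Int_def mult.commute)
  also have "\<dots> = (\<Sum>x\<in>S. \<Sum>e<M. if Suc e dvd g x then moebius_mu (Suc e) else 0)"
    by (rule sum.swap)
  also have "\<dots> = (\<Sum>x\<in>S. if g x = 1 then 1 else 0)"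
  proof (rule sum.cong)
    fix x assume x: "x \<in> S"
    have "(\<Sum>e<M. if Suc e dvd g x then moebius_mu (Suc e) else 0) = (\<Sum>e | e < M \<and> Suc e dvd g x. moebius_mu (Suc e))"
      by (simp add: sum.If_cases Int_def conj_commute)
    also have "\<dots> = (\<Sum>d | d dvd g x. moebius_mu d)"
      unfolding dv[OF x] by (simp add: sum.reindex)
    finally show "(\<Sum>e<M. if Suc e dvd g x then moebius_mu (Suc e) else 0) = (if g x = 1 then 1 else 0)"
      using sum_moebius_mu_divisors[OF assms(2)[OF x]] by simp
  qed simp
  also have "\<dots> = int (card {x\<in>S. g x = 1})"
    using assms(1) by (simp add: sum.If_cases Int_def)
  finally have "real_of_int (\<Sum>e<M. moebius_mu (Suc e) * int (card {x\<in>S. Suc e dvd g x})) = real (card {x\<in>S. g x = 1})"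
    by simp
  moreover have "(\<lambda>e. real_of_int (moebius_mu (Suc e)) * real (card {x\<in>S. Suc e dvd g x})) sums
     (\<Sum>e<M. real_of_int (moebius_mu (Suc e)) * real (card {x\<in>S. Suc e dvd g x}))"
  proof (rule sums_finite)
    fix e assume "e \<notin> {..<M}"
    then have none: "{x\<in>S. Suc e dvd g x} = {}" using M assms(2) by (force dest: dvd_imp_le)
    then show "real_of_int (moebius_mu (Suc e)) * real (card {x\<in>S. Suc e dvd g x}) = 0" unfolding none by simp
  qed simp
  ultimately show ?thesis by simp
qed

text \<open>With \<open>H\<close> the partial sums of the inverse squares, the series of
  \<open>\<mu>(e) / e\<^sup>2 * H (N div e)\<close> collects, for each \<open>k \<le> N\<close>, the
  sum of \<open>\<mu>(e)\<close> over the divisors of \<open>k\<close>, divided by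
  \<open>k\<^sup>2\<close>. It is therefore 1 for every \<open>N \<ge> 1\<close>, and letting
  \<open>N\<close> grow under the majorant \<open>1 / e\<^sup>2\<close> gives the reciprocal of
  \<open>pi\<^sup>2 / 6\<close>.\<close>

lemma suminf_moebius_mu: "(\<Sum>e. real_of_int (moebius_mu (Suc e)) * (1 / (real (Suc e))\<^sup>2)) = 6 / pi\<^sup>2"
proof -
  define H where "H n = (\<Sum>j<n. 1 / (real (Suc j))\<^sup>2)" for n
  define m where "m e = real_of_int (moebius_mu (Suc e)) * (1 / (real (Suc e))\<^sup>2)" for e
  define a where "a e N = m e * H (N div Suc e)" for e N
  have Hlim: "H \<longlonglongrightarrow> pi\<^sup>2 / 6"
    using sums_inverse_squares_Suc unfolding sums_def H_def .
  have Hle: "H n \<le> pi\<^sup>2 / 6" and H0: "0 \<le> H n" for n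
  proof -
    show "H n \<le> pi\<^sup>2 / 6" unfolding H_def
      unfolding sums_unique[OF sums_inverse_squares_Suc]
      using sum_le_suminf[OF sums_summable[OF sums_inverse_squares_Suc], of "{..<n}"] by simp
    show "0 \<le> H n" unfolding H_def by (intro sum_nonneg) simp
  qed
  have "(\<lambda>N. suminf (\<lambda>e. a e N)) \<longlonglongrightarrow> suminf (\<lambda>e. m e * (pi\<^sup>2 / 6))"
  proof (rule tannerys_theorem[THEN conjunct2, THEN conjunct2])
    fix e
    have "filterlim (\<lambda>N. N div Suc e) sequentially sequentially"
      unfolding filterlim_at_top
    proof
      fix Z
      have "eventually (\<lambda>N. Z * Suc e \<le> N) sequentially" by (rule eventually_ge_at_top)
      then show "eventually (\<lambda>N. Z \<le> N div Suc e) sequentially"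
        by eventually_elim (subst less_eq_div_iff_mult_less_eq, simp_all)
    qed
    then show "(\<lambda>N. a e N) \<longlonglongrightarrow> m e * (pi\<^sup>2 / 6)"
      unfolding a_def by (intro tendsto_mult_left filterlim_compose[OF Hlim])
  next
    show "summable (\<lambda>e. 1 / (real (Suc e))\<^sup>2 * (pi\<^sup>2 / 6))"
      using sums_inverse_squares_Suc by (intro summable_mult2) (rule sums_summable)
    have "norm (a e N) \<le> 1 / (real (Suc e))\<^sup>2 * (pi\<^sup>2 / 6)" for e N
    proof -
      have "\<bar>real_of_int (moebius_mu (Suc e))\<bar> \<le> 1" using abs_moebius_mu[of "Suc e"] by linarith
      then have "\<bar>m e\<bar> \<le> 1 / (real (Suc e))\<^sup>2"
        unfolding m_def by (simp add: abs_mult mult_left_le_one_le divide_right_mono)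
      then show ?thesis unfolding a_def real_norm_def abs_mult
        using H0 Hle by (intro mult_mono) auto
    qed
    then show "eventually (\<lambda>(e, N). norm (a e N) \<le> 1 / (real (Suc e))\<^sup>2 * (pi\<^sup>2 / 6)) (at_top \<times>\<^sub>F sequentially)"
      by (simp add: case_prod_unfold)
  qed simp
  moreover have "suminf (\<lambda>e. a e N) = 1" if "N \<ge> 1" for N
  proof -
    have "(\<Sum>e<N. a e N) = (\<Sum>e<N. \<Sum>k\<in>{1..N}. if Suc e dvd k then real_of_int (moebius_mu (Suc e)) / (real k)\<^sup>2 else 0)"
    proof (rule sum.cong)
      fix e assume "e \<in> {..<N}"
      have img: "{k \<in> {1..N}. Suc e dvd k} = (\<lambda>j. Suc e * Suc j) ` {..<N div Suc e}"
      proof (intro equalityI subsetI)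
        fix k assume k: "k \<in> {k \<in> {1..N}. Suc e dvd k}"
        then obtain j where j: "k = Suc e * j" by (auto elim: dvdE)
        then have "j \<ge> 1" using k by (cases j) auto
        moreover have "j \<le> N div Suc e" using k j
          by (subst less_eq_div_iff_mult_less_eq) (simp_all add: mult.commute)
        ultimately show "k \<in> (\<lambda>j. Suc e * Suc j) ` {..<N div Suc e}"
          using j by (intro image_eqI[of _ _ "j - 1"]) auto
      next
        fix k assume "k \<in> (\<lambda>j. Suc e * Suc j) ` {..<N div Suc e}"
        then obtain j where j: "k = Suc e * Suc j" "Suc j \<le> N div Suc e" by auto
        from j(2) have "Suc j * Suc e \<le> N" by (subst (asm) less_eq_div_iff_mult_less_eq) simp_all
        moreover have "Suc e dvd k" unfolding j(1) by (rule dvd_triv_left)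
        ultimately show "k \<in> {k \<in> {1..N}. Suc e dvd k}" using j(1) by (simp add: mult.commute)
      qed
      have "(\<Sum>k\<in>{1..N}. if Suc e dvd k then real_of_int (moebius_mu (Suc e)) / (real k)\<^sup>2 else 0)
          = (\<Sum>k\<in>{k \<in> {1..N}. Suc e dvd k}. real_of_int (moebius_mu (Suc e)) / (real k)\<^sup>2)"
        by (simp add: sum.If_cases Int_def)
      also have "\<dots> = (\<Sum>j<N div Suc e. real_of_int (moebius_mu (Suc e)) / (real (Suc e * Suc j))\<^sup>2)"
        unfolding img by (subst sum.reindex) (auto intro!: inj_onI simp del: of_nat_mult mult_Suc mult_Suc_right)
      also have "\<dots> = a e N"
        unfolding a_def m_def H_def sum_distrib_left of_nat_mult power_mult_distrib
        by (intro sum.cong) simp_all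
      finally show "a e N = (\<Sum>k\<in>{1..N}. if Suc e dvd k then real_of_int (moebius_mu (Suc e)) / (real k)\<^sup>2 else 0)" ..
    qed simp
    also have "\<dots> = (\<Sum>k\<in>{1..N}. \<Sum>e<N. if Suc e dvd k then real_of_int (moebius_mu (Suc e)) / (real k)\<^sup>2 else 0)"
      by (rule sum.swap)
    also have "\<dots> = (\<Sum>k\<in>{1..N}. if k = 1 then 1 else 0)"
    proof (rule sum.cong)
      fix k assume k: "k \<in> {1..N}"
      have dv: "{d. d dvd k} = Suc ` {e. e < N \<and> Suc e dvd k}"
      proof (intro equalityI subsetI)
        fix d assume d: "d \<in> {d. d dvd k}"
        then have "0 < d" "d \<le> k" using k by (auto intro: dvd_imp_le Nat.gr0I)
        then show "d \<in> Suc ` {e. e < N \<and> Suc e dvd k}"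
          using k d by (intro image_eqI[of _ _ "d - 1"]) auto
      qed auto
      have "(\<Sum>e<N. if Suc e dvd k then real_of_int (moebius_mu (Suc e)) / (real k)\<^sup>2 else 0)
          = (\<Sum>e | e < N \<and> Suc e dvd k. real_of_int (moebius_mu (Suc e)) / (real k)\<^sup>2)"
        by (simp add: sum.If_cases Int_def conj_commute)
      also have "\<dots> = real_of_int (\<Sum>d | d dvd k. moebius_mu d) / (real k)\<^sup>2"
        unfolding dv by (simp add: sum.reindex sum_divide_distrib)
      finally show "(\<Sum>e<N. if Suc e dvd k then real_of_int (moebius_mu (Suc e)) / (real k)\<^sup>2 else 0) = (if k = 1 then 1 else 0)"
        using k by (simp add: sum_moebius_mu_divisors del: of_int_sum)
    qed simp
    also have "\<dots> = 1" using that by (subst sum.delta) auto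
    finally have "(\<Sum>e<N. a e N) = 1" .
    moreover have "suminf (\<lambda>e. a e N) = (\<Sum>e<N. a e N)"
      by (rule suminf_finite) (auto simp: a_def H_def div_less)
    ultimately show ?thesis by simp
  qed
  then have "(\<lambda>N. suminf (\<lambda>e. a e N)) \<longlonglongrightarrow> 1"
    by (intro tendsto_eventually) (auto simp: eventually_sequentially)
  ultimately have "suminf (\<lambda>e. m e * (pi\<^sup>2 / 6)) = 1"
    by (rule LIMSEQ_unique)
  moreover have "suminf (\<lambda>e. m e * (pi\<^sup>2 / 6)) = suminf m * (pi\<^sup>2 / 6)"
    using summable_moebius_mu unfolding m_def[abs_def, symmetric] by (rule suminf_mult2[symmetric])
  ultimately show ?thesis unfolding m_def[abs_def] by (simp add: field_simps)
qed

text \<open>The densities \<open>1 / e\<^sup>2\<close> are asked for one fixed \<open>e\<close> at a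
  time. The bound has to hold for all \<open>e\<close> at once, also for those growing with
  \<open>i\<close>; being summable in \<open>e\<close>, it licenses the exchange of limit and
  series.\<close>

theorem sieve_tendsto:
  fixes S :: "'i \<Rightarrow> 'a set" and g :: "'i \<Rightarrow> 'a \<Rightarrow> nat"
  assumes F: "F \<noteq> bot"
    and fin: "eventually (\<lambda>i. finite (S i) \<and> (\<forall>x\<in>S i. g i x > 0)) F"
    and lim: "\<And>e. e \<ge> 1 \<Longrightarrow> ((\<lambda>i. real (card {x\<in>S i. e dvd g i x}) / c i) \<longlongrightarrow> \<kappa> * (1 / (real e)\<^sup>2)) F"
    and bound: "eventually (\<lambda>i. c i > 0 \<and> (\<forall>e\<ge>1. real (card {x\<in>S i. e dvd g i x}) \<le> K * c i / (real e)\<^sup>2)) F"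
  shows "((\<lambda>i. real (card {x\<in>S i. g i x = 1}) / c i) \<longlongrightarrow> \<kappa> * (6 / pi\<^sup>2)) F"
proof -
  define a where "a e i = real_of_int (moebius_mu (Suc e)) * (real (card {x\<in>S i. Suc e dvd g i x}) / c i)" for e i
  define b where "b e = real_of_int (moebius_mu (Suc e)) * (\<kappa> * (1 / (real (Suc e))\<^sup>2))" for e
  have "((\<lambda>i. suminf (\<lambda>e. a e i)) \<longlongrightarrow> suminf b) F"
  proof (rule tannerys_theorem[THEN conjunct2, THEN conjunct2])
    show "((\<lambda>i. a e i) \<longlongrightarrow> b e) F" for e
      unfolding a_def b_def by (intro tendsto_mult_left lim) simp
    show "summable (\<lambda>e. K * (1 / (real (Suc e))\<^sup>2))"
      using sums_inverse_squares_Suc by (intro summable_mult) (rule sums_summable)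
    have "eventually (\<lambda>i. \<forall>e. norm (a e i) \<le> K * (1 / (real (Suc e))\<^sup>2)) F"
      using bound
    proof eventually_elim
      case (elim i)
      show ?case
      proof
        fix e
        have "\<bar>real_of_int (moebius_mu (Suc e))\<bar> \<le> 1" using abs_moebius_mu[of "Suc e"] by linarith
        then have "norm (a e i) \<le> 1 * (real (card {x\<in>S i. Suc e dvd g i x}) / c i)"
          unfolding a_def using elim by (simp only: norm_mult real_norm_def abs_mult) (intro mult_mono, auto)
        also have "\<dots> \<le> K * (1 / (real (Suc e))\<^sup>2)"
          using elim[THEN conjunct2, rule_format, of "Suc e"] elim by (simp add: field_simps)
        finally show "norm (a e i) \<le> K * (1 / (real (Suc e))\<^sup>2)" .
      qed
    qed
    then show "eventually (\<lambda>(e, i). norm (a e i) \<le> K * (1 / (real (Suc e))\<^sup>2)) (at_top \<times>\<^sub>F F)"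
      unfolding eventually_prod_filter
      by (intro exI[of _ "\<lambda>_. True"] exI[of _ "\<lambda>i. \<forall>e. norm (a e i) \<le> K * (1 / (real (Suc e))\<^sup>2)"]) simp
  qed (rule F)
  moreover have "suminf b = \<kappa> * (6 / pi\<^sup>2)"
    unfolding b_def suminf_moebius_mu[symmetric] using summable_moebius_mu
    by (subst suminf_mult[symmetric]) (auto simp: algebra_simps)
  moreover have "eventually (\<lambda>i. suminf (\<lambda>e. a e i) = real (card {x\<in>S i. g i x = 1}) / c i) F"
    using fin
  proof eventually_elim
    case (elim i)
    have "(\<lambda>e. real_of_int (moebius_mu (Suc e)) * real (card {x\<in>S i. Suc e dvd g i x}) / c i)
        sums (real (card {x\<in>S i. g i x = 1}) / c i)"
      by (rule sums_divide) (rule card_coprime_eq_suminf, use elim in auto)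
    then show ?case by (simp add: a_def sums_iff)
  qed
  ultimately show ?thesis by (simp add: tendsto_cong)
qed

section \<open>Counting lattice points\<close>

definition int_in :: "real \<Rightarrow> real \<Rightarrow> real \<Rightarrow> int set" where
  "int_in R a b = {k. R * a < real_of_int k \<and> real_of_int k < R * b}"

lemma int_in_eq: "int_in R a b = {\<lfloor>R * a\<rfloor> + 1..<\<lceil>R * b\<rceil>}"
  unfolding int_in_def by (auto simp: floor_less_iff less_ceiling_iff)  linarith+

lemma finite_int_in [simp]: "finite (int_in R a b)"
  by (simp add: int_in_eq)

lemma card_int_in:
  assumes "0 < R" "a < b"
  shows "\<bar>real (card (int_in R a b)) - R * (b - a)\<bar> \<le> 1"
proof -
  have "R * a < R * b" using assms by simp
  then have "\<lfloor>R * a\<rfloor> + 1 \<le> \<lceil>R * b\<rceil>" by linarith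
  then have "real (card (int_in R a b)) = real_of_int (\<lceil>R * b\<rceil> - (\<lfloor>R * a\<rfloor> + 1))"
    by (simp add: int_in_eq)
  moreover have "R * b \<le> \<lceil>R * b\<rceil>" "\<lceil>R * b\<rceil> < R * b + 1" "\<lfloor>R * a\<rfloor> \<le> R * a" "R * a < \<lfloor>R * a\<rfloor> + 1" by linarith+
  ultimately show ?thesis unfolding abs_le_iff right_diff_distrib of_int_diff of_int_add by linarith
qed

lemma dvd_nat_gcd_iff: "e dvd nat (gcd i j) \<longleftrightarrow> int e dvd i \<and> int e dvd j"
  unfolding int_dvd_int_iff[symmetric] by simp

lemma card_int_in_tendsto:
  assumes "a < b"
  shows "((\<lambda>R. real (card (int_in R a b)) / R) \<longlongrightarrow> b - a) at_top"
proof (rule Lim_transform_eventually)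
  have ev: "eventually (\<lambda>R. norm (real (card (int_in R a b)) / R - (b - a)) \<le> 1 / R) at_top"
    using eventually_gt_at_top[of "0::real"]
  proof eventually_elim
    case (elim R)
    have "real (card (int_in R a b)) / R - (b - a) = (real (card (int_in R a b)) - R * (b - a)) / R"
      using elim by (simp add: field_simps)
    then show ?case using card_int_in[OF elim assms] elim by (simp add: divide_right_mono)
  qed
  have "((\<lambda>R. 1 / R) \<longlongrightarrow> (0::real)) at_top"
    using tendsto_inverse_0_at_top[OF filterlim_ident] by (simp add: divide_inverse)
  from Lim_null_comparison[OF ev this]
  show "((\<lambda>R. (real (card (int_in R a b)) / R - (b - a)) + (b - a)) \<longlongrightarrow> b - a) at_top"
    using tendsto_add[of "\<lambda>R. real (card (int_in R a b)) / R - (b - a)" 0 at_top "\<lambda>_. b - a" "b - a"] by simp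
qed simp

lemma card_int_in_dvd:
  assumes "e > (0::int)"
  shows "card {k \<in> int_in R a b. e dvd k} = card (int_in (R / real_of_int e) a b)"
proof -
  have "{k \<in> int_in R a b. e dvd k} = (\<lambda>j. e * j) ` int_in (R / real_of_int e) a b"
    using assms by (auto simp: int_in_def field_simps image_iff elim!: dvdE)
  then show ?thesis using assms by (simp add: card_image inj_on_def)
qed

text \<open>For \<open>a \<ge> 0\<close> only positive integers are counted, so there is no additive
  error. The bound thus survives scales below 1, which occur after division of the scale by a large
  \<open>e\<close>.\<close>

lemma card_int_in_le:
  assumes "0 \<le> a" "0 \<le> R"
  shows "real (card (int_in R a b)) \<le> max 0 (R * b)"
proof -
  have "int_in R a b \<subseteq> {1..\<lfloor>max 0 (R * b)\<rfloor>}"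
  proof
    fix k assume k: "k \<in> int_in R a b"
    have "0 \<le> R * a" using assms by simp
    then have "0 < real_of_int k" using k by (simp add: int_in_def)
    then show "k \<in> {1..\<lfloor>max 0 (R * b)\<rfloor>}" using k by (auto simp: int_in_def le_floor_iff)
  qed
  then have "card (int_in R a b) \<le> card {1..\<lfloor>max 0 (R * b)\<rfloor>}" by (intro card_mono) auto
  also have "real \<dots> \<le> max 0 (R * b)" by (simp add: of_nat_nat)
  finally show ?thesis by simp
qed

section \<open>Coprime pairs in a dilated rectangle\<close>

definition prim_pairs :: "real \<Rightarrow> real \<Rightarrow> real \<Rightarrow> real \<Rightarrow> real \<Rightarrow> (int \<times> int) set" where
  "prim_pairs R a b c d = {(i, j) \<in> int_in R a b \<times> int_in R c d. coprime i j}"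

lemma finite_prim_pairs [simp]: "finite (prim_pairs R a b c d)"
  unfolding prim_pairs_def by (rule finite_subset[of _ "int_in R a b \<times> int_in R c d"]) auto

text \<open>The sieve applied to the gcd: the pairs divisible by \<open>e\<close> correspond to all
  pairs at scale \<open>R / e\<close>, whence the density \<open>1 / e\<^sup>2\<close>. Strict lower
  ends that are at least 0 keep the gcd positive.\<close>

theorem card_prim_pairs_tendsto:
  assumes "0 \<le> a" "a < b" "0 \<le> c" "c < d"
  shows "((\<lambda>R. real (card (prim_pairs R a b c d)) / R\<^sup>2) \<longlongrightarrow> (b - a) * (d - c) * (6 / pi\<^sup>2)) at_top"
proof -
  let ?S = "\<lambda>R. int_in R a b \<times> int_in R c d"
  let ?g = "\<lambda>R (i, j). nat (gcd i j)"
  have Ae: "card {x \<in> ?S R. e dvd ?g R x} = card (int_in (R / real e) a b) * card (int_in (R / real e) c d)"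
    if "e \<ge> 1" for e :: nat and R :: real
  proof -
    have "{x \<in> ?S R. e dvd ?g R x} = {k \<in> int_in R a b. int e dvd k} \<times> {k \<in> int_in R c d. int e dvd k}"
      by (auto simp: dvd_nat_gcd_iff)
    then show ?thesis using that card_int_in_dvd[of "int e" R] by (simp add: card_cartesian_product)
  qed
  have pos: "0 < k" if "k \<in> int_in R a' b'" "0 \<le> a'" "0 < R" for k a' b' R
  proof -
    have "0 \<le> R * a'" using that by simp
    moreover have "R * a' < real_of_int k" using that by (simp add: int_in_def)
    ultimately have "0 < real_of_int k" by linarith
    then show ?thesis by simp
  qed
  have "((\<lambda>R. real (card {x \<in> ?S R. ?g R x = 1}) / R\<^sup>2) \<longlongrightarrow> ((b - a) * (d - c)) * (6 / pi\<^sup>2)) at_top"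
  proof (rule sieve_tendsto)
    show "eventually (\<lambda>R. finite (?S R) \<and> (\<forall>x\<in>?S R. ?g R x > 0)) at_top"
      using eventually_gt_at_top[of "0::real"]
    proof eventually_elim
      case (elim R)
      have "0 < gcd i j" if "i \<in> int_in R a b" for i j :: int
        using pos[OF that] assms elim by simp
      then show ?case by auto
    qed
    show "((\<lambda>R. real (card {x \<in> ?S R. e dvd ?g R x}) / R\<^sup>2) \<longlongrightarrow> ((b - a) * (d - c)) * (1 / (real e)\<^sup>2)) at_top"
      if e: "e \<ge> 1" for e :: nat
    proof -
      have fl: "filterlim (\<lambda>R::real. R / real e) at_top at_top"
        using e filterlim_tendsto_pos_mult_at_top[OF tendsto_const[of "1 / real e"] _ filterlim_ident] by simp
      have "((\<lambda>R. (real (card (int_in (R / real e) a b)) / (R / real e)) * (real (card (int_in (R / real e) c d)) / (R / real e)) * (1 / (real e)\<^sup>2))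
          \<longlongrightarrow> (b - a) * (d - c) * (1 / (real e)\<^sup>2)) at_top"
        by (intro tendsto_mult_right tendsto_mult filterlim_compose[OF card_int_in_tendsto fl] assms)
      then show ?thesis
        by (rule Lim_transform_eventually) (use e in \<open>auto simp: Ae power2_eq_square field_simps\<close>)
    qed
    show "eventually (\<lambda>R. R\<^sup>2 > 0 \<and> (\<forall>e\<ge>1. real (card {x \<in> ?S R. e dvd ?g R x}) \<le> (b * d) * R\<^sup>2 / (real e)\<^sup>2)) at_top"
      using eventually_gt_at_top[of "0::real"]
    proof eventually_elim
      case (elim R)
      have "real (card {x \<in> ?S R. e dvd ?g R x}) \<le> (b * d) * R\<^sup>2 / (real e)\<^sup>2" if e: "e \<ge> 1" for e :: nat
      proof -
        have "0 \<le> R / real e * b" "0 \<le> R / real e * d" using elim assms by auto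
        then have "real (card (int_in (R / real e) a b)) * real (card (int_in (R / real e) c d)) \<le> (R / real e * b) * (R / real e * d)"
          using card_int_in_le[of a "R / real e" b] card_int_in_le[of c "R / real e" d] assms elim
          by (intro mult_mono) auto
        then show ?thesis using e by (simp add: Ae power2_eq_square field_simps)
      qed
      then show ?case using elim by simp
    qed
  qed auto
  moreover have "{x \<in> ?S R. ?g R x = 1} = prim_pairs R a b c d" for R
    by (auto simp: prim_pairs_def coprime_iff_gcd_eq_1)
  ultimately show ?thesis by simp
qed

section \<open>Linear congruences with coprime coefficients\<close>

lemma abs_diff_le_trans: "\<bar>u - v\<bar> \<le> d \<Longrightarrow> \<bar>v - w\<bar> \<le> d' \<Longrightarrow> \<bar>u - w\<bar> \<le> d' + d" for u v w d d' :: real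
  by linarith

lemma sum_period_shift:
  fixes f :: "int \<Rightarrow> real"
  assumes per: "\<And>k. f (k + e) = f k" and e: "e > 0"
  shows "(\<Sum>k\<in>{i..<i + e}. f k) = (\<Sum>k\<in>{0..<e}. f k)"
proof -
  have step: "(\<Sum>k\<in>{i + 1..<i + 1 + e}. f k) = (\<Sum>k\<in>{i..<i + e}. f k)" for i
  proof -
    have "{i..<i + e} = insert i {i + 1..<i + e}" "{i + 1..<i + 1 + e} = insert (i + e) {i + 1..<i + e}"
      using e by auto
    then show ?thesis by (simp add: per)
  qed
  show ?thesis
  proof (induction i rule: int_induct[where k = 0])
    case (step1 i) then show ?case using step[of i] by simp
  next
    case (step2 i) then show ?case using step[of "i - 1"] by simp
  qed simp
qed

lemma sum_period_shift':
  fixes f :: "int \<Rightarrow> real"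
  assumes per: "\<And>k. f (k + e) = f k" and e: "e > 0"
  shows "(\<Sum>k\<in>{0..<e}. f (k + c)) = (\<Sum>k\<in>{0..<e}. f k)"
proof -
  have "(\<Sum>k\<in>{0..<e}. f (k + c)) = (\<Sum>k\<in>{c..<c + e}. f k)"
    by (rule sum.reindex_bij_witness[of _ "\<lambda>k. k - c" "\<lambda>k. k + c"]) auto
  then show ?thesis using sum_period_shift[of f e c, OF assms] by simp
qed

text \<open>A run of \<open>n\<close> integers consists of full periods and a remainder shorter than
  \<open>e\<close>; the remainder and the fraction of a period replacing it both lie between 0 and
  \<open>e * B\<close>.\<close>

lemma sum_run_periodic:
  fixes f :: "int \<Rightarrow> real"
  assumes per: "\<And>k. f (k + e) = f k" and e: "e > 0" and f: "\<And>k. 0 \<le> f k" "\<And>k. f k \<le> B"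
  shows "\<bar>(\<Sum>k\<in>{i..<i + int n}. f k) - real n / real_of_int e * (\<Sum>k\<in>{0..<e}. f k)\<bar> \<le> real_of_int e * B"
proof -
  define T where "T = (\<Sum>k\<in>{0..<e}. f k)"
  define r where "r = int n mod e"
  have blocks: "(\<Sum>k\<in>{i..<i + e * int m}. f k) = real m * T" for m
  proof (induction m)
    case (Suc m)
    have "0 \<le> e * int m" using e by simp
    moreover have "i + e * int (Suc m) = i + e * int m + e" by (simp add: algebra_simps)
    ultimately have "{i..<i + e * int (Suc m)} = {i..<i + e * int m} \<union> {i + e * int m..<i + e * int m + e}"
      using ivl_disj_un_two(3)[of i "i + e * int m" "i + e * int m + e"] e by (simp add: add.assoc del: of_nat_Suc)
    moreover have "{i..<i + e * int m} \<inter> {i + e * int m..<i + e * int m + e} = {}" by auto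
    ultimately show ?case
      using Suc sum_period_shift[of f e "i + e * int m", OF per e]
      by (simp add: sum.union_disjoint T_def algebra_simps)
  qed simp
  obtain m where m: "int n = e * int m + r"
    using e mult_div_mod_eq[of e "int n"] unfolding r_def
    by (metis pos_imp_zdiv_nonneg_iff nonneg_int_cases of_nat_0_le_iff)
  have r: "0 \<le> r" "r < e" unfolding r_def using e by auto
  have "{i..<i + int n} = {i..<i + e * int m} \<union> {i + e * int m..<i + e * int m + r}"
    using ivl_disj_un_two(3)[of i "i + e * int m" "i + e * int m + r"] r(1) e by (simp add: m add.assoc)
  moreover have "{i..<i + e * int m} \<inter> {i + e * int m..<i + e * int m + r} = {}" by auto
  ultimately have sum: "(\<Sum>k\<in>{i..<i + int n}. f k) = real m * T + (\<Sum>k\<in>{i + e * int m..<i + e * int m + r}. f k)"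
    using blocks by (simp add: sum.union_disjoint)
  have "real n / real_of_int e * T = real m * T + real_of_int r / real_of_int e * T"
  proof -
    have "real n = real_of_int e * real m + real_of_int r" using m by (metis of_int_add of_int_mult of_int_of_nat_eq)
    then show ?thesis using e by (simp add: field_simps)
  qed
  moreover have "0 \<le> (\<Sum>k\<in>{i + e * int m..<i + e * int m + r}. f k)" using f by (intro sum_nonneg)
  moreover have "(\<Sum>k\<in>{i + e * int m..<i + e * int m + r}. f k) \<le> real_of_int r * B"
    using sum_bounded_above[of "{i + e * int m..<i + e * int m + r}" f B] f r by simp
  moreover have "0 \<le> T" unfolding T_def using f by (intro sum_nonneg)
  moreover have "T \<le> real_of_int e * B"
    unfolding T_def using sum_bounded_above[of "{0..<e}" f B] f e by simp
  moreover have "0 \<le> B" using f by (meson order_trans)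
  moreover have "real_of_int r / real_of_int e * T \<le> real_of_int r * B"
  proof -
    have "real_of_int r / real_of_int e * T \<le> real_of_int r / real_of_int e * (real_of_int e * B)"
      using \<open>T \<le> _\<close> r e by (intro mult_left_mono) auto
    then show ?thesis using e by simp
  qed
  moreover have "0 \<le> real_of_int r / real_of_int e * T" using \<open>0 \<le> T\<close> r e by simp
  moreover have "real_of_int r * B \<le> real_of_int e * B" using r \<open>0 \<le> B\<close> by (intro mult_right_mono) auto
  ultimately show ?thesis unfolding sum T_def[symmetric] by linarith
qed

text \<open>Let \<open>F j\<close> count the solutions with \<open>j\<close> added to the form.
  Translating \<open>(x, y)\<close> by \<open>j\<close> times a Bezout vector shows that
  \<open>F j\<close> does not depend on \<open>j\<close>, and the \<open>e\<close> values together
  count all \<open>e\<^sup>2\<close> pairs.\<close>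

lemma card_solutions_mod:
  fixes e p q :: int
  assumes "coprime p q" "e > 0"
  shows "(\<Sum>x\<in>{0..<e}. \<Sum>y\<in>{0..<e}. of_bool (e dvd x * q + y * p) :: real) = real_of_int e"
proof -
  obtain s r where rs: "s * p + r * q = 1" using bezout_int[of p q] assms(1) by auto
  define F where "F j = (\<Sum>x\<in>{0..<e}. \<Sum>y\<in>{0..<e}. of_bool (e dvd x * q + y * p + j) :: real)" for j
  have per: "of_bool (e dvd (k + e) * a + b) = (of_bool (e dvd k * a + b) :: real)" for k a b
  proof -
    have "(k + e) * a + b = (k * a + b) + e * a" by (simp add: algebra_simps)
    then show ?thesis by (simp only: dvd_add_times_triv_right_iff mult.commute[of e a])
  qed
  have "F j = F 0" for j
  proof -
    have "F j = (\<Sum>x\<in>{0..<e}. \<Sum>y\<in>{0..<e}. of_bool (e dvd (x + j * r) * q + (y + j * s) * p))"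
    proof -
      have "x * q + y * p + j = (x + j * r) * q + (y + j * s) * p" for x y
      proof -
        have "j = j * (s * p + r * q)" using rs by simp
        then show ?thesis by (simp add: algebra_simps)
      qed
      then show ?thesis unfolding F_def by simp
    qed
    also have "\<dots> = (\<Sum>x\<in>{0..<e}. \<Sum>y\<in>{0..<e}. of_bool (e dvd (x + j * r) * q + y * p))"
    proof (rule sum.cong)
      fix x
      show "(\<Sum>y\<in>{0..<e}. of_bool (e dvd (x + j * r) * q + (y + j * s) * p)) = (\<Sum>y\<in>{0..<e}. of_bool (e dvd (x + j * r) * q + y * p) :: real)"
        by (rule sum_period_shift'[where f = "\<lambda>y. of_bool (e dvd (x + j * r) * q + y * p)"])
           (use per[of _ p] assms in \<open>simp_all only: add.commute[of "_ * q"]\<close>)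
    qed simp
    also have "\<dots> = (\<Sum>y\<in>{0..<e}. \<Sum>x\<in>{0..<e}. of_bool (e dvd (x + j * r) * q + y * p))"
      by (rule sum.swap)
    also have "\<dots> = (\<Sum>y\<in>{0..<e}. \<Sum>x\<in>{0..<e}. of_bool (e dvd x * q + y * p))"
    proof (rule sum.cong)
      fix y
      show "(\<Sum>x\<in>{0..<e}. of_bool (e dvd (x + j * r) * q + y * p)) = (\<Sum>x\<in>{0..<e}. of_bool (e dvd x * q + y * p) :: real)"
        by (rule sum_period_shift'[where f = "\<lambda>x. of_bool (e dvd x * q + y * p)"])
           (use per assms in simp_all)
    qed simp
    also have "\<dots> = F 0" unfolding F_def by (subst sum.swap) simp
    finally show ?thesis .
  qed
  then have "(\<Sum>j\<in>{0..<e}. F j) = (\<Sum>j\<in>{0..<e}. F 0)" by (rule sum.cong[OF refl])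
  then have "(\<Sum>j\<in>{0..<e}. F j) = real_of_int e * F 0" using assms(2) by simp
  moreover have "(\<Sum>j\<in>{0..<e}. F j) = (\<Sum>x\<in>{0..<e}. \<Sum>y\<in>{0..<e}. \<Sum>j\<in>{0..<e}. of_bool (e dvd x * q + y * p + j))"
    unfolding F_def by (subst sum.swap, rule sum.cong, simp, subst sum.swap, simp)
  moreover have "(\<Sum>j\<in>{0..<e}. of_bool (e dvd a + j) :: real) = 1" for a
  proof -
    have "(\<Sum>j\<in>{0..<e}. of_bool (e dvd a + j) :: real) = (\<Sum>j\<in>{0..<e}. of_bool (e dvd j))"
      using sum_period_shift'[where f = "\<lambda>j. of_bool (e dvd j)" and c = a and e = e] assms(2)
      by (simp add: add.commute)
    also have "\<dots> = (\<Sum>j\<in>{0..<e}. if j = 0 then 1 else 0)"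
      by (intro sum.cong) (auto dest: zdvd_imp_le)
    also have "\<dots> = 1" using assms(2) by (subst sum.delta) auto
    finally show ?thesis .
  qed
  ultimately have "real_of_int e * F 0 = real_of_int e * real_of_int e" using assms(2) by simp
  then show ?thesis using assms(2) by (simp add: F_def)
qed

text \<open>Pairs are written \<open>(y, x)\<close> beside \<open>(p, q)\<close>, matching the order
  of the entries of a sextuple, while the form is \<open>x * q + y * p\<close>.\<close>

definition sol_pairs :: "int \<Rightarrow> real \<Rightarrow> real \<times> real \<Rightarrow> real \<times> real \<Rightarrow> int \<times> int \<Rightarrow> (int \<times> int) set" where
  "sol_pairs e R a b pq = {(y, x). y \<in> int_in R (fst a) (fst b) \<and> x \<in> int_in R (snd a) (snd b) \<and>
      e dvd x * snd pq + y * fst pq}"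

lemma finite_sol_pairs [simp]: "finite (sol_pairs e R a b pq)"
  unfolding sol_pairs_def
  by (rule finite_subset[of _ "int_in R (fst a) (fst b) \<times> int_in R (snd a) (snd b)"]) auto

text \<open>The indicator is summed over \<open>y\<close> and then over \<open>x\<close>, each time
  along a run of consecutive integers with an \<open>e\<close>-periodic summand. The error grows
  with \<open>e\<close> but does not see the coprime pair, which varies with
  \<open>R\<close>.\<close>

lemma card_sol_pairs:
  assumes cop: "coprime p q" and e: "e > 0" and R: "R > 0"
    and ab: "fst a < fst b" "snd a < snd b"
  shows "\<bar>real (card (sol_pairs e R a b (p, q))) - real (card (int_in R (fst a) (fst b))) * real (card (int_in R (snd a) (snd b))) / real_of_int e\<bar>
    \<le> real_of_int e * (real (card (int_in R (fst a) (fst b))) + real (card (int_in R (snd a) (snd b))))"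
proof -
  let ?Y = "int_in R (fst a) (fst b)" and ?X = "int_in R (snd a) (snd b)"
  have run: "\<exists>i. int_in R c d = {i..<i + int (card (int_in R c d))}" if "c < d" for c d
  proof -
    have "R * c < R * d" using that R by simp
    then have "\<lfloor>R * c\<rfloor> + 1 \<le> \<lceil>R * d\<rceil>" by linarith
    then show ?thesis by (intro exI[of _ "\<lfloor>R * c\<rfloor> + 1"]) (simp add: int_in_eq)
  qed
  define ind where "ind x y = (of_bool (e dvd x * q + y * p) :: real)" for x y
  define h where "h x = (\<Sum>y\<in>{0..<e}. ind x y)" for x
  have per: "of_bool (e dvd (k + e) * a + b) = (of_bool (e dvd k * a + b) :: real)" for k a b
  proof -
    have "(k + e) * a + b = (k * a + b) + e * a" by (simp add: algebra_simps)
    then show ?thesis by (simp only: dvd_add_times_triv_right_iff mult.commute[of e a])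
  qed
  have ind1: "ind x (y + e) = ind x y" and ind2: "ind (x + e) y = ind x y" for x y
    using per[of y p "x * q"] per[of x q "y * p"] by (simp_all add: ind_def add.commute)
  have ind01: "0 \<le> ind x y" "ind x y \<le> 1" for x y by (simp_all add: ind_def)
  have h0: "0 \<le> h x" for x unfolding h_def using ind01 by (intro sum_nonneg) auto
  have he: "h x \<le> real_of_int e" for x
    unfolding h_def using sum_bounded_above[of "{0..<e}" "ind x" 1] ind01 e by simp
  have hs: "(\<Sum>x\<in>{0..<e}. h x) = real_of_int e"
    unfolding h_def ind_def by (rule card_solutions_mod[OF cop e])
  have "real (card (sol_pairs e R a b (p, q))) = (\<Sum>(y, x)\<in>?Y \<times> ?X. ind x y)"
  proof -
    have "(\<Sum>(y, x)\<in>?Y \<times> ?X. ind x y) = (\<Sum>z\<in>?Y \<times> ?X. if e dvd snd z * q + fst z * p then 1 else 0)"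
      by (intro sum.cong) (auto simp: ind_def)
    also have "\<dots> = real (card {z \<in> ?Y \<times> ?X. e dvd snd z * q + fst z * p})"
      by (simp add: sum.If_cases Int_def)
    also have "{z \<in> ?Y \<times> ?X. e dvd snd z * q + fst z * p} = sol_pairs e R a b (p, q)"
      by (auto simp: sol_pairs_def)
    finally show ?thesis ..
  qed
  also have "\<dots> = (\<Sum>x\<in>?X. \<Sum>y\<in>?Y. ind x y)"
    by (subst sum.cartesian_product[symmetric]) (rule sum.swap)
  finally have C: "real (card (sol_pairs e R a b (p, q))) = (\<Sum>x\<in>?X. \<Sum>y\<in>?Y. ind x y)" .
  have inner: "\<bar>(\<Sum>y\<in>?Y. ind x y) - real (card ?Y) / real_of_int e * h x\<bar> \<le> real_of_int e" for x
  proof -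
    obtain i where "?Y = {i..<i + int (card ?Y)}" using run[OF ab(1)] by blast
    then show ?thesis using sum_run_periodic[of "ind x" e 1 i "card ?Y", OF ind1 e ind01] unfolding h_def by simp
  qed
  have outer: "\<bar>(\<Sum>x\<in>?X. h x) - real (card ?X)\<bar> \<le> real_of_int e * real_of_int e"
  proof -
    obtain i where "?X = {i..<i + int (card ?X)}" using run[OF ab(2)] by blast
    moreover have "h (k + e) = h k" for k unfolding h_def by (simp add: ind2)
    ultimately show ?thesis using sum_run_periodic[of h e "real_of_int e" i "card ?X", OF _ e h0 he] e hs by simp
  qed
  have "\<bar>(\<Sum>x\<in>?X. \<Sum>y\<in>?Y. ind x y) - real (card ?Y) / real_of_int e * (\<Sum>x\<in>?X. h x)\<bar>
     = \<bar>\<Sum>x\<in>?X. ((\<Sum>y\<in>?Y. ind x y) - real (card ?Y) / real_of_int e * h x)\<bar>"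
    by (simp add: sum_subtractf sum_distrib_left)
  also have "\<dots> \<le> (\<Sum>x\<in>?X. real_of_int e)"
    by (rule order_trans[OF sum_abs]) (intro sum_mono inner)
  finally have 1: "\<bar>(\<Sum>x\<in>?X. \<Sum>y\<in>?Y. ind x y) - real (card ?Y) / real_of_int e * (\<Sum>x\<in>?X. h x)\<bar> \<le> real_of_int e * real (card ?X)"
    by (simp add: mult.commute)
  have "real (card ?Y) / real_of_int e * (\<Sum>x\<in>?X. h x) - real (card ?Y) * real (card ?X) / real_of_int e
      = real (card ?Y) / real_of_int e * ((\<Sum>x\<in>?X. h x) - real (card ?X))"
    by (simp add: right_diff_distrib)
  then have "\<bar>real (card ?Y) / real_of_int e * (\<Sum>x\<in>?X. h x) - real (card ?Y) * real (card ?X) / real_of_int e\<bar>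
      \<le> real (card ?Y) / real_of_int e * (real_of_int e * real_of_int e)"
    using outer e by (simp only: abs_mult) (intro mult_mono, auto)
  also have "\<dots> = real_of_int e * real (card ?Y)" using e by simp
  finally have 2: "\<bar>real (card ?Y) / real_of_int e * (\<Sum>x\<in>?X. h x) - real (card ?Y) * real (card ?X) / real_of_int e\<bar> \<le> real_of_int e * real (card ?Y)" .
  show ?thesis unfolding C distrib_left by (rule abs_diff_le_trans[OF 1 2])
qed

text \<open>\<open>K\<close> depends on \<open>e\<close> and on the box only. Uniformity in
  \<open>(p, q)\<close> is what permits summation over all coprime pairs at scale
  \<open>R\<close>.\<close>

lemma card_sol_pairs':
  assumes e: "e > 0" and ab: "fst a < fst b" "snd a < snd b"
  obtains K where "\<And>p q R. coprime p q \<Longrightarrow> R \<ge> 1 \<Longrightarrow>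
     \<bar>real (card (sol_pairs e R a b (p, q))) / R\<^sup>2 - (fst b - fst a) * (snd b - snd a) / real_of_int e\<bar> \<le> K / R"
proof
  define s t where "s = fst b - fst a" and "t = snd b - snd a"
  have st: "0 < s" "0 < t" using ab by (auto simp: s_def t_def)
  define K where "K = real_of_int e * (s + t + 2) + (s + t + 1)"
  fix p q :: int and R :: real assume cop: "coprime p q" and R: "R \<ge> 1"
  define Y X where "Y = real (card (int_in R (fst a) (fst b)))" and "X = real (card (int_in R (snd a) (snd b)))"
  have Y: "\<bar>Y - R * s\<bar> \<le> 1" and X: "\<bar>X - R * t\<bar> \<le> 1"
    using card_int_in[of R "fst a" "fst b"] card_int_in[of R "snd a" "snd b"] ab R by (auto simp: Y_def X_def s_def t_def)
  have XY0: "0 \<le> X" "0 \<le> Y" by (auto simp: X_def Y_def)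
  have e1: "1 \<le> real_of_int e" using e by simp
  have 1: "\<bar>real (card (sol_pairs e R a b (p, q))) - Y * X / real_of_int e\<bar> \<le> real_of_int e * (Y + X)"
    using card_sol_pairs[OF cop e _ ab, of R] R by (simp add: Y_def X_def)
  have "Y * X - R\<^sup>2 * (s * t) = (Y - R * s) * X + R * s * (X - R * t)"
    by (simp add: power2_eq_square algebra_simps)
  then have "\<bar>Y * X - R\<^sup>2 * (s * t)\<bar> \<le> \<bar>Y - R * s\<bar> * X + R * s * \<bar>X - R * t\<bar>"
    using XY0 R st abs_triangle_ineq[of "(Y - R * s) * X" "R * s * (X - R * t)"] by (simp add: abs_mult)
  also have "\<dots> \<le> 1 * (R * t + 1) + R * s * 1"
    using X Y XY0 R st by (intro add_mono mult_mono) auto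
  also have "\<dots> \<le> R * (s + t + 1)" using R by (simp add: algebra_simps)
  finally have "\<bar>Y * X - R\<^sup>2 * (s * t)\<bar> / real_of_int e \<le> R * (s + t + 1) / 1"
    using e1 R st by (intro frac_le) auto
  moreover have "\<bar>Y * X / real_of_int e - R\<^sup>2 * (s * t) / real_of_int e\<bar> = \<bar>Y * X - R\<^sup>2 * (s * t)\<bar> / real_of_int e"
    using e1 by (simp add: diff_divide_distrib[symmetric] abs_divide)
  moreover have "real_of_int e * (Y + X) \<le> real_of_int e * (R * (s + t + 2))"
  proof (intro mult_left_mono)
    have "Y + X \<le> R * s + R * t + 2" using X Y by linarith
    also have "\<dots> \<le> R * (s + t + 2)" using R by (simp add: algebra_simps)
    finally show "Y + X \<le> R * (s + t + 2)" .
  qed (use e1 in simp)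
  moreover have KR: "K * R = real_of_int e * (R * (s + t + 2)) + R * (s + t + 1)"
    by (simp add: K_def algebra_simps)
  ultimately have "\<bar>Y * X / real_of_int e - R\<^sup>2 * (s * t) / real_of_int e\<bar> \<le> R * (s + t + 1)"
    and "real_of_int e * (Y + X) + R * (s + t + 1) \<le> K * R" by simp_all
  then have *: "\<bar>real (card (sol_pairs e R a b (p, q))) - R\<^sup>2 * (s * t) / real_of_int e\<bar> \<le> K * R"
    using abs_diff_le_trans[OF 1] by (smt (verit))
  have "real (card (sol_pairs e R a b (p, q))) / R\<^sup>2 - s * t / real_of_int e
      = (real (card (sol_pairs e R a b (p, q))) - R\<^sup>2 * (s * t) / real_of_int e) / R\<^sup>2"
    using R by (simp add: diff_divide_distrib)
  then have "\<bar>real (card (sol_pairs e R a b (p, q))) / R\<^sup>2 - s * t / real_of_int e\<bar> \<le> K * R / R\<^sup>2"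
    using * R by (simp add: abs_divide divide_right_mono)
  then show "\<bar>real (card (sol_pairs e R a b (p, q))) / R\<^sup>2 - (fst b - fst a) * (snd b - snd a) / real_of_int e\<bar> \<le> K / R"
    using R by (simp add: power2_eq_square s_def t_def)
qed

text \<open>The pair \<open>(y, x)\<close> is determined by \<open>x q + y p\<close> and \<open>y div q\<close>, since \<open>y\<close> is then known modulo \<open>q\<close>.\<close>
lemma card_sol_pairs_le:
  assumes v: "0 < v" and u2: "0 \<le> u2" and v2: "0 \<le> v2"
  shows "\<exists>K\<ge>0. \<forall>e p q R. coprime p q \<longrightarrow> e > 0 \<longrightarrow> R > 0 \<longrightarrow> R * v \<le> real_of_int q \<longrightarrow> real_of_int q \<le> R * v2 \<longrightarrow>
     0 \<le> p \<longrightarrow> real_of_int p \<le> R * u2 \<longrightarrow>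
     (\<forall>y x. (y, x) \<in> sol_pairs 1 R a b (p, q) \<longrightarrow> 0 < x * q + y * p) \<longrightarrow>
     real (card (sol_pairs e R a b (p, q))) \<le> K * R\<^sup>2 / real_of_int e"
proof -
  define Y where "Y = \<bar>fst a\<bar> + \<bar>fst b\<bar>"
  define X where "X = \<bar>snd a\<bar> + \<bar>snd b\<bar>"
  \<comment> \<open>Since \<open>q \<ge> R * v\<close> and \<open>\<bar>y\<bar> \<le> R * Y\<close>,
    the quotient \<open>y div q\<close> takes boundedly many values, all in
    \<open>D\<close>.\<close>
  define D where "D = {\<lfloor>- (Y / v)\<rfloor>..\<lfloor>Y / v\<rfloor>}"
  define L where "L = X * v2 + Y * u2"
  have XY: "0 \<le> X" "0 \<le> Y" by (auto simp: X_def Y_def)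
  have L: "0 \<le> L" unfolding L_def using XY u2 v2 by simp
  have "real (card (sol_pairs e R a b (p, q))) \<le> real (card D) * L * R\<^sup>2 / real_of_int e"
    if cop: "coprime p q" and e: "e > 0" and R: "R > 0" and q: "R * v \<le> real_of_int q" "real_of_int q \<le> R * v2"
      and p: "0 \<le> p" "real_of_int p \<le> R * u2"
      and pos: "\<forall>y x. (y, x) \<in> sol_pairs 1 R a b (p, q) \<longrightarrow> 0 < x * q + y * p" for e p q :: int and R :: real
  proof -
  have "0 < R * v" using R v by simp
  then have q0: "0 < q" using q(1) by linarith
  define \<phi> where "\<phi> = (\<lambda>(y, x). ((x * q + y * p) div e, y div q))"
  have in_abs: "\<bar>real_of_int k\<bar> \<le> R * (\<bar>c\<bar> + \<bar>d\<bar>)" if "k \<in> int_in R c d" for k c d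
  proof -
    have k: "R * c < real_of_int k" "real_of_int k < R * d" using that by (auto simp: int_in_def)
    have "- (R * \<bar>c\<bar>) \<le> R * c" "R * d \<le> R * \<bar>d\<bar>" using R by (auto simp: abs_if)
    moreover have "0 \<le> R * \<bar>c\<bar>" "0 \<le> R * \<bar>d\<bar>" using R by auto
    ultimately show ?thesis using k by (simp add: distrib_left abs_le_iff)
  qed
  have inj: "inj_on \<phi> (sol_pairs e R a b (p, q))"
  proof (rule inj_onI)
    fix z z' assume z: "z \<in> sol_pairs e R a b (p, q)" "z' \<in> sol_pairs e R a b (p, q)" "\<phi> z = \<phi> z'"
    obtain y x y' x' where zz: "z = (y, x)" "z' = (y', x')" by (cases z, cases z')
    have "e dvd x * q + y * p" "e dvd x' * q + y' * p" using z by (auto simp: zz sol_pairs_def)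
    moreover have "(x * q + y * p) div e = (x' * q + y' * p) div e" using z(3) by (simp add: zz \<phi>_def)
    ultimately have eq: "x * q + y * p = x' * q + y' * p" by (metis dvd_div_eq_iff)
    then have "(y - y') * p = (x' - x) * q" by (simp add: algebra_simps)
    then have "q dvd (y - y') * p" by simp
    then have "q dvd y - y'" using cop by (simp add: coprime_commute coprime_dvd_mult_left_iff)
    then have "y mod q = y' mod q" by (simp add: mod_eq_dvd_iff)
    moreover have "y div q = y' div q" using z(3) by (simp add: zz \<phi>_def)
    ultimately have "y = y'" by (metis mult_div_mod_eq)
    then show "z = z'" using eq q0 by (simp add: zz)
  qed
  \<comment> \<open>Positivity of \<open>x * q + y * p\<close> makes its quotient by
    \<open>e\<close> at least 1, so the number of quotients is at most
    \<open>L * R\<^sup>2 / e\<close> without an additive constant, even when \<open>e\<close>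
    exceeds \<open>R\<^sup>2\<close>.\<close>
  have sub: "\<phi> ` sol_pairs e R a b (p, q) \<subseteq> {1..\<lfloor>L * R\<^sup>2 / real_of_int e\<rfloor>} \<times> D"
  proof (rule image_subsetI)
    fix z assume z: "z \<in> sol_pairs e R a b (p, q)"
    obtain y x where zz: "z = (y, x)" by (cases z)
    have yx: "y \<in> int_in R (fst a) (fst b)" "x \<in> int_in R (snd a) (snd b)" "e dvd x * q + y * p"
      using z by (auto simp: zz sol_pairs_def)
    have y: "\<bar>real_of_int y\<bar> \<le> R * Y" and x: "\<bar>real_of_int x\<bar> \<le> R * X"
      using in_abs yx by (auto simp: X_def Y_def)
    have c0: "0 < x * q + y * p" using yx pos by (auto simp: sol_pairs_def)
    obtain c where c: "x * q + y * p = e * c" using yx(3) by (elim dvdE)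
    have c1: "1 \<le> c" using c0 e unfolding c by (simp add: zero_less_mult_iff)
    have "real_of_int (x * q + y * p) \<le> \<bar>real_of_int x\<bar> * real_of_int q + \<bar>real_of_int y\<bar> * real_of_int p"
      using q0 p unfolding of_int_add of_int_mult by (intro add_mono mult_right_mono) auto
    also have "\<dots> \<le> (R * X) * (R * v2) + (R * Y) * (R * u2)"
      using x y q p q0 R XY by (intro add_mono mult_mono) auto
    also have "\<dots> = L * R\<^sup>2" by (simp add: L_def power2_eq_square algebra_simps)
    finally have "real_of_int c \<le> L * R\<^sup>2 / real_of_int e" using e unfolding c by (simp add: field_simps)
    then have 1: "(x * q + y * p) div e \<in> {1..\<lfloor>L * R\<^sup>2 / real_of_int e\<rfloor>}"
      using c1 e unfolding c by (simp add: le_floor_iff)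
    have "\<bar>real_of_int y / real_of_int q\<bar> \<le> R * Y / (R * v)"
      using y q q0 R v XY by (simp only: abs_divide) (intro frac_le, auto)
    then have "\<bar>real_of_int y / real_of_int q\<bar> \<le> Y / v" using R by simp
    then have "- (Y / v) \<le> real_of_int y / real_of_int q" "real_of_int y / real_of_int q \<le> Y / v"
      unfolding abs_le_iff by linarith+
    then have "y div q \<in> D" unfolding D_def floor_divide_of_int_eq[symmetric, where 'a = real]
      by (auto intro: floor_mono)
    with 1 show "\<phi> z \<in> {1..\<lfloor>L * R\<^sup>2 / real_of_int e\<rfloor>} \<times> D" by (simp add: zz \<phi>_def)
  qed
  have "card (sol_pairs e R a b (p, q)) = card (\<phi> ` sol_pairs e R a b (p, q))" using inj by (simp add: card_image)
  also have "\<dots> \<le> card ({1..\<lfloor>L * R\<^sup>2 / real_of_int e\<rfloor>} \<times> D)"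
    by (rule card_mono[OF _ sub]) (simp add: D_def)
  also have "\<dots> = nat \<lfloor>L * R\<^sup>2 / real_of_int e\<rfloor> * card D" by (simp add: card_cartesian_product)
  finally have "real (card (sol_pairs e R a b (p, q))) \<le> real (nat \<lfloor>L * R\<^sup>2 / real_of_int e\<rfloor>) * real (card D)"
    by (metis of_nat_le_iff of_nat_mult)
  also have "\<dots> \<le> (L * R\<^sup>2 / real_of_int e) * real (card D)"
  proof (intro mult_right_mono)
    have "0 \<le> L * R\<^sup>2 / real_of_int e" using L e by simp
    then show "real (nat \<lfloor>L * R\<^sup>2 / real_of_int e\<rfloor>) \<le> L * R\<^sup>2 / real_of_int e" by linarith
  qed simp
  finally show ?thesis by (simp add: mult.commute mult.left_commute)
  qed
  then show ?thesis using L by (intro exI[of _ "real (card D) * L"]) simp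
qed

section \<open>Integer sextuples in a dilated box\<close>

type_synonym 'a six = "('a \<times> 'a) \<times> ('a \<times> 'a) \<times> ('a \<times> 'a)"

text \<open>A sextuple is \<open>((p, q), (y, x), (n, m))\<close>, where \<open>(p, q)\<close>
  stands for two consecutive denominators \<open>(q', q)\<close>. With modulus 1 the divisibility in
  \<open>sol_pairs\<close> is vacuous, so the last two pairs run through full boxes.\<close>

definition six_points :: "real \<Rightarrow> real six \<Rightarrow> real six \<Rightarrow> int six set" where
  "six_points R A B = {(pq, yx, nm). pq \<in> prim_pairs R (fst (fst A)) (fst (fst B)) (snd (fst A)) (snd (fst B)) \<and>
     yx \<in> sol_pairs 1 R (fst (snd A)) (fst (snd B)) pq \<and> nm \<in> sol_pairs 1 R (snd (snd A)) (snd (snd B)) pq}"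

text \<open>This is \<open>gcd(c, a\<^sub>1)\<close> with \<open>c = x * q + y * p\<close> and
  \<open>a\<^sub>1 = m * q + n * p\<close>.\<close>

definition six_gcd :: "int six \<Rightarrow> nat" where
  "six_gcd = (\<lambda>((p, q), (y, x), (n, m)). nat (gcd (x * q + y * p) (m * q + n * p)))"

text \<open>For fixed \<open>(p, q)\<close> the two divisibilities concern different variables, so
  the fibre is a product and the densities \<open>1 / e\<close> multiply.\<close>

lemma six_points_dvd:
  assumes "e \<ge> 1"
  shows "{z \<in> six_points R A B. e dvd six_gcd z} =
    (SIGMA pq:prim_pairs R (fst (fst A)) (fst (fst B)) (snd (fst A)) (snd (fst B)).
      sol_pairs (int e) R (fst (snd A)) (fst (snd B)) pq \<times> sol_pairs (int e) R (snd (snd A)) (snd (snd B)) pq)"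
  by (auto simp: six_points_def sol_pairs_def six_gcd_def dvd_nat_gcd_iff)

lemma finite_six_points [simp]: "finite (six_points R A B)"
proof -
  have "six_points R A B = {z \<in> six_points R A B. 1 dvd six_gcd z}" by simp
  also have "finite \<dots>" by (subst six_points_dvd) auto
  finally show ?thesis .
qed

text \<open>Two sieves are nested: coprimality of \<open>(p, q)\<close> gives one factor
  \<open>6 / pi\<^sup>2\<close>, the condition on \<open>six_gcd\<close> the other. For fixed
  \<open>e\<close>, the fibre over each coprime \<open>(p, q)\<close> has about
  \<open>R ^ 4 * J1 * J2 / e\<^sup>2\<close> points, with an error uniform in \<open>(p, q)\<close>,
  so that it acts as a constant multiplier of the number of coprime pairs.\<close>

theorem card_six_points_tendsto:
  fixes A B :: "real six"
  assumes U: "0 \<le> fst (fst A)" "fst (fst A) < fst (fst B)" "0 < snd (fst A)" "snd (fst A) < snd (fst B)"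
    and J: "fst (fst (snd A)) < fst (fst (snd B))" "snd (fst (snd A)) < snd (fst (snd B))"
    and J': "fst (snd (snd A)) < fst (snd (snd B))" "snd (snd (snd A)) < snd (snd (snd B))"
    and pos: "\<And>u v y x n m. ((u, v), (y, x), (n, m)) \<in> box A B \<Longrightarrow> 0 < x * v + y * u \<and> 0 < m * v + n * u"
  shows "((\<lambda>R. real (card {z \<in> six_points R A B. six_gcd z = 1}) / R ^ 6) \<longlongrightarrow>
     (6 / pi\<^sup>2)\<^sup>2 * measure lborel (box A B)) at_top"
proof -
  obtain u1 v1 y1 x1 n1 m1 where A: "A = ((u1, v1), (y1, x1), (n1, m1))" by (metis surj_pair)
  obtain u2 v2 y2 x2 n2 m2 where B: "B = ((u2, v2), (y2, x2), (n2, m2))" by (metis surj_pair)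
  note AB = A B
  have U': "0 \<le> u1" "u1 < u2" "0 < v1" "v1 < v2" and JJ: "y1 < y2" "x1 < x2" "n1 < n2" "m1 < m2"
    using U J J' by (simp_all add: AB)
  have box_iff: "((u, v), (y, x), (n, m)) \<in> box A B \<longleftrightarrow>
      u1 < u \<and> u < u2 \<and> v1 < v \<and> v < v2 \<and> y1 < y \<and> y < y2 \<and> x1 < x \<and> x < x2 \<and> n1 < n \<and> n < n2 \<and> m1 < m \<and> m < m2" for u v y x n m
    by (auto simp: AB mem_box Basis_prod_def)
  define P where "P R = prim_pairs R u1 u2 v1 v2" for R
  define C where "C e R pq = real (card (sol_pairs (int e) R (y1, x1) (y2, x2) pq))" for e R pq
  define C' where "C' e R pq = real (card (sol_pairs (int e) R (n1, m1) (n2, m2) pq))" for e R pq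
  define \<delta> where "\<delta> = (u2 - u1) * (v2 - v1)"
  define J1 where "J1 = (y2 - y1) * (x2 - x1)"
  define J2 where "J2 = (n2 - n1) * (m2 - m1)"
  have J0: "0 \<le> J1" "0 \<le> J2" using JJ by (auto simp: J1_def J2_def)
  have Ae: "real (card {z \<in> six_points R A B. e dvd six_gcd z}) = (\<Sum>pq\<in>P R. C e R pq * C' e R pq)" if "e \<ge> 1" for e R
    unfolding six_points_dvd[OF that]
    by (subst card_SigmaI) (auto simp: AB P_def C_def C'_def card_cartesian_product)
  have Plim: "((\<lambda>R. real (card (P R)) / R\<^sup>2) \<longlongrightarrow> \<delta> * (6 / pi\<^sup>2)) at_top"
    unfolding P_def \<delta>_def using card_prim_pairs_tendsto[of u1 u2 v1 v2] U' by simp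
  have Pin: "coprime p q \<and> 0 \<le> p \<and> real_of_int p \<le> R * u2 \<and> R * v1 \<le> real_of_int q \<and> real_of_int q \<le> R * v2
      \<and> u1 < real_of_int p / R \<and> real_of_int p / R < u2 \<and> v1 < real_of_int q / R \<and> real_of_int q / R < v2" 
    if "(p, q) \<in> P R" "R > 0" for p q R
  proof -
    have "0 \<le> R * u1" using U' that by simp
    moreover have "R * u1 < real_of_int p" using that by (simp add: P_def prim_pairs_def int_in_def)
    ultimately have "0 \<le> real_of_int p" by linarith
    moreover have "coprime p q" "R * u1 < real_of_int p" "real_of_int p < R * u2" "R * v1 < real_of_int q" "real_of_int q < R * v2"
      using that by (auto simp: P_def prim_pairs_def int_in_def)
    ultimately show ?thesis using that(2) by (simp add: pos_less_divide_eq pos_divide_less_eq mult.commute)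
  qed
  have in_div: "c < real_of_int k / R \<and> real_of_int k / R < d" if "k \<in> int_in R c d" "R > 0" for k R c d
    using that by (simp add: int_in_def pos_less_divide_eq pos_divide_less_eq mult.commute)
  have posI: "0 < x * q + y * p" if pq: "(p, q) \<in> P R" and R: "R > 0" and yx: "(y, x) \<in> sol_pairs 1 R (y1, x1) (y2, x2) (p, q)" for p q y x R
  proof -
    \<comment> \<open>This half of \<open>pos\<close> concerns \<open>u\<close>, \<open>v\<close>,
      \<open>y\<close>, \<open>x\<close> only; the other two coordinates are filled with midpoints
      to obtain a point of the box.\<close>
    have "((p / R, q / R), (y / R, x / R), ((n1 + n2) / 2, (m1 + m2) / 2)) \<in> box A B"
      unfolding box_iff using Pin[OF pq R] in_div[of y R y1 y2] in_div[of x R x1 x2] R yx JJ by (simp add: sol_pairs_def)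
    then have "0 < (x / R) * (q / R) + (y / R) * (p / R)" by (rule pos[THEN conjunct1])
    also have "\<dots> = real_of_int (x * q + y * p) / (R * R)" by (simp add: add_divide_distrib)
    finally show ?thesis using R by (simp add: zero_less_divide_iff del: of_int_add of_int_mult)
  qed
  have posI': "0 < m * q + n * p" if pq: "(p, q) \<in> P R" and R: "R > 0" and nm: "(n, m) \<in> sol_pairs 1 R (n1, m1) (n2, m2) (p, q)" for p q n m R
  proof -
    have "((p / R, q / R), ((y1 + y2) / 2, (x1 + x2) / 2), (n / R, m / R)) \<in> box A B"
      unfolding box_iff using Pin[OF pq R] in_div[of n R n1 n2] in_div[of m R m1 m2] R nm JJ by (simp add: sol_pairs_def)
    then have "0 < (m / R) * (q / R) + (n / R) * (p / R)" by (rule pos[THEN conjunct2])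
    also have "\<dots> = real_of_int (m * q + n * p) / (R * R)" by (simp add: add_divide_distrib)
    finally show ?thesis using R by (simp add: zero_less_divide_iff del: of_int_add of_int_mult)
  qed
  have uv: "0 < v1" "0 \<le> u2" "0 \<le> v2" using U' by auto
  obtain K where K: "K \<ge> 0" "\<forall>e p q R. coprime p q \<longrightarrow> e > 0 \<longrightarrow> R > 0 \<longrightarrow> R * v1 \<le> real_of_int q \<longrightarrow> real_of_int q \<le> R * v2 \<longrightarrow>
     0 \<le> p \<longrightarrow> real_of_int p \<le> R * u2 \<longrightarrow>
     (\<forall>y x. (y, x) \<in> sol_pairs 1 R (y1, x1) (y2, x2) (p, q) \<longrightarrow> 0 < x * q + y * p) \<longrightarrow>
     real (card (sol_pairs e R (y1, x1) (y2, x2) (p, q))) \<le> K * R\<^sup>2 / real_of_int e"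
    using card_sol_pairs_le[OF uv, of "(y1, x1)" "(y2, x2)"] by (elim exE conjE) (rule that)
  obtain K' where K': "K' \<ge> 0" "\<forall>e p q R. coprime p q \<longrightarrow> e > 0 \<longrightarrow> R > 0 \<longrightarrow> R * v1 \<le> real_of_int q \<longrightarrow> real_of_int q \<le> R * v2 \<longrightarrow>
     0 \<le> p \<longrightarrow> real_of_int p \<le> R * u2 \<longrightarrow>
     (\<forall>y x. (y, x) \<in> sol_pairs 1 R (n1, m1) (n2, m2) (p, q) \<longrightarrow> 0 < x * q + y * p) \<longrightarrow>
     real (card (sol_pairs e R (n1, m1) (n2, m2) (p, q))) \<le> K' * R\<^sup>2 / real_of_int e"
    using card_sol_pairs_le[OF uv, of "(n1, m1)" "(n2, m2)"] by (elim exE conjE) (rule that)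
  have Cle: "C e R pq \<le> K * R\<^sup>2 / real e" "C' e R pq \<le> K' * R\<^sup>2 / real e"
    if "e \<ge> 1" "R > 0" "pq \<in> P R" for e R pq
  proof -
    obtain p q where pq: "pq = (p, q)" by (cases pq)
    show "C e R pq \<le> K * R\<^sup>2 / real e"
      using K(2)[rule_format, of p q "int e" R] Pin[of p q R] posI[of p q R] that by (simp add: C_def pq)
    show "C' e R pq \<le> K' * R\<^sup>2 / real e"
      using K'(2)[rule_format, of p q "int e" R] Pin[of p q R] posI'[of p q R] that by (simp add: C'_def pq)
  qed
  have "((\<lambda>R. real (card {z \<in> six_points R A B. six_gcd z = 1}) / R ^ 6) \<longlongrightarrow>
     (\<delta> * (6 / pi\<^sup>2) * (J1 * J2)) * (6 / pi\<^sup>2)) at_top"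
  proof (rule sieve_tendsto)
    show "eventually (\<lambda>R. finite (six_points R A B) \<and> (\<forall>z\<in>six_points R A B. six_gcd z > 0)) at_top"
      using eventually_gt_at_top[of "0::real"]
    proof eventually_elim
      case (elim R)
      have "six_gcd z > 0" if z: "z \<in> six_points R A B" for z
      proof -
        obtain p q y x n m where zz: "z = ((p, q), (y, x), (n, m))" by (metis surj_pair)
        have "0 < x * q + y * p" by (rule posI[OF _ elim]) (use z in \<open>auto simp: zz six_points_def P_def AB\<close>)
        then show ?thesis by (simp add: zz six_gcd_def)
      qed
      then show ?case by simp
    qed
    show "((\<lambda>R. real (card {z \<in> six_points R A B. e dvd six_gcd z}) / R ^ 6) \<longlongrightarrow> \<delta> * (6 / pi\<^sup>2) * (J1 * J2) * (1 / (real e)\<^sup>2)) at_top"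
      if e: "e \<ge> 1" for e :: nat
    proof -
      have ee: "int e > 0" using e by simp
      obtain L where L: "\<And>p q R. coprime p q \<Longrightarrow> R \<ge> 1 \<Longrightarrow> \<bar>real (card (sol_pairs (int e) R (y1, x1) (y2, x2) (p, q))) / R\<^sup>2 - J1 / real e\<bar> \<le> L / R"
        using card_sol_pairs'[OF ee, of "(y1, x1)" "(y2, x2)"] JJ by (auto simp: J1_def)
      obtain L' where L': "\<And>p q R. coprime p q \<Longrightarrow> R \<ge> 1 \<Longrightarrow> \<bar>real (card (sol_pairs (int e) R (n1, m1) (n2, m2) (p, q))) / R\<^sup>2 - J2 / real e\<bar> \<le> L' / R"
        using card_sol_pairs'[OF ee, of "(n1, m1)" "(n2, m2)"] JJ by (auto simp: J2_def)
      \<comment> \<open>The two factors of the product are replaced by their limits one after the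
        other: \<open>K\<close> bounds the factor kept in the first replacement, \<open>J2\<close>
        the one kept in the second.\<close>
      define E where "E = K * L' + J2 * L"
      define f where "f R = real (card {z \<in> six_points R A B. e dvd six_gcd z}) / R ^ 6 - real (card (P R)) / R\<^sup>2 * (J1 * J2 / (real e)\<^sup>2)" for R
      have "eventually (\<lambda>R. norm (f R) \<le> real (card (P R)) / R\<^sup>2 * (E / R)) at_top"
        using eventually_ge_at_top[of "1::real"]
      proof eventually_elim
        case (elim R)
        have R: "R > 0" using elim by simp
        have each: "\<bar>(C e R pq / R\<^sup>2) * (C' e R pq / R\<^sup>2) - J1 * J2 / (real e)\<^sup>2\<bar> \<le> E / R" if pq: "pq \<in> P R" for pq
        proof -
          obtain p q where pq': "pq = (p, q)" by (cases pq)
          have cop: "coprime p q" using Pin[of p q R] pq R by (simp add: pq')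
          have 1: "\<bar>C e R pq / R\<^sup>2 - J1 / real e\<bar> \<le> L / R" using L[OF cop elim] by (simp add: C_def pq')
          have 2: "\<bar>C' e R pq / R\<^sup>2 - J2 / real e\<bar> \<le> L' / R" using L'[OF cop elim] by (simp add: C'_def pq')
          have "C e R pq \<le> K * R\<^sup>2 / real e" using Cle(1)[OF e R pq] .
          also have "\<dots> \<le> K * R\<^sup>2 / 1" using e K(1) by (intro divide_left_mono) auto
          finally have 3: "0 \<le> C e R pq / R\<^sup>2" "C e R pq / R\<^sup>2 \<le> K" using R by (auto simp: C_def field_simps)
          have 4: "0 \<le> J2 / real e" "J2 / real e \<le> J2" using J0 e mult_left_mono[of 1 "real e" J2] by (simp_all add: divide_le_eq)
          have "(C e R pq / R\<^sup>2) * (C' e R pq / R\<^sup>2) - J1 * J2 / (real e)\<^sup>2 =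
             (C e R pq / R\<^sup>2) * (C' e R pq / R\<^sup>2 - J2 / real e) + (J2 / real e) * (C e R pq / R\<^sup>2 - J1 / real e)"
            by (simp add: right_diff_distrib power2_eq_square mult.commute)
          also have "\<bar>\<dots>\<bar> \<le> (C e R pq / R\<^sup>2) * \<bar>C' e R pq / R\<^sup>2 - J2 / real e\<bar> + (J2 / real e) * \<bar>C e R pq / R\<^sup>2 - J1 / real e\<bar>"
            by (rule order_trans[OF abs_triangle_ineq]) (simp only: abs_mult abs_of_nonneg[OF 3(1)] abs_of_nonneg[OF 4(1)] order_refl)
          also have "\<dots> \<le> K * (L' / R) + J2 * (L / R)"
            using 1 2 3 4 K(1) J0 by (intro add_mono mult_mono) auto
          also have "\<dots> = E / R" by (simp add: E_def add_divide_distrib)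
          finally show ?thesis .
        qed
        have R6: "R ^ 6 = R\<^sup>2 * (R\<^sup>2 * R\<^sup>2)" by (simp add: power_add[symmetric])
        have "real (card {z \<in> six_points R A B. e dvd six_gcd z}) / R ^ 6 = (1 / R\<^sup>2) * (\<Sum>pq\<in>P R. (C e R pq / R\<^sup>2) * (C' e R pq / R\<^sup>2))"
          unfolding Ae[OF e] R6 sum_distrib_left sum_divide_distrib by (intro sum.cong) auto
        moreover have "real (card (P R)) / R\<^sup>2 * (J1 * J2 / (real e)\<^sup>2) = (1 / R\<^sup>2) * (\<Sum>pq\<in>P R. J1 * J2 / (real e)\<^sup>2)"
          by simp
        ultimately have "f R = (1 / R\<^sup>2) * (\<Sum>pq\<in>P R. (C e R pq / R\<^sup>2) * (C' e R pq / R\<^sup>2) - J1 * J2 / (real e)\<^sup>2)"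
          unfolding f_def sum_subtractf right_diff_distrib by simp
        then have "\<bar>f R\<bar> = (1 / R\<^sup>2) * \<bar>\<Sum>pq\<in>P R. (C e R pq / R\<^sup>2) * (C' e R pq / R\<^sup>2) - J1 * J2 / (real e)\<^sup>2\<bar>"
          by (simp only: abs_mult) simp
        also have "\<dots> \<le> (1 / R\<^sup>2) * (\<Sum>pq\<in>P R. E / R)"
          by (intro mult_left_mono order_trans[OF sum_abs] sum_mono each) auto
        finally show ?case by simp
      qed
      moreover have "((\<lambda>R. real (card (P R)) / R\<^sup>2 * (E / R)) \<longlongrightarrow> (\<delta> * (6 / pi\<^sup>2)) * 0) at_top"
        by (intro tendsto_mult Plim real_tendsto_divide_at_top[OF tendsto_const filterlim_ident])
      ultimately have f0: "(f \<longlongrightarrow> 0) at_top" by (intro Lim_null_comparison[of f]) auto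
      have "((\<lambda>R. f R + real (card (P R)) / R\<^sup>2 * (J1 * J2 / (real e)\<^sup>2)) \<longlongrightarrow> 0 + (\<delta> * (6 / pi\<^sup>2)) * (J1 * J2 / (real e)\<^sup>2)) at_top"
        by (intro tendsto_add f0 tendsto_mult_right Plim)
      then show ?thesis by (simp add: f_def)
    qed
    show "eventually (\<lambda>R. R ^ 6 > 0 \<and> (\<forall>e\<ge>1. real (card {z \<in> six_points R A B. e dvd six_gcd z}) \<le> (u2 * v2 * K * K') * R ^ 6 / (real e)\<^sup>2)) at_top"
      using eventually_gt_at_top[of "0::real"]
    proof eventually_elim
      case (elim R)
      have cP: "real (card (P R)) \<le> (R * u2) * (R * v2)"
      proof -
        have "card (P R) \<le> card (int_in R u1 u2 \<times> int_in R v1 v2)"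
          unfolding P_def prim_pairs_def by (rule card_mono) auto
        then have "real (card (P R)) \<le> real (card (int_in R u1 u2)) * real (card (int_in R v1 v2))"
          by (metis card_cartesian_product of_nat_le_iff of_nat_mult)
        also have "\<dots> \<le> max 0 (R * u2) * max 0 (R * v2)"
          using U' elim by (intro mult_mono card_int_in_le) auto
        finally show ?thesis using U' elim by (simp add: max_def split: if_splits)
      qed
      have "real (card {z \<in> six_points R A B. e dvd six_gcd z}) \<le> (u2 * v2 * K * K') * R ^ 6 / (real e)\<^sup>2" if e: "e \<ge> 1" for e :: nat
      proof -
        have "(\<Sum>pq\<in>P R. C e R pq * C' e R pq) \<le> (\<Sum>pq\<in>P R. (K * R\<^sup>2 / real e) * (K' * R\<^sup>2 / real e))"
          using Cle e elim K(1) by (intro sum_mono mult_mono) (auto simp: C'_def)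
        also have "\<dots> = real (card (P R)) * ((K * R\<^sup>2 / real e) * (K' * R\<^sup>2 / real e))" by simp
        also have "\<dots> \<le> ((R * u2) * (R * v2)) * ((K * R\<^sup>2 / real e) * (K' * R\<^sup>2 / real e))"
          using cP K(1) K'(1) by (intro mult_right_mono) auto
        also have "\<dots> = (u2 * v2 * K * K') * R ^ 6 / (real e)\<^sup>2"
          by (simp add: power2_eq_square numeral_eq_Suc)
        finally show ?thesis by (simp add: Ae[OF e])
      qed
      then show ?case using elim by simp
    qed
  qed simp
  moreover have "measure lborel (box A B) = \<delta> * (J1 * J2)"
  proof -
    have "\<forall>b\<in>Basis. A \<bullet> b \<le> B \<bullet> b" using U' JJ by (auto simp: AB Basis_prod_def)
    then have "measure lborel (box A B) = (\<Prod>b\<in>Basis. (B - A) \<bullet> b)" by (simp add: measure_lborel_box_eq)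
    also have "\<dots> = \<delta> * (J1 * J2)"
      by (simp add: AB Basis_prod_def prod.union_disjoint \<delta>_def J1_def J2_def image_Un image_image disjoint_iff zero_prod_def)
    finally show ?thesis .
  qed
  moreover have "\<delta> * (6 / pi\<^sup>2) * (J1 * J2) * (6 / pi\<^sup>2) = (6 / pi\<^sup>2)\<^sup>2 * (\<delta> * (J1 * J2))"
    by (simp add: power2_eq_square)
  ultimately show ?thesis by (simp only:)
qed

section \<open>States of an expansion and the limit law\<close>

text \<open>The points of the unit interval with more than \<open>n\<close> digits. None of their
  first \<open>n\<close> reciprocals is an integer, so the floors defining the first
  \<open>n\<close> digits are locally constant.\<close>

definition live :: "nat \<Rightarrow> real set" where
  "live n = {x. 0 < x \<and> x < 1 \<and> (\<forall>i\<le>n. (gauss_map ^^ i) x \<noteq> 0)}"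

lemma isCont_gauss_map:
  assumes "x \<noteq> 0" "gauss_map x \<noteq> 0"
  shows "isCont gauss_map x"
proof -
  have "1 / x \<notin> \<int>" using assms(2) by (simp add: gauss_map_def)
  then have "isCont frac (1 / x)" by (rule continuous_frac)
  moreover have "isCont (\<lambda>x. 1 / x) x" using assms(1) by (intro continuous_intros)
  ultimately have "isCont (\<lambda>x. frac (1 / x)) x" by (intro isCont_o2[of x "\<lambda>x. 1 / x" frac])
  then show ?thesis by (simp add: gauss_map_def[abs_def])
qed

lemma isCont_gauss_map_funpow:
  assumes "\<And>i. i \<le> n \<Longrightarrow> (gauss_map ^^ i) x \<noteq> 0"
  shows "isCont (gauss_map ^^ n) x"
  using assms
proof (induction n)
  case (Suc n)
  have "isCont (gauss_map ^^ n) x" using Suc by simp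
  moreover have "isCont gauss_map ((gauss_map ^^ n) x)"
    using Suc.prems[of n] Suc.prems[of "Suc n"] by (intro isCont_gauss_map) auto
  ultimately show ?case using isCont_o2[of x "gauss_map ^^ n" gauss_map] by (simp add: o_def)
qed (simp add: id_def)

lemma eventually_nonzero:
  fixes f :: "real \<Rightarrow> real"
  assumes "isCont f x" "f x \<noteq> 0"
  shows "eventually (\<lambda>y. f y \<noteq> 0) (nhds x)"
proof -
  have "(f \<longlongrightarrow> f x) (nhds x)" using assms(1) by (simp add: isCont_def tendsto_nhds_iff)
  then show ?thesis using tendsto_imp_eventually_ne assms(2) by blast
qed

lemma eventually_live:
  assumes "x \<in> live n"
  shows "eventually (\<lambda>y. y \<in> live n) (nhds x)"
proof -
  have "eventually (\<lambda>y. (gauss_map ^^ i) y \<noteq> 0) (nhds x)" if "i \<le> n" for i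
    using assms that by (intro eventually_nonzero isCont_gauss_map_funpow) (auto simp: live_def)
  then have "eventually (\<lambda>y. \<forall>i\<in>{..n}. (gauss_map ^^ i) y \<noteq> 0) (nhds x)"
    by (intro eventually_ball_finite) auto
  moreover have "eventually (\<lambda>y. y \<in> {0<..<1}) (nhds x)"
    using assms by (intro eventually_nhds_in_open) (auto simp: live_def)
  ultimately show ?thesis by eventually_elim (auto simp: live_def)
qed

lemma open_live: "open (live n)"
  by (subst open_subopen) (use eventually_live in \<open>auto simp: eventually_nhds\<close>, metis subsetI)

text \<open>Digit \<open>j\<close> is the floor of the reciprocal of the image after
  \<open>j - 1\<close> steps. The next image is nonzero, so this reciprocal is not an integer and
  the floor is constant nearby.\<close>

lemma eventually_cf_digit:
  assumes "x \<in> live n" "1 \<le> j" "j \<le> int n"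
  shows "eventually (\<lambda>y. cf_digit y j = cf_digit x j) (nhds x)"
proof -
  define i where "i = nat (j - 1)"
  have i: "Suc i \<le> n" using assms by (simp add: i_def)
  have nz: "(gauss_map ^^ m) x \<noteq> 0" if "m \<le> n" for m using assms(1) that by (auto simp: live_def)
  have "isCont (gauss_map ^^ i) x" using nz i by (intro isCont_gauss_map_funpow) auto
  then have "((\<lambda>y. 1 / (gauss_map ^^ i) y) \<longlongrightarrow> 1 / (gauss_map ^^ i) x) (nhds x)"
    using nz[of i] i by (intro tendsto_intros) (auto simp: isCont_def tendsto_nhds_iff)
  moreover have "1 / (gauss_map ^^ i) x \<notin> \<int>"
    using nz[of "Suc i"] i by (simp add: gauss_map_def)
  ultimately have "eventually (\<lambda>y. \<lfloor>1 / (gauss_map ^^ i) y\<rfloor> = \<lfloor>1 / (gauss_map ^^ i) x\<rfloor>) (nhds x)"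
    by (rule eventually_floor_eq)
  then show ?thesis by eventually_elim (use assms in \<open>simp add: cf_digit_def i_def\<close>)
qed

lemma rational_of_gauss_map_0:
  assumes "0 \<le> x" "(gauss_map ^^ n) x = 0"
  shows "x \<in> \<rat>"
  using assms
proof (induction n arbitrary: x)
  case (Suc n)
  have "gauss_map x \<in> \<rat>" using Suc.prems(2) by (intro Suc.IH gauss_map_range) (simp add: funpow_swap1)
  then have "frac (1 / x) + of_int \<lfloor>1 / x\<rfloor> \<in> \<rat>" by (intro Rats_add) (auto simp: gauss_map_def)
  then have "1 / x \<in> \<rat>" by (simp add: frac_def)
  then have "inverse (1 / x) \<in> \<rat>" by (rule Rats_inverse)
  then show ?case by simp
qed simp

lemma irrational_live:
  assumes "x \<notin> \<rat>" "0 < x" "x < 1"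
  shows "x \<in> live n"
  using assms rational_of_gauss_map_0[of x] by (auto simp: live_def)

section \<open>States and the windows they determine\<close>

definition domW :: "(real \<times> real \<times> real) set" where
  "domW = {(u, v, \<tau>). 0 < u \<and> u < 1 \<and> 1 < v \<and> 0 < \<tau> \<and> \<tau> * (v * (v + u)) < 1}"

text \<open>The solution \<open>t\<close> of \<open>\<tau> = t / (v * (v + t * u))\<close>. The last
  condition of \<open>domW\<close> says that this tail is less than 1.\<close>

definition tail_of :: "real \<times> real \<times> real \<Rightarrow> real" where
  "tail_of = (\<lambda>(u, v, \<tau>). \<tau> * v\<^sup>2 / (1 - \<tau> * (u * v)))"

text \<open>The parameter \<open>\<tau>\<close> is \<open>R\<^sup>2 \<bar>\<rho> - p\<^sub>s / q\<^sub>s\<bar>\<close>.\<close>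
definition cf_state :: "real \<Rightarrow> real \<Rightarrow> nat \<Rightarrow> real \<times> real \<times> real" where
  "cf_state R \<rho> s = (let q = real (cf_denom \<rho> s); q' = real (cf_denom \<rho> (s - 1)); t = (gauss_map ^^ s) \<rho> in
     (q' / R, q / R, R\<^sup>2 * t / (q * (q + t * q'))))"

text \<open>Offsets \<open>j \<ge> 1\<close> are the digits of the tail \<open>t\<close>. Since
  \<open>y\<close> begins with \<open>h\<^sub>s\<close>, a window entry with offset
  \<open>j \<le> 0\<close> is the digit number \<open>1 - j\<close> of \<open>y\<close>.\<close>

definition join_digits :: "nat \<Rightarrow> real \<Rightarrow> real \<Rightarrow> int \<Rightarrow> nat" where
  "join_digits k y t j = (if 1 \<le> j \<and> j \<le> int k then cf_digit t j
     else if - int k \<le> j \<and> j \<le> 0 then cf_digit y (1 - j) else 0)"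

definition limit_map :: "nat \<Rightarrow> real \<times> real \<times> real \<Rightarrow> real \<times> (int \<Rightarrow> nat)" where
  "limit_map k z = (fst (snd z), join_digits k (fst z / fst (snd z)) (tail_of z))"

text \<open>Irrationality of ratio and tail would also hold almost everywhere, but the ratio of an
  actual state is rational. Finitely many nonzero images give an open condition that actual states
  can meet. The index is \<open>k + 1\<close> for the ratio because \<open>k + 1\<close> offsets of
  the window are at most 0.\<close>

definition good_dom :: "nat \<Rightarrow> (real \<times> real \<times> real) set" where
  "good_dom k = {z \<in> domW. fst z / fst (snd z) \<in> live (k + 1) \<and> tail_of z \<in> live k}"

lemma domW_denom:
  assumes "(u, v, \<tau>) \<in> domW"
  shows "0 < 1 - \<tau> * (u * v)"
proof -
  have d: "0 < \<tau>" "0 < v" "\<tau> * (v * (v + u)) < 1" using assms by (auto simp: domW_def)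
  have "u * v < v * (v + u)" using d(2) by (simp add: algebra_simps)
  then have "\<tau> * (u * v) < \<tau> * (v * (v + u))" using d(1) by (rule mult_strict_left_mono)
  then show ?thesis using d(3) by linarith
qed

lemma open_domW: "open domW"
proof -
  have eq: "domW = {z. 0 < fst z} \<inter> {z. fst z < 1} \<inter> {z. 1 < fst (snd z)} \<inter> {z. 0 < snd (snd z)} \<inter>
      {z. snd (snd z) * (fst (snd z) * (fst (snd z) + fst z)) < 1}"
    by (auto simp: domW_def)
  show ?thesis unfolding eq by (intro open_Int open_Collect_less continuous_intros)
qed

lemma continuous_on_tail_of: "continuous_on domW tail_of"
proof -
  have eq: "tail_of = (\<lambda>z. snd (snd z) * (fst (snd z))\<^sup>2 / (1 - snd (snd z) * (fst z * fst (snd z))))"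
    by (auto simp: tail_of_def)
  show ?thesis unfolding eq
    by (intro continuous_intros) (use domW_denom in force)
qed

lemma continuous_on_ratio: "continuous_on domW (\<lambda>z. fst z / fst (snd z))"
  by (intro continuous_intros) (auto simp: domW_def)

lemma open_good_dom: "open (good_dom k)"
proof -
  have "good_dom k = ((\<lambda>z. fst z / fst (snd z)) -` live (k + 1) \<inter> domW) \<inter> (tail_of -` live k \<inter> domW)"
    by (auto simp: good_dom_def)
  also have "open \<dots>"
    using continuous_on_open_vimage[OF open_domW, THEN iffD1, OF continuous_on_ratio]
      continuous_on_open_vimage[OF open_domW, THEN iffD1, OF continuous_on_tail_of] open_live
    by (simp add: open_Int)
  finally show ?thesis .
qed

text \<open>Digits jump in general, but those occurring here are locally constant on
  \<open>good_dom\<close>. Continuity turns an open set of vectors into an open set of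
  states.\<close>

lemma continuous_on_limit_map: "continuous_on (good_dom k) (limit_map k)"
proof -
  have sub: "good_dom k \<subseteq> domW" by (auto simp: good_dom_def)
  have const: "continuous_on (good_dom k) (\<lambda>z. cf_digit (g z) j)"
    if g: "continuous_on domW g" and live: "\<And>z. z \<in> good_dom k \<Longrightarrow> g z \<in> live n" and j: "1 \<le> j" "j \<le> int n" for g n j
  proof (rule continuous_at_imp_continuous_on, rule ballI)
    fix z assume z: "z \<in> good_dom k"
    have "isCont g z" using g z sub open_domW by (auto simp: continuous_on_eq_continuous_at)
    then have "filterlim g (nhds (g z)) (nhds z)" by (simp add: isCont_def tendsto_nhds_iff)
    then have "eventually (\<lambda>y. cf_digit (g y) j = cf_digit (g z) j) (nhds z)"
      using eventually_cf_digit[OF live[OF z] j] by (auto simp: filterlim_iff)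
    then show "isCont (\<lambda>z. cf_digit (g z) j) z"
      unfolding isCont_def by (intro tendsto_eventually) (auto simp: eventually_at_filter elim: eventually_mono)
  qed
  have "continuous_on (good_dom k) (\<lambda>z. join_digits k (fst z / fst (snd z)) (tail_of z) j)" for j
  proof (cases "1 \<le> j \<and> j \<le> int k")
    case True
    then show ?thesis unfolding join_digits_def
      using const[OF continuous_on_tail_of, of k j] by (simp add: good_dom_def)
  next
    case F: False
    show ?thesis
    proof (cases "- int k \<le> j \<and> j \<le> 0")
      case True
      then show ?thesis unfolding join_digits_def
        using F const[OF continuous_on_ratio, of "k + 1" "1 - j"] by (simp add: good_dom_def)
    next
      case False
      show ?thesis unfolding join_digits_def if_not_P[OF F] if_not_P[OF False] by (rule continuous_on_const)
    qed
  qed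
  then show ?thesis unfolding limit_map_def[abs_def]
    by (intro continuous_on_Pair continuous_on_coordinatewise_then_product continuous_intros)
qed

lemma cf_state_cfe:
  assumes "pos_word w" "w \<noteq> []" "0 < x" "x < 1"
  shows "cf_state R (cfe w x) (length w) =
    (real (cden' w) / R, real (cden w) / R, R\<^sup>2 * x / (real (cden w) * (real (cden w) + x * real (cden' w))))"
  unfolding cf_state_def Let_def cf_denom_cfe(1)[OF assms(1,3,4)] cf_denom_cfe(2)[OF assms(1,3,4,2)]
    gauss_map_cfe[OF assms(1,3,4)] ..

lemma tail_of_state:
  assumes "0 < q" "0 < q'" "0 < x" "0 < R"
  shows "tail_of (q' / R, q / R, R\<^sup>2 * x / (q * (q + x * q'))) = x"
proof -
  have p: "0 < q + x * q'" using assms by (intro add_pos_pos) auto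
  have 1: "R\<^sup>2 * x / (q * (q + x * q')) * (q / R)\<^sup>2 = x * q / (q + x * q')"
    using assms(1,4) by (simp add: power2_eq_square)
  have "R\<^sup>2 * x / (q * (q + x * q')) * (q' / R * (q / R)) = x * q' / (q + x * q')"
    using assms(1,4) by (simp add: power2_eq_square)
  then have 2: "1 - R\<^sup>2 * x / (q * (q + x * q')) * (q' / R * (q / R)) = q / (q + x * q')"
    using p by (simp add: field_simps)
  show ?thesis unfolding tail_of_def prod.case 1 2 using assms p by simp
qed

text \<open>Membership in \<open>domW\<close> alone certifies a genuine straddling index:
  \<open>\<tau> > 0\<close> forces a nonzero tail, so the expansion has not ended at
  \<open>s\<close>.\<close>

lemma cf_state_domW:
  assumes R: "R > 0" and \<rho>: "0 \<le> \<rho>" "\<rho> < 1" and st: "cf_state R \<rho> s \<in> domW"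
  obtains w x where "pos_word w" "w \<noteq> []" "length w = s" "0 < x" "x < 1" "\<rho> = cfe w x"
    "0 < cden' w" "real (cden' w) < R" "R < real (cden w)"
proof -
  define x where "x = (gauss_map ^^ s) \<rho>"
  have x1: "0 \<le> x" "x < 1" using gauss_map_funpow_range[OF \<rho>] by (auto simp: x_def)
  have "x \<noteq> 0" using st by (auto simp: cf_state_def domW_def Let_def x_def)
  then have x0: "0 < x" using x1 by simp
  \<comment> \<open>At \<open>s = 0\<close> the truncated difference \<open>s - 1\<close> is 0 too,
    so the first two coordinates would be equal, against \<open>u < 1 < v\<close>.\<close>
  have s: "s \<noteq> 0"
  proof
    assume "s = 0"
    then have "fst (snd (cf_state R \<rho> s)) = fst (cf_state R \<rho> s)" by (simp add: cf_state_def Let_def)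
    then show False using st by (cases "cf_state R \<rho> s") (auto simp: domW_def)
  qed
  define w where "w = cf_word \<rho> s"
  have w: "pos_word w" "\<rho> = cfe w x" "length w = s"
    using cf_word_expansion[OF \<rho>, of s] \<open>x \<noteq> 0\<close> by (auto simp: w_def x_def)
  have ne: "w \<noteq> []" using w s by auto
  have "cf_state R (cfe w x) (length w) \<in> domW" using st w by simp
  then have "0 < real (cden' w) / R" "real (cden' w) / R < 1" "1 < real (cden w) / R"
    unfolding cf_state_cfe[OF w(1) ne x0 x1(2)] by (auto simp: domW_def)
  then have "0 < cden' w" "real (cden' w) < R" "R < real (cden w)"
    using R by (auto simp: field_simps)
  with w ne x0 x1 show ?thesis by (intro that[of w x]) auto
qed

lemma cf_denom_mono_cfe:
  assumes "pos_word w" "0 < x" "x < 1" "i \<le> j" "j \<le> length w"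
  shows "cf_denom (cfe w x) i \<le> cf_denom (cfe w x) j"
  using assms(4,5)
proof (induction j rule: dec_induct)
  case (step n)
  have "cf_digit (cfe w x) (int (Suc n)) = w ! n" using cf_digit_cfe[OF assms(1-3), of n] step by simp
  moreover have "0 < w ! n" using assms(1) step.prems by (simp add: nth_mem)
  ultimately have "cf_denom (cfe w x) n \<le> cf_denom (cfe w x) (Suc n)"
    by (simp add: cf_denom_Suc trans_le_add1)
  then show ?case using step by simp
qed simp

lemma renewal_index_cfe:
  assumes "pos_word w" "0 < x" "x < 1" "w \<noteq> []" "real (cden' w) < R" "R < real (cden w)"
  shows "renewal_index R (cfe w x) = length w"
  unfolding renewal_index_def
proof (rule Least_equality)
  show "R \<le> real (cf_denom (cfe w x) (length w))" using cf_denom_cfe(1)[OF assms(1-3)] assms(6) by simp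
  fix s assume s: "R \<le> real (cf_denom (cfe w x) s)"
  show "length w \<le> s"
  proof (rule ccontr)
    assume "\<not> length w \<le> s"
    then have "cf_denom (cfe w x) s \<le> cf_denom (cfe w x) (length w - 1)"
      by (intro cf_denom_mono_cfe assms) auto
    then show False using s cf_denom_cfe(2)[OF assms(1-4)] assms(5) by simp
  qed
qed

lemma straddles_cfe_iff:
  assumes "pos_word w" "0 < x" "x < 1" "w \<noteq> []" "real (cden' w) < R" "R < real (cden w)"
  shows "straddles R (cfe w x) s \<longleftrightarrow> s = length w"
proof
  assume "s = length w"
  moreover have "cf_digit (cfe w x) (int (length w)) \<noteq> 0"
    using cf_digit_cfe[OF assms(1-3), of "length w - 1"] assms(1,4) by (auto simp: nth_mem)
  ultimately show "straddles R (cfe w x) s"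
    using cf_denom_cfe[OF assms(1-3)] assms(4-6) by (cases w) (auto simp: straddles_def)
next
  assume s: "straddles R (cfe w x) s"
  define \<rho> where "\<rho> = cfe w x"
  have s1: "1 \<le> s" "cf_digit \<rho> (int s) \<noteq> 0" "real (cf_denom \<rho> (s - 1)) < R" "R < real (cf_denom \<rho> s)"
    using s by (auto simp: straddles_def \<rho>_def)
  have "\<not> s < length w"
  proof
    assume "s < length w"
    then have "cf_denom \<rho> s \<le> cf_denom \<rho> (length w - 1)" unfolding \<rho>_def
      by (intro cf_denom_mono_cfe assms) auto
    then show False using s1 cf_denom_cfe(2)[OF assms(1-4)] assms(5) by (simp add: \<rho>_def)
  qed
  \<comment> \<open>Once a rational expansion has ended, the digits 0 make \<open>cf_denom\<close>
    oscillate. The nonzero digit at \<open>s\<close> shows that the expansion reaches far enough for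
    the denominators to increase up to \<open>s - 1\<close>.\<close>
  moreover have "\<not> length w < s"
  proof
    assume l: "length w < s"
    have \<rho>01: "0 \<le> \<rho>" "\<rho> < 1" using cfe_in_01[OF assms(1-3)] by (auto simp: \<rho>_def)
    have "(gauss_map ^^ (s - 1)) \<rho> \<noteq> 0"
    proof
      assume "(gauss_map ^^ (s - 1)) \<rho> = 0"
      then show False using s1 by (auto simp: cf_digit_def nat_diff_distrib)
    qed
    then have w': "pos_word (cf_word \<rho> (s - 1))" "cfe (cf_word \<rho> (s - 1)) ((gauss_map ^^ (s - 1)) \<rho>) = \<rho>"
      and t: "0 < (gauss_map ^^ (s - 1)) \<rho>" "(gauss_map ^^ (s - 1)) \<rho> < 1"
      using cf_word_expansion[OF \<rho>01, of "s - 1"] gauss_map_funpow_range[OF \<rho>01, of "s - 1"] by (metis, metis, metis order_le_less, metis)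
    have "cf_denom \<rho> (length w) \<le> cf_denom \<rho> (s - 1)"
      using cf_denom_mono_cfe[OF w'(1) t, of "length w" "s - 1"] l unfolding w'(2) by simp
    then show False using s1 cf_denom_cfe(1)[OF assms(1-3)] assms(6) by (simp add: \<rho>_def)
  qed
  ultimately show "s = length w" by simp
qed

text \<open>For a good state the conventions \<open>R \<le> q\<close> of
  \<open>renewal_index\<close> and \<open>R < q\<close> of \<open>straddles\<close> select the same
  index, since \<open>domW\<close> makes the inequalities strict. One function of the state
  therefore serves both models.\<close>

theorem vectors_eq_limit_map:
  assumes R: "R > 0" and \<rho>: "0 \<le> \<rho>" "\<rho> < 1" and st: "cf_state R \<rho> s \<in> good_dom k"
  shows "renewal_vector k R \<rho> = limit_map k (cf_state R \<rho> s)"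
    "straddle_vector k R \<rho> = limit_map k (cf_state R \<rho> s)"
proof -
  have "cf_state R \<rho> s \<in> domW" using st by (auto simp: good_dom_def)
  then obtain w x where w: "pos_word w" "w \<noteq> []" "length w = s" "0 < x" "x < 1" "\<rho> = cfe w x"
    "0 < cden' w" "real (cden' w) < R" "R < real (cden w)"
    by (rule cf_state_domW[OF R \<rho>])
  have state: "cf_state R \<rho> s = (real (cden' w) / R, real (cden w) / R, R\<^sup>2 * x / (real (cden w) * (real (cden w) + x * real (cden' w))))"
    using cf_state_cfe[OF w(1,2,4,5), of R] unfolding w(3,6) .
  have tl: "tail_of (cf_state R \<rho> s) = x"
    unfolding state using cden_pos[OF w(1)] w(4,7) R by (intro tail_of_state) simp_all
  have ratio: "fst (cf_state R \<rho> s) / fst (snd (cf_state R \<rho> s)) = cfe (rev w) 0"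
    unfolding state cfe_rev_0[OF w(1)] using R by simp
  have rw: "pos_word (rev w)" using w(1) by simp
  have "fst (cf_state R \<rho> s) / fst (snd (cf_state R \<rho> s)) \<in> live (k + 1)"
    using st by (simp add: good_dom_def)
  then have "(gauss_map ^^ i) (cfe (rev w) 0) \<noteq> 0" if "i \<le> k + 1" for i
    using that unfolding ratio live_def by simp
  then have digits: "k + 1 < length w" "\<And>i. i \<le> k \<Longrightarrow> cf_digit (cfe (rev w) 0) (int (Suc i)) = rev w ! i"
    using cf_digit_cfe_0[OF rw, of k] by auto
  have window: "cf_window k \<rho> s = join_digits k (cfe (rev w) 0) x"
  proof
    fix j
    show "cf_window k \<rho> s j = join_digits k (cfe (rev w) 0) x j"
    proof (cases "1 \<le> j \<and> j \<le> int k")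
      case True
      have "cf_digit \<rho> (int s + j) = cf_digit x j"
        using cf_digit_add[of j \<rho> s] True gauss_map_cfe[OF w(1,4,5)] unfolding w(3) w(6)[symmetric] by simp
      then show ?thesis using True by (simp add: cf_window_def join_digits_def)
    next
      case F: False
      show ?thesis
      proof (cases "- int k \<le> j \<and> j \<le> 0")
        case True
        define i where "i = nat (- j)"
        have i: "i \<le> k" "j = - int i" using True by (auto simp: i_def)
        have lt: "s - Suc i < length w" "i < length w" using digits(1) i w(3) by auto
        \<comment> \<open>Offset \<open>- i\<close> is the digit of index \<open>s - i\<close>, that
          is, entry \<open>s - Suc i\<close> of \<open>w\<close> counted from 0, and entry
          \<open>i\<close> of the reversed word.\<close>
        have "int s + j = int (Suc (s - Suc i))" using i digits(1) w(3) by linarith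
        then have "cf_digit \<rho> (int s + j) = w ! (s - Suc i)"
          using cf_digit_cfe[OF w(1,4,5) lt(1)] unfolding w(6) by (simp only:)
        then have "cf_window k \<rho> s j = w ! (s - Suc i)"
          using True by (simp add: cf_window_def)
        moreover have "1 - j = int (Suc i)" using i by simp
        then have "join_digits k (cfe (rev w) 0) x j = rev w ! i"
          using digits(2)[OF i(1)] True by (simp only: join_digits_def) simp
        moreover have "rev w ! i = w ! (s - Suc i)" using rev_nth[OF lt(2)] unfolding w(3) .
        ultimately show ?thesis by simp
      next
        case False
        then show ?thesis using F by (auto simp: cf_window_def join_digits_def)
      qed
    qed
  qed
  have den: "real (cf_denom \<rho> s) / R = fst (snd (cf_state R \<rho> s))" by (simp add: cf_state_def Let_def)
  have lm: "limit_map k (cf_state R \<rho> s) = (real (cf_denom \<rho> s) / R, cf_window k \<rho> s)"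
    unfolding limit_map_def ratio tl window den ..
  have "renewal_index R \<rho> = s" using renewal_index_cfe[OF w(1,4,5,2,8,9)] w(3,6) by simp
  then show "renewal_vector k R \<rho> = limit_map k (cf_state R \<rho> s)" by (simp add: renewal_vector_def lm)
  have str: "straddles R \<rho> = (\<lambda>s'. s' = s)"
    using straddles_cfe_iff[OF w(1,4,5,2,8,9)] unfolding w(3) w(6)[symmetric] by (rule ext)
  show "straddle_vector k R \<rho> = limit_map k (cf_state R \<rho> s)"
    unfolding straddle_vector_def lm str by simp
qed

section \<open>Volume of the region of sextuples\<close>

lemma nn_integral_lborel_pair:
  fixes f :: "'a::euclidean_space \<times> 'b::euclidean_space \<Rightarrow> ennreal"
  assumes "f \<in> borel_measurable borel"
  shows "(\<integral>\<^sup>+z. f z \<partial>lborel) = (\<integral>\<^sup>+x. \<integral>\<^sup>+y. f (x, y) \<partial>lborel \<partial>lborel)"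
proof -
  have "f \<in> borel_measurable (lborel \<Otimes>\<^sub>M lborel)" using assms by (simp add: lborel_prod)
  from lborel.nn_integral_fst[OF this] show ?thesis by (simp add: lborel_prod)
qed

lemma nn_integral_lborel_swap:
  fixes f :: "real \<Rightarrow> real \<Rightarrow> ennreal"
  assumes "(\<lambda>(x, y). f x y) \<in> borel_measurable borel"
  shows "(\<integral>\<^sup>+x. \<integral>\<^sup>+y. f x y \<partial>lborel \<partial>lborel) = (\<integral>\<^sup>+y. \<integral>\<^sup>+x. f x y \<partial>lborel \<partial>lborel)"
proof -
  have "(\<lambda>(x, y). f x y) \<in> borel_measurable (lborel \<Otimes>\<^sub>M lborel)" using assms by (simp add: lborel_prod)
  from lborel_pair.Fubini'[OF this] show ?thesis by simp
qed

lemma borel_measurable_indicator_comp: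
  assumes "S \<in> sets borel" "f \<in> borel_measurable M"
  shows "(\<lambda>z. indicator S (f z) :: ennreal) \<in> borel_measurable M"
  by (rule measurable_compose[OF assms(2) borel_measurable_indicator[OF assms(1)]])

text \<open>The linear map from \<open>(n, m)\<close> to the scaled
  \<open>(a\<^sub>1, a\<^sub>2)\<close> has determinant of absolute value
  \<open>x * v + y * u\<close>, so the preimage of the unit square has the reciprocal area. The
  substitution is carried out one coordinate at a time.\<close>

lemma nn_integral_parallelogram:
  fixes u v x y \<sigma> :: real
  assumes v: "0 < v" and c: "0 < x * v + y * u" and \<sigma>: "\<bar>\<sigma>\<bar> = 1"
  shows "(\<integral>\<^sup>+n. \<integral>\<^sup>+m. indicator {0<..<1} (m * v + n * u) * indicator {0<..<1} (\<sigma> * (n * x - m * y)) \<partial>lborel \<partial>lborel)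
    = ennreal (1 / (x * v + y * u))"
proof -
  let ?c = "x * v + y * u"
  let ?I = "indicator {0<..<1::real} :: real \<Rightarrow> ennreal"
  have \<sigma>2: "\<sigma> * \<sigma> = 1" using \<sigma> by (auto simp: abs_if split: if_splits)
  have "(\<integral>\<^sup>+m. ?I (m * v + n * u) * ?I (\<sigma> * (n * x - m * y)) \<partial>lborel)
      = ennreal (1 / v) * (\<integral>\<^sup>+a. ?I a * ?I (\<sigma> * (n * ?c - a * y) / v) \<partial>lborel)" for n
  proof -
    have "(\<integral>\<^sup>+m. ?I (m * v + n * u) * ?I (\<sigma> * (n * x - m * y)) \<partial>lborel) =
        ennreal \<bar>1 / v\<bar> * (\<integral>\<^sup>+a. ?I ((- n * u / v + 1 / v * a) * v + n * u) * ?I (\<sigma> * (n * x - (- n * u / v + 1 / v * a) * y)) \<partial>lborel)"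
      using v by (intro nn_integral_real_affine borel_measurable_times_ennreal borel_measurable_indicator_comp) auto
    moreover have "(- n * u / v + 1 / v * a) * v + n * u = a" for a using v by (simp add: field_simps)
    moreover have "\<sigma> * (n * x - (- n * u / v + 1 / v * a) * y) = \<sigma> * (n * ?c - a * y) / v" for a
      using v by (simp add: field_simps)
    ultimately show ?thesis using v by simp
  qed
  then have "(\<integral>\<^sup>+n. \<integral>\<^sup>+m. ?I (m * v + n * u) * ?I (\<sigma> * (n * x - m * y)) \<partial>lborel \<partial>lborel)
      = (\<integral>\<^sup>+n. ennreal (1 / v) * (\<integral>\<^sup>+a. ?I a * ?I (\<sigma> * (n * ?c - a * y) / v) \<partial>lborel) \<partial>lborel)" by simp
  also have "\<dots> = ennreal (1 / v) * (\<integral>\<^sup>+n. \<integral>\<^sup>+a. ?I a * ?I (\<sigma> * (n * ?c - a * y) / v) \<partial>lborel \<partial>lborel)"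
    by (rule nn_integral_cmult) measurable
  also have "(\<integral>\<^sup>+n. \<integral>\<^sup>+a. ?I a * ?I (\<sigma> * (n * ?c - a * y) / v) \<partial>lborel \<partial>lborel) =
      (\<integral>\<^sup>+a. \<integral>\<^sup>+n. ?I a * ?I (\<sigma> * (n * ?c - a * y) / v) \<partial>lborel \<partial>lborel)"
    by (rule nn_integral_lborel_swap) (simp only: borel_prod[symmetric] case_prod_unfold, measurable)
  also have "\<dots> = (\<integral>\<^sup>+a. ?I a * ennreal (v / ?c) \<partial>lborel)"
  proof (rule nn_integral_cong)
    fix a
    have "(\<integral>\<^sup>+n. ?I (\<sigma> * (n * ?c - a * y) / v) \<partial>lborel) =
        ennreal \<bar>\<sigma> * v / ?c\<bar> * (\<integral>\<^sup>+b. ?I (\<sigma> * ((a * y / ?c + \<sigma> * v / ?c * b) * ?c - a * y) / v) \<partial>lborel)"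
      using v c \<sigma> by (intro nn_integral_real_affine borel_measurable_times_ennreal borel_measurable_indicator_comp) auto
    moreover have "\<sigma> * ((a * y / ?c + \<sigma> * v / ?c * b) * ?c - a * y) / v = b" for b
    proof -
      have "(a * y / ?c + \<sigma> * v / ?c * b) * ?c = a * y + \<sigma> * v * b" using c by (simp add: distrib_right)
      then have "\<sigma> * ((a * y / ?c + \<sigma> * v / ?c * b) * ?c - a * y) / v = \<sigma> * (\<sigma> * v * b) / v" by simp
      also have "\<dots> = (\<sigma> * \<sigma>) * (v * b) / v" by (simp add: mult.assoc)
      also have "\<dots> = b" using v by (simp add: \<sigma>2)
      finally show ?thesis .
    qed
    moreover have "\<bar>\<sigma> * v / ?c\<bar> = v / ?c" using v c \<sigma> by (simp add: abs_mult)
    ultimately have "(\<integral>\<^sup>+n. ?I (\<sigma> * (n * ?c - a * y) / v) \<partial>lborel) = ennreal (v / ?c)" by (simp only:) simp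
    moreover have "(\<integral>\<^sup>+n. ?I a * ?I (\<sigma> * (n * ?c - a * y) / v) \<partial>lborel) = ?I a * (\<integral>\<^sup>+n. ?I (\<sigma> * (n * ?c - a * y) / v) \<partial>lborel)"
      by (rule nn_integral_cmult) measurable
    ultimately show "(\<integral>\<^sup>+n. ?I a * ?I (\<sigma> * (n * ?c - a * y) / v) \<partial>lborel) = ?I a * ennreal (v / ?c)" by simp
  qed
  also have "\<dots> = ennreal (v / ?c)" by (subst nn_integral_multc) auto
  also have "ennreal (1 / v) * ennreal (v / ?c) = ennreal (1 / ?c)"
    using v c by (subst ennreal_mult[symmetric]) auto
  finally show ?thesis .
qed

text \<open>Substitution \<open>c = x * v + y * u\<close>, \<open>\<tau> = y / (v * c)\<close>, for
  which \<open>dy dx = c dc d\<tau>\<close>. The weight \<open>1 / c\<close>, which is the area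
  found for \<open>(n, m)\<close>, cancels the Jacobian, and \<open>c\<close> runs through an
  interval of length one.\<close>

lemma nn_integral_tail_coordinates:
  fixes u v :: real and S :: "(real \<times> real \<times> real) set"
  assumes v: "0 < v" and S: "S \<in> sets borel"
  shows "(\<integral>\<^sup>+y. \<integral>\<^sup>+x. indicator {0<..<1} (x * v + y * u) * indicator S (u, v, y / (v * (x * v + y * u))) * ennreal (1 / (x * v + y * u)) \<partial>lborel \<partial>lborel)
    = (\<integral>\<^sup>+\<tau>. indicator S (u, v, \<tau>) \<partial>lborel)"
proof -
  let ?I = "indicator {0<..<1::real} :: real \<Rightarrow> ennreal"
  have mS: "(\<lambda>z. indicator S (f z, g z, h z) :: ennreal) \<in> borel_measurable M"
    if "f \<in> borel_measurable M" "g \<in> borel_measurable M" "h \<in> borel_measurable M" for f g h and M :: "'z measure"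
    by (rule measurable_compose[OF _ borel_measurable_indicator[OF S]]) (intro borel_measurable_Pair that)
  have "(\<integral>\<^sup>+x. ?I (x * v + y * u) * indicator S (u, v, y / (v * (x * v + y * u))) * ennreal (1 / (x * v + y * u)) \<partial>lborel)
      = ennreal (1 / v) * (\<integral>\<^sup>+c. ?I c * indicator S (u, v, y / (v * c)) * ennreal (1 / c) \<partial>lborel)" for y
  proof -
    have "(\<integral>\<^sup>+x. ?I (x * v + y * u) * indicator S (u, v, y / (v * (x * v + y * u))) * ennreal (1 / (x * v + y * u)) \<partial>lborel) =
       ennreal \<bar>1 / v\<bar> * (\<integral>\<^sup>+c. ?I ((- (y * u) / v + 1 / v * c) * v + y * u) * indicator S (u, v, y / (v * ((- (y * u) / v + 1 / v * c) * v + y * u))) * ennreal (1 / ((- (y * u) / v + 1 / v * c) * v + y * u)) \<partial>lborel)"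
      using v by (intro nn_integral_real_affine borel_measurable_times_ennreal mS borel_measurable_indicator_comp) auto
    moreover have "(- (y * u) / v + 1 / v * c) * v + y * u = c" for c using v by (simp add: field_simps)
    ultimately show ?thesis using v by simp
  qed
  then have "(\<integral>\<^sup>+y. \<integral>\<^sup>+x. ?I (x * v + y * u) * indicator S (u, v, y / (v * (x * v + y * u))) * ennreal (1 / (x * v + y * u)) \<partial>lborel \<partial>lborel)
      = (\<integral>\<^sup>+y. ennreal (1 / v) * (\<integral>\<^sup>+c. ?I c * indicator S (u, v, y / (v * c)) * ennreal (1 / c) \<partial>lborel) \<partial>lborel)" by simp
  also have "\<dots> = ennreal (1 / v) * (\<integral>\<^sup>+y. \<integral>\<^sup>+c. ?I c * indicator S (u, v, y / (v * c)) * ennreal (1 / c) \<partial>lborel \<partial>lborel)"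
    by (rule nn_integral_cmult, rule lborel.borel_measurable_nn_integral, unfold case_prod_unfold)
       (intro borel_measurable_times_ennreal mS; measurable)
  also have "(\<integral>\<^sup>+y. \<integral>\<^sup>+c. ?I c * indicator S (u, v, y / (v * c)) * ennreal (1 / c) \<partial>lborel \<partial>lborel)
     = (\<integral>\<^sup>+c. \<integral>\<^sup>+y. ?I c * indicator S (u, v, y / (v * c)) * ennreal (1 / c) \<partial>lborel \<partial>lborel)"
    by (rule nn_integral_lborel_swap, unfold borel_prod[symmetric] case_prod_unfold)
       (intro borel_measurable_times_ennreal mS; measurable)
  also have "\<dots> = (\<integral>\<^sup>+c. ?I c * (ennreal v * (\<integral>\<^sup>+\<tau>. indicator S (u, v, \<tau>) \<partial>lborel)) \<partial>lborel)"
  proof (rule nn_integral_cong)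
    fix c :: real
    show "(\<integral>\<^sup>+y. ?I c * indicator S (u, v, y / (v * c)) * ennreal (1 / c) \<partial>lborel) = ?I c * (ennreal v * (\<integral>\<^sup>+\<tau>. indicator S (u, v, \<tau>) \<partial>lborel))"
    proof (cases "c \<in> {0<..<1}")
      case True
      have "(\<integral>\<^sup>+y. indicator S (u, v, y / (v * c)) \<partial>lborel) = ennreal \<bar>v * c\<bar> * (\<integral>\<^sup>+\<tau>. indicator S (u, v, (0 + v * c * \<tau>) / (v * c)) \<partial>lborel)"
        using v True by (intro nn_integral_real_affine mS) auto
      also have "\<dots> = ennreal (v * c) * (\<integral>\<^sup>+\<tau>. indicator S (u, v, \<tau>) \<partial>lborel)" using v True by simp
      finally have *: "(\<integral>\<^sup>+y. indicator S (u, v, y / (v * c)) \<partial>lborel) = ennreal (v * c) * (\<integral>\<^sup>+\<tau>. indicator S (u, v, \<tau>) \<partial>lborel)" .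
      have "(\<integral>\<^sup>+y. indicator S (u, v, y / (v * c)) * ennreal (1 / c) \<partial>lborel) = ennreal (v * c) * (\<integral>\<^sup>+\<tau>. indicator S (u, v, \<tau>) \<partial>lborel) * ennreal (1 / c)"
        unfolding *[symmetric] by (intro nn_integral_multc mS) measurable
      also have "\<dots> = (ennreal (v * c) * ennreal (1 / c)) * (\<integral>\<^sup>+\<tau>. indicator S (u, v, \<tau>) \<partial>lborel)"
        by (simp only: ac_simps)
      also have "ennreal (v * c) * ennreal (1 / c) = ennreal v"
        using v True by (subst ennreal_mult[symmetric]) auto
      finally show ?thesis using True by simp
    qed simp
  qed
  also have "\<dots> = ennreal v * (\<integral>\<^sup>+\<tau>. indicator S (u, v, \<tau>) \<partial>lborel)"
    by (subst nn_integral_multc) auto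
  also have "ennreal (1 / v) * (ennreal v * (\<integral>\<^sup>+\<tau>. indicator S (u, v, \<tau>) \<partial>lborel)) = (\<integral>\<^sup>+\<tau>. indicator S (u, v, \<tau>) \<partial>lborel)"
    using v by (subst mult.assoc[symmetric], subst ennreal_mult[symmetric]) auto
  finally show ?thesis .
qed

text \<open>All entries are divided by \<open>R\<close>, the root of \<open>N\<close>. The
  conditions put the scaled \<open>c\<close>, \<open>a\<^sub>1\<close>, \<open>a\<^sub>2\<close>
  into the open unit interval and the state with tail \<open>y / x\<close> into
  \<open>S\<close>.\<close>

definition six_region :: "real \<Rightarrow> (real \<times> real \<times> real) set \<Rightarrow> real six set" where
  "six_region \<sigma> S = {((u, v), (y, x), (n, m)). 0 < x * v + y * u \<and> x * v + y * u < 1 \<and> 0 < v \<and>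
     (u, v, y / (v * (x * v + y * u))) \<in> S \<and>
     0 < m * v + n * u \<and> m * v + n * u < 1 \<and> 0 < \<sigma> * (n * x - m * y) \<and> \<sigma> * (n * x - m * y) < 1}"

lemma open_six_region:
  assumes "open S"
  shows "open (six_region \<sigma> S)"
proof -
  define c where "c z = snd (fst (snd z)) * snd (fst z) + fst (fst (snd z)) * fst (fst z)" for z :: "real six"
  define T where "T = {z :: real six. 0 < c z} \<inter> {z. 0 < snd (fst z)}"
  define f where "f z = (fst (fst z), snd (fst z), fst (fst (snd z)) / (snd (fst z) * c z))" for z :: "real six"
  have cc: "continuous_on A c" for A unfolding c_def by (intro continuous_intros)
  have T: "open T" unfolding T_def by (intro open_Int open_Collect_less continuous_intros cc)
  have "continuous_on T f" unfolding f_def by (intro continuous_intros cc) (auto simp: T_def)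
  then have "open (f -` S \<inter> T)" using continuous_on_open_vimage[OF T] assms by blast
  moreover have "six_region \<sigma> S = (f -` S \<inter> T) \<inter> {z. c z < 1} \<inter>
      {z. 0 < snd (snd (snd z)) * snd (fst z) + fst (snd (snd z)) * fst (fst z)} \<inter>
      {z. snd (snd (snd z)) * snd (fst z) + fst (snd (snd z)) * fst (fst z) < 1} \<inter>
      {z. 0 < \<sigma> * (fst (snd (snd z)) * snd (fst (snd z)) - snd (snd (snd z)) * fst (fst (snd z)))} \<inter>
      {z. \<sigma> * (fst (snd (snd z)) * snd (fst (snd z)) - snd (snd (snd z)) * fst (fst (snd z))) < 1}"
    by (auto simp: six_region_def f_def T_def c_def)
  ultimately show ?thesis by (auto intro!: open_Int open_Collect_less continuous_intros cc)
qed

text \<open>Every \<open>(u, v, \<tau>)\<close> carries fibre mass one: the area in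
  \<open>(n, m)\<close> and the Jacobian of \<open>(y, x)\<close> compensate each other. This is why
  the triples lead to the uniform distribution of states.\<close>

theorem emeasure_six_region:
  assumes S: "open S" "S \<subseteq> domW" and \<sigma>: "\<bar>\<sigma>\<bar> = 1"
  shows "emeasure lborel (six_region \<sigma> S) = emeasure lborel S"
proof -
  let ?I = "indicator {0<..<1::real} :: real \<Rightarrow> ennreal"
  have Sb: "S \<in> sets borel" using S(1) by simp
  have \<Omega>: "six_region \<sigma> S \<in> sets borel" using open_six_region[OF S(1)] by simp
  have iP: "(\<lambda>z. indicator (six_region \<sigma> S) (f z) :: ennreal) \<in> borel_measurable borel"
    if "f \<in> borel_measurable borel" for f :: "'z::euclidean_space \<Rightarrow> real six"
    by (rule measurable_compose[OF that borel_measurable_indicator[OF \<Omega>]])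
  have "emeasure lborel (six_region \<sigma> S) = (\<integral>\<^sup>+z. indicator (six_region \<sigma> S) z \<partial>lborel)"
    using \<Omega> by simp
  also have "\<dots> = (\<integral>\<^sup>+uv. \<integral>\<^sup>+w. indicator (six_region \<sigma> S) (uv, w) \<partial>lborel \<partial>lborel)"
    by (rule nn_integral_lborel_pair) (rule iP, simp)
  also have "\<dots> = (\<integral>\<^sup>+uv. \<integral>\<^sup>+\<tau>. indicator S (fst uv, snd uv, \<tau>) \<partial>lborel \<partial>lborel)"
  proof (rule nn_integral_cong)
    fix uv :: "real \<times> real"
    obtain u v where uv: "uv = (u, v)" by (cases uv)
    show "(\<integral>\<^sup>+w. indicator (six_region \<sigma> S) (uv, w) \<partial>lborel) = (\<integral>\<^sup>+\<tau>. indicator S (fst uv, snd uv, \<tau>) \<partial>lborel)"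
    proof (cases "0 < v")
      case False
      have "(u, v, \<tau>) \<notin> S" for \<tau> using False S(2) by (auto simp: domW_def)
      moreover have "(uv, w) \<notin> six_region \<sigma> S" for w using False by (auto simp: six_region_def uv)
      ultimately show ?thesis by (simp add: uv)
    next
      case v: True
      have split: "indicator (six_region \<sigma> S) ((u, v), (y, x), (n, m)) =
          (?I (x * v + y * u) * indicator S (u, v, y / (v * (x * v + y * u)))) *
          (?I (m * v + n * u) * ?I (\<sigma> * (n * x - m * y)))" for y x n m
        using v by (auto simp: six_region_def indicator_def)
      have "(\<integral>\<^sup>+w. indicator (six_region \<sigma> S) ((u, v), w) \<partial>lborel) =
          (\<integral>\<^sup>+yx. \<integral>\<^sup>+nm. indicator (six_region \<sigma> S) ((u, v), yx, nm) \<partial>lborel \<partial>lborel)"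
        by (rule nn_integral_lborel_pair) (rule iP, simp)
      also have "\<dots> = (\<integral>\<^sup>+yx. (?I (snd yx * v + fst yx * u) * indicator S (u, v, fst yx / (v * (snd yx * v + fst yx * u)))) * ennreal (1 / (snd yx * v + fst yx * u)) \<partial>lborel)"
      proof (rule nn_integral_cong)
        fix yx :: "real \<times> real"
        obtain y x where yx: "yx = (y, x)" by (cases yx)
        have "(\<integral>\<^sup>+nm. indicator (six_region \<sigma> S) ((u, v), yx, nm) \<partial>lborel) =
           (\<integral>\<^sup>+n. \<integral>\<^sup>+m. indicator (six_region \<sigma> S) ((u, v), yx, n, m) \<partial>lborel \<partial>lborel)"
          by (rule nn_integral_lborel_pair) (rule iP, simp)
        also have "\<dots> = (\<integral>\<^sup>+n. \<integral>\<^sup>+m. (?I (x * v + y * u) * indicator S (u, v, y / (v * (x * v + y * u)))) *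
          (?I (m * v + n * u) * ?I (\<sigma> * (n * x - m * y))) \<partial>lborel \<partial>lborel)"
          by (simp add: yx split)
        also have "\<dots> = (\<integral>\<^sup>+n. (?I (x * v + y * u) * indicator S (u, v, y / (v * (x * v + y * u)))) *
          (\<integral>\<^sup>+m. ?I (m * v + n * u) * ?I (\<sigma> * (n * x - m * y)) \<partial>lborel) \<partial>lborel)"
          by (intro nn_integral_cong nn_integral_cmult) measurable
        also have "\<dots> = (?I (x * v + y * u) * indicator S (u, v, y / (v * (x * v + y * u)))) *
          (\<integral>\<^sup>+n. \<integral>\<^sup>+m. ?I (m * v + n * u) * ?I (\<sigma> * (n * x - m * y)) \<partial>lborel \<partial>lborel)"
          by (intro nn_integral_cmult) measurable
        also have "\<dots> = (?I (x * v + y * u) * indicator S (u, v, y / (v * (x * v + y * u)))) * ennreal (1 / (x * v + y * u))"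
        proof (cases "0 < x * v + y * u")
          case True
          then show ?thesis by (simp only: nn_integral_parallelogram[OF v True \<sigma>])
        qed simp
        finally show "(\<integral>\<^sup>+nm. indicator (six_region \<sigma> S) ((u, v), yx, nm) \<partial>lborel) =
          (?I (snd yx * v + fst yx * u) * indicator S (u, v, fst yx / (v * (snd yx * v + fst yx * u)))) * ennreal (1 / (snd yx * v + fst yx * u))"
          by (simp add: yx)
      qed
      also have "\<dots> = (\<integral>\<^sup>+y. \<integral>\<^sup>+x. ?I (x * v + y * u) * indicator S (u, v, y / (v * (x * v + y * u))) * ennreal (1 / (x * v + y * u)) \<partial>lborel \<partial>lborel)"
        by (subst nn_integral_lborel_pair)
           (simp_all, intro borel_measurable_times_ennreal borel_measurable_indicator_comp[OF Sb] borel_measurable_indicator_comp borel_measurable_Pair, simp_all add: borel_prod[symmetric])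
      also have "\<dots> = (\<integral>\<^sup>+\<tau>. indicator S (u, v, \<tau>) \<partial>lborel)"
        by (rule nn_integral_tail_coordinates[OF v Sb])
      finally show ?thesis by (simp add: uv)
    qed
  qed
  also have "\<dots> = (\<integral>\<^sup>+u. \<integral>\<^sup>+v. \<integral>\<^sup>+\<tau>. indicator S (u, v, \<tau>) \<partial>lborel \<partial>lborel \<partial>lborel)"
  proof (subst nn_integral_lborel_pair)
    have "(\<lambda>(uv, \<tau>). indicator S (fst uv, snd uv, \<tau>) :: ennreal) \<in> borel_measurable (borel \<Otimes>\<^sub>M lborel)"
    proof -
      have "sets (borel \<Otimes>\<^sub>M lborel) = sets (borel :: ((real \<times> real) \<times> real) measure)"
        by (simp add: borel_prod[symmetric] cong: sets_pair_measure_cong)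
      then have cong: "borel_measurable (borel \<Otimes>\<^sub>M lborel) = (borel_measurable borel :: ((real \<times> real) \<times> real \<Rightarrow> ennreal) set)"
        by (rule measurable_cong_sets) simp
      show ?thesis unfolding case_prod_unfold cong
        by (intro borel_measurable_indicator_comp[OF Sb] borel_measurable_Pair borel_measurable_continuous_onI continuous_intros)
    qed
    then show "(\<lambda>uv. \<integral>\<^sup>+\<tau>. indicator S (fst uv, snd uv, \<tau>) \<partial>lborel) \<in> borel_measurable borel"
      by (rule lborel.borel_measurable_nn_integral)
  qed simp
  also have "\<dots> = (\<integral>\<^sup>+u. \<integral>\<^sup>+w. indicator S (u, w) \<partial>lborel \<partial>lborel)"
  proof (rule nn_integral_cong)
    fix u :: real
    show "(\<integral>\<^sup>+v. \<integral>\<^sup>+\<tau>. indicator S (u, v, \<tau>) \<partial>lborel \<partial>lborel) = (\<integral>\<^sup>+w. indicator S (u, w) \<partial>lborel)"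
      by (rule nn_integral_lborel_pair[symmetric]) (rule measurable_compose[OF _ borel_measurable_indicator[OF Sb]], simp)
  qed
  also have "\<dots> = (\<integral>\<^sup>+z. indicator S z \<partial>lborel)"
    using Sb by (intro nn_integral_lborel_pair[symmetric]) simp
  also have "\<dots> = emeasure lborel S" using Sb by simp
  finally show ?thesis .
qed

section \<open>Volume of the region of states\<close>

lemma alternating_inverse_squares: "(\<lambda>n. (-1) ^ n * (1 / (real (Suc n))\<^sup>2)) sums (pi\<^sup>2 / 12)"
proof -
  let ?a = "\<lambda>n. 1 / (real (Suc n))\<^sup>2"
  \<comment> \<open>Subtracting twice the terms with even denominator \<open>Suc n\<close> makes the
    series alternate; those terms form a quarter of the full sum.\<close>
  define f where "f n = (if odd n then 2 * ?a n else 0)" for n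
  have "(\<lambda>m. f (2 * m + 1)) sums (1 / 2 * (pi\<^sup>2 / 6))"
  proof -
    have "f (2 * m + 1) = 1 / 2 * ?a m" for m
    proof -
      have "real (Suc (2 * m + 1)) = 2 * real (Suc m)" by simp
      then show ?thesis unfolding f_def by (simp only: power_mult_distrib) simp
    qed
    then show ?thesis using sums_mult[OF sums_inverse_squares_Suc, of "1 / 2"] by simp
  qed
  moreover have "strict_mono (\<lambda>m::nat. 2 * m + 1)" by (rule strict_monoI) simp
  moreover have "f n = 0" if "n \<notin> range (\<lambda>m. 2 * m + 1)" for n
    using that by (metis f_def oddE rangeI)
  ultimately have "f sums (1 / 2 * (pi\<^sup>2 / 6))" using sums_mono_reindex[of "\<lambda>m. 2 * m + 1" f] by blast
  then have "(\<lambda>n. ?a n - f n) sums (pi\<^sup>2 / 6 - 1 / 2 * (pi\<^sup>2 / 6))"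
    by (intro sums_diff sums_inverse_squares_Suc)
  moreover have "?a n - f n = (-1) ^ n * ?a n" for n by (simp add: f_def)
  ultimately show ?thesis by simp
qed

text \<open>The antiderivative is minus the dilogarithm at \<open>- u\<close>: its power series is
  differentiated termwise inside the interval and is continuous up to 1 by the M-test, where its
  value is the alternating sum of inverse squares.\<close>

lemma nn_integral_ln_over_id: "(\<integral>\<^sup>+u. ennreal (ln (1 + u) / u) * indicator {0<..<1} u \<partial>lborel) = ennreal (pi\<^sup>2 / 12)"
proof -
  define c where "c n = (if n = 0 then 0 else - ((-1) ^ n) / (real n)\<^sup>2)" for n :: nat
  define F where "F u = (\<Sum>n. c n * u ^ n)" for u :: real
  define f where "f u = (if u \<in> {0..1} then (if u = 0 then 1 else ln (1 + u) / u) else 0)" for u :: real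
  have cS: "c (Suc n) = (-1) ^ n * (1 / (real (Suc n))\<^sup>2)" for n by (simp add: c_def)
  have csum: "c sums (pi\<^sup>2 / 12)"
    using alternating_inverse_squares sums_Suc_iff[of c "pi\<^sup>2 / 12"] by (simp add: cS c_def)
  have cabs: "summable (\<lambda>n. \<bar>c n\<bar>)"
  proof -
    have "summable (\<lambda>n. \<bar>c (Suc n)\<bar>)"
      using sums_summable[OF sums_inverse_squares_Suc] by (simp add: cS abs_mult power_abs)
    then show ?thesis using summable_Suc_iff[of "\<lambda>n. \<bar>c n\<bar>"] by blast
  qed
  have F0: "F 0 = 0" unfolding F_def by (simp add: c_def powser_zero)
  have F1: "F 1 = pi\<^sup>2 / 12" unfolding F_def using csum by (simp add: sums_iff)
  have cont: "continuous_on {0..1} F"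
  proof -
    have "uniform_limit {0..1} (\<lambda>n u. \<Sum>i<n. c i * u ^ i) F sequentially"
      unfolding F_def
    proof (rule Weierstrass_m_test[OF _ cabs])
      fix n and u :: real assume "u \<in> {0..1}"
      then show "norm (c n * u ^ n) \<le> \<bar>c n\<bar>" by (simp add: abs_mult power_le_one mult_left_le)
    qed
    then show ?thesis
      by (rule uniform_limit_theorem[rotated]) (auto intro!: always_eventually continuous_intros)
  qed
  have deriv: "(F has_vector_derivative f u) (at u)" if u: "u \<in> {0<..<1}" for u
  proof -
    have "summable (\<lambda>n. c n * 1 ^ n)" using csum by (simp add: sums_iff)
    then have D: "DERIV F u :> (\<Sum>n. diffs c n * u ^ n)"
      unfolding F_def using u by (intro termdiffs_strong[of c 1]) auto
    have dc: "diffs c n = (-1) ^ n * (1 / real (n + 1))" for n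
      by (simp add: diffs_def cS power2_eq_square del: of_nat_Suc) 
    have "ln (1 + u) = (\<Sum>n. (-1) ^ n * (1 / real (n + 1)) * (1 + u - 1) ^ Suc n)"
      using u by (intro ln_series) auto
    also have "\<dots> = (\<Sum>n. u * (diffs c n * u ^ n))" by (simp add: dc mult.commute mult.left_commute)
    also have "\<dots> = u * (\<Sum>n. diffs c n * u ^ n)"
    proof (rule suminf_mult)
      show "summable (\<lambda>n. diffs c n * u ^ n)"
      proof (rule termdiff_converges[of u 1 c])
        show "norm u < 1" using u by simp
        fix x :: real assume x: "norm x < 1"
        show "summable (\<lambda>n. c n * x ^ n)"
        proof (rule summable_comparison_test'[OF cabs])
          show "norm (c n * x ^ n) \<le> \<bar>c n\<bar>" for n
            using x by (simp add: abs_mult power_abs power_le_one mult_left_le)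
        qed
      qed
    qed
    finally have "(\<Sum>n. diffs c n * u ^ n) = f u" using u by (simp add: f_def)
    then show ?thesis using D by (simp add: has_real_derivative_iff_has_vector_derivative)
  qed
  have "(f has_integral (F 1 - F 0)) {0..1}"
    by (rule fundamental_theorem_of_calculus_interior[OF _ cont deriv]) auto
  then have "((\<lambda>u. if u \<in> {0..1} then f u else 0) has_integral (pi\<^sup>2 / 12)) UNIV"
    by (subst has_integral_restrict_UNIV) (simp add: F0 F1)
  moreover have "(\<lambda>u. if u \<in> {0..1} then f u else 0) = f" by (auto simp: f_def)
  ultimately have "(f has_integral (pi\<^sup>2 / 12)) UNIV" by simp
  moreover have "f \<in> borel_measurable borel" unfolding f_def by measurable
  moreover have "0 \<le> f u" for u by (auto simp: f_def)
  ultimately have "(\<integral>\<^sup>+u. ennreal (f u) \<partial>lborel) = ennreal (pi\<^sup>2 / 12)"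
    by (intro nn_integral_has_integral_lborel)
  moreover have "(\<integral>\<^sup>+u. ennreal (ln (1 + u) / u) * indicator {0<..<1} u \<partial>lborel) = (\<integral>\<^sup>+u. ennreal (f u) \<partial>lborel)"
  proof (rule nn_integral_cong_AE)
    have "AE u in lborel. u \<noteq> 0 \<and> u \<noteq> (1::real)" using AE_lborel_singleton[of 0] AE_lborel_singleton[of 1] by eventually_elim simp
    then show "AE u in lborel. ennreal (ln (1 + u) / u) * indicator {0<..<1} u = ennreal (f u)"
      by eventually_elim (auto simp: f_def indicator_def)
  qed
  ultimately show ?thesis by simp
qed

text \<open>Partial fractions, with the antiderivative normalised as
  \<open>ln (v / (v + u)) / u\<close> so that it vanishes at infinity.\<close>

lemma nn_integral_inner_density:
  assumes u: "0 < u"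
  shows "(\<integral>\<^sup>+v. ennreal (1 / (v * (v + u))) * indicator {1<..} v \<partial>lborel) = ennreal (ln (1 + u) / u)"
proof -
  define F where "F v = (ln v - ln (v + u)) / u" for v
  have "(\<integral>\<^sup>+v. ennreal (1 / (v * (v + u))) * indicator {1..} v \<partial>lborel) = ennreal (0 - F 1)"
  proof (rule nn_integral_FTC_atLeast)
    show "(\<lambda>v. 1 / (v * (v + u))) \<in> borel_measurable borel" by measurable
    show "DERIV F v :> 1 / (v * (v + u))" if "1 \<le> v" for v
    proof -
      have "((\<lambda>v. (ln v - ln (v + u)) / u) has_real_derivative (1 / v - 1 / (v + u)) / u) (at v)"
        using that u by (auto intro!: derivative_eq_intros)
      moreover have "(1 / v - 1 / (v + u)) / u = 1 / (v * (v + u))" using that u by (simp add: divide_simps)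
      ultimately show ?thesis by (simp add: F_def[abs_def])
    qed
    show "0 \<le> 1 / (v * (v + u))" if "1 \<le> v" for v using that u by simp
    have fl: "filterlim (\<lambda>v. v + u) at_top at_top"
      using filterlim_tendsto_add_at_top[OF tendsto_const[of u] filterlim_ident[of at_top]] by (simp add: add.commute)
    have "((\<lambda>v. ln (1 - u / (v + u)) / u) \<longlongrightarrow> ln (1 - 0) / u) at_top"
      by (intro tendsto_divide tendsto_ln tendsto_diff tendsto_const real_tendsto_divide_at_top[OF tendsto_const fl]) (use u in auto)
    moreover have "eventually (\<lambda>v. ln (1 - u / (v + u)) / u = F v) at_top"
      using eventually_gt_at_top[of 0]
    proof eventually_elim
      case (elim v)
      have "1 - u / (v + u) = v / (v + u)" using elim u by (simp add: field_simps)
      then show ?case using elim u by (simp add: F_def ln_div)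
    qed
    ultimately show "(F \<longlongrightarrow> 0) at_top" by (simp add: tendsto_cong)
  qed
  moreover have "(\<integral>\<^sup>+v. ennreal (1 / (v * (v + u))) * indicator {1<..} v \<partial>lborel) = (\<integral>\<^sup>+v. ennreal (1 / (v * (v + u))) * indicator {1..} v \<partial>lborel)"
    by (rule nn_integral_cong_AE, rule eventually_mono[OF AE_lborel_singleton[of 1]]) (auto simp: indicator_def)
  ultimately show ?thesis by (simp add: F_def)
qed

text \<open>The fibre in \<open>\<tau>\<close> has length \<open>1 / (v * (v + u))\<close>; its
  integral over \<open>v > 1\<close> is \<open>ln (1 + u) / u\<close>, which is then integrated over
  \<open>0 < u < 1\<close>.\<close>

theorem emeasure_domW: "emeasure lborel domW = ennreal (pi\<^sup>2 / 12)"
proof -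
  have W: "domW \<in> sets borel" using open_domW by simp
  have iW: "(\<lambda>z. indicator domW (f z) :: ennreal) \<in> borel_measurable borel" if "f \<in> borel_measurable borel" for f :: "'z::euclidean_space \<Rightarrow> real \<times> real \<times> real"
    by (rule borel_measurable_indicator_comp[OF W that])
  have "emeasure lborel domW = (\<integral>\<^sup>+z. indicator domW z \<partial>lborel)" using W by simp
  also have "\<dots> = (\<integral>\<^sup>+u. \<integral>\<^sup>+w. indicator domW (u, w) \<partial>lborel \<partial>lborel)"
    by (rule nn_integral_lborel_pair) (use W in simp)
  also have "\<dots> = (\<integral>\<^sup>+u. ennreal (ln (1 + u) / u) * indicator {0<..<1} u \<partial>lborel)"
  proof (rule nn_integral_cong)
    fix u :: real
    have "(\<integral>\<^sup>+w. indicator domW (u, w) \<partial>lborel) = (\<integral>\<^sup>+v. \<integral>\<^sup>+\<tau>. indicator domW (u, v, \<tau>) \<partial>lborel \<partial>lborel)"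
      by (rule nn_integral_lborel_pair) (rule iW, simp)
    also have "\<dots> = (\<integral>\<^sup>+v. (ennreal (1 / (v * (v + u))) * indicator {1<..} v) * indicator {0<..<1} u \<partial>lborel)"
    proof (rule nn_integral_cong)
      fix v :: real
      show "(\<integral>\<^sup>+\<tau>. indicator domW (u, v, \<tau>) \<partial>lborel) = (ennreal (1 / (v * (v + u))) * indicator {1<..} v) * indicator {0<..<1} u"
      proof (cases "0 < u \<and> u < 1 \<and> 1 < v")
        case True
        then have "0 < v * (v + u)" by simp
        then have "(u, v, \<tau>) \<in> domW \<longleftrightarrow> \<tau> \<in> {0<..<1 / (v * (v + u))}" for \<tau>
          using True by (simp add: domW_def pos_less_divide_eq)
        then have "indicator domW (u, v, \<tau>) = (indicator {0<..<1 / (v * (v + u))} \<tau> :: ennreal)" for \<tau>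
          by (simp add: indicator_def)
        then show ?thesis using True by simp
      next
        case False
        then have "indicator domW (u, v, \<tau>) = (0 :: ennreal)" for \<tau> by (auto simp: domW_def indicator_def)
        then show ?thesis using False by (auto simp: indicator_def)
      qed
    qed
    also have "\<dots> = (\<integral>\<^sup>+v. ennreal (1 / (v * (v + u))) * indicator {1<..} v \<partial>lborel) * indicator {0<..<1} u"
      by (rule nn_integral_multc) measurable
    also have "\<dots> = ennreal (ln (1 + u) / u) * indicator {0<..<1} u"
      by (cases "0 < u") (simp_all add: nn_integral_inner_density)
    finally show "(\<integral>\<^sup>+w. indicator domW (u, w) \<partial>lborel) = ennreal (ln (1 + u) / u) * indicator {0<..<1} u" .
  qed
  also have "\<dots> = ennreal (pi\<^sup>2 / 12)" by (rule nn_integral_ln_over_id)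
  finally show ?thesis .
qed

section \<open>The limit law\<close>

lemma AE_not_in_countable: "countable A \<Longrightarrow> AE x in lborel. x \<notin> (A :: real set)"
  by (rule AE_not_in) (rule countable_imp_null_set_lborel)

lemma tail_of_in_01:
  assumes "(u, v, \<tau>) \<in> domW"
  shows "0 < tail_of (u, v, \<tau>)" "tail_of (u, v, \<tau>) < 1"
proof -
  have d: "0 < 1 - \<tau> * (u * v)" "0 < \<tau>" "1 < v" "\<tau> * (v * (v + u)) < 1"
    using domW_denom[OF assms] assms by (auto simp: domW_def)
  show "0 < tail_of (u, v, \<tau>)" using d by (simp add: tail_of_def)
  have "\<tau> * v\<^sup>2 < 1 - \<tau> * (u * v)" using d(4) by (simp add: power2_eq_square algebra_simps)
  then show "tail_of (u, v, \<tau>) < 1" using d by (simp add: tail_of_def)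
qed

text \<open>For fixed \<open>u\<close> only countably many \<open>v\<close> make
  \<open>u / v\<close> rational, and for fixed \<open>u\<close>, \<open>v\<close> only countably
  many \<open>\<tau>\<close> make the tail rational. The exceptional sets are images of the
  rationals under the inverse functions.\<close>

lemma AE_good_dom: "AE z in lborel. z \<in> domW \<longrightarrow> z \<in> good_dom k"
proof -
  have sets: "{z. z \<in> domW \<longrightarrow> z \<in> good_dom k} \<in> sets borel"
  proof -
    have "{z. z \<in> domW \<longrightarrow> z \<in> good_dom k} = - domW \<union> good_dom k" by auto
    moreover have "domW \<in> sets borel" "good_dom k \<in> sets borel" using open_domW open_good_dom by auto
    ultimately show ?thesis by (auto simp: borel_comp)
  qed
  define P where "P u v \<tau> \<longleftrightarrow> ((u, v, \<tau>) \<in> domW \<longrightarrow> (u, v, \<tau>) \<in> good_dom k)" for u v \<tau>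
  have inner: "AE v in lborel. AE \<tau> in lborel. P u v \<tau>" for u
  proof -
    have "AE v in lborel. v \<notin> (\<lambda>r. u / r) ` \<rat>" by (intro AE_not_in_countable countable_image countable_rat)
    then show ?thesis
    proof eventually_elim
      case (elim v)
      have "AE \<tau> in lborel. \<tau> \<notin> (\<lambda>r. r / (v\<^sup>2 + r * (u * v))) ` \<rat>" by (intro AE_not_in_countable countable_image countable_rat)
      then show ?case
      proof eventually_elim
        case e2: (elim \<tau>)
        show "P u v \<tau>" unfolding P_def
        proof
          assume W: "(u, v, \<tau>) \<in> domW"
          then have w: "0 < u" "u < 1" "1 < v" "0 < \<tau>" by (auto simp: domW_def)
          have "u / v \<notin> \<rat>"
          proof
            assume "u / v \<in> \<rat>"
            moreover have "v = u / (u / v)" using w by simp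
            ultimately show False using elim by blast
          qed
          moreover have "tail_of (u, v, \<tau>) \<notin> \<rat>"
          proof
            assume r: "tail_of (u, v, \<tau>) \<in> \<rat>"
            define r where "r = tail_of (u, v, \<tau>)"
            have "0 < r" using tail_of_in_01[OF W] by (simp add: r_def)
            then have "0 < v\<^sup>2 + r * (u * v)" using w by (intro add_pos_pos) auto
            moreover have "\<tau> * v\<^sup>2 = r * (1 - \<tau> * (u * v))" using domW_denom[OF W] by (simp add: r_def tail_of_def)
            then have "\<tau> * (v\<^sup>2 + r * (u * v)) = r" by (simp add: algebra_simps)
            ultimately have "\<tau> = r / (v\<^sup>2 + r * (u * v))" by (simp add: eq_divide_eq)
            then show False using e2 r unfolding r_def by blast
          qed
          moreover have "0 < u / v" "u / v < 1" using w by auto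
          ultimately show "(u, v, \<tau>) \<in> good_dom k"
            using W tail_of_in_01[OF W] irrational_live by (simp add: good_dom_def)
        qed
      qed
    qed
  qed
  have "AE w in lborel. P u (fst w) (snd w)" for u
  proof -
    have "{w. P u (fst w) (snd w)} = Pair u -` {z. z \<in> domW \<longrightarrow> z \<in> good_dom k}" by (auto simp: P_def)
    moreover have "(\<lambda>w. (u, w)) \<in> borel \<rightarrow>\<^sub>M borel" for u :: real
      by (rule borel_measurable_continuous_onI) (intro continuous_intros)
    ultimately have "{w. P u (fst w) (snd w)} \<in> sets borel" using measurable_sets[OF _ sets, of "Pair u" borel] by simp
    then have "{w \<in> space (lborel \<Otimes>\<^sub>M lborel). P u (fst w) (snd w)} \<in> sets (lborel \<Otimes>\<^sub>M lborel)"
      unfolding lborel_prod by simp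
    then have "AE w in (lborel \<Otimes>\<^sub>M lborel). P u (fst w) (snd w)"
      by (rule lborel_pair.AE_pair_measure) (use inner[of u] in simp)
    then show ?thesis unfolding lborel_prod .
  qed
  then have AE: "AE u in lborel. AE w in lborel. (u, w) \<in> domW \<longrightarrow> (u, w) \<in> good_dom k"
    by (simp add: P_def)
  have "{z \<in> space (lborel \<Otimes>\<^sub>M lborel). z \<in> domW \<longrightarrow> z \<in> good_dom k} \<in> sets (lborel \<Otimes>\<^sub>M lborel)"
    using sets unfolding lborel_prod by simp
  then have "AE z in (lborel \<Otimes>\<^sub>M lborel). z \<in> domW \<longrightarrow> z \<in> good_dom k"
    using AE by (rule lborel_pair.AE_pair_measure)
  then show ?thesis unfolding lborel_prod .
qed

lemma emeasure_good_dom: "emeasure lborel (good_dom k) = ennreal (pi\<^sup>2 / 12)"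
proof -
  have "emeasure lborel (good_dom k) = emeasure lborel domW"
  proof (rule emeasure_eq_AE)
    show "AE z in lborel. z \<in> good_dom k \<longleftrightarrow> z \<in> domW"
      using AE_good_dom[of k] by eventually_elim (auto simp: good_dom_def)
  qed (use open_domW open_good_dom in auto)
  then show ?thesis by (simp add: emeasure_domW)
qed

text \<open>The constant off \<open>good_dom\<close> has mass zero under the uniform measure; it
  extends a map continuous on an open set to a Borel map on the whole space.\<close>

definition limit_law :: "nat \<Rightarrow> (real \<times> (int \<Rightarrow> nat)) measure" where
  "limit_law k = distr (uniform_measure lborel (good_dom k)) borel
     (\<lambda>z. if z \<in> good_dom k then limit_map k z else (0, \<lambda>_. 0))"

lemma limit_map_measurable:
  "(\<lambda>z. if z \<in> good_dom k then limit_map k z else (0, \<lambda>_. 0)) \<in> borel \<rightarrow>\<^sub>M borel"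
  using open_good_dom continuous_on_limit_map by (intro borel_measurable_continuous_on_if) auto

lemma limit_map_measurable':
  "(\<lambda>z. if z \<in> good_dom k then limit_map k z else (0, \<lambda>_. 0)) \<in> uniform_measure lborel A \<rightarrow>\<^sub>M borel"
proof -
  have "sets (uniform_measure lborel A) = sets borel" by simp
  then show ?thesis using limit_map_measurable measurable_cong_sets by blast
qed

lemma prob_space_limit_law: "prob_space (limit_law k)"
proof -
  interpret prob_space "uniform_measure lborel (good_dom k)"
    by (rule prob_space_uniform_measure) (auto simp: emeasure_good_dom)
  show ?thesis unfolding limit_law_def
    by (rule prob_space_distr) (rule limit_map_measurable')
qed

text \<open>The factor is the reciprocal of the volume of \<open>good_dom\<close>. The limit mass of
  an open set of vectors becomes the volume of an open set of states, the form in which both models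
  are estimated.\<close>

lemma measure_limit_law:
  assumes "open G"
  shows "measure (limit_law k) G = 12 / pi\<^sup>2 * measure lborel (limit_map k -` G \<inter> good_dom k)"
    "open (limit_map k -` G \<inter> good_dom k)"
proof -
  show "open (limit_map k -` G \<inter> good_dom k)"
    using continuous_on_open_vimage[OF open_good_dom, THEN iffD1, OF continuous_on_limit_map] assms by blast
  let ?f = "\<lambda>z. if z \<in> good_dom k then limit_map k z else (0, \<lambda>_. 0)"
  have f: "?f \<in> uniform_measure lborel (good_dom k) \<rightarrow>\<^sub>M borel"
    by (rule limit_map_measurable')
  have "?f -` G \<in> sets borel" using measurable_sets[OF limit_map_measurable, of G] assms by simp
  then have fG: "?f -` G \<in> sets lborel" by simp
  have Gb: "G \<in> sets borel" using assms by simp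
  have gd: "good_dom k \<in> sets lborel" using open_good_dom by simp
  have sp: "?f -` G \<inter> space (uniform_measure lborel (good_dom k)) = ?f -` G" by simp
  have "emeasure (limit_law k) G = emeasure (uniform_measure lborel (good_dom k)) (?f -` G)"
    unfolding limit_law_def emeasure_distr[OF f Gb] sp ..
  also have "\<dots> = emeasure lborel (good_dom k \<inter> ?f -` G) / emeasure lborel (good_dom k)"
    by (rule emeasure_uniform_measure[OF gd fG])
  also have "good_dom k \<inter> ?f -` G = limit_map k -` G \<inter> good_dom k" by auto
  finally have "emeasure (limit_law k) G = emeasure lborel (limit_map k -` G \<inter> good_dom k) / ennreal (pi\<^sup>2 / 12)"
    by (simp add: emeasure_good_dom)
  moreover have "emeasure lborel (limit_map k -` G \<inter> good_dom k) = ennreal (measure lborel (limit_map k -` G \<inter> good_dom k))"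
  proof (rule emeasure_eq_ennreal_measure)
    have "emeasure lborel (limit_map k -` G \<inter> good_dom k) \<le> emeasure lborel (good_dom k)"
      by (rule emeasure_mono) (use open_good_dom in auto)
    then show "emeasure lborel (limit_map k -` G \<inter> good_dom k) \<noteq> \<top>"
      by (auto simp: emeasure_good_dom top_unique)
  qed
  ultimately have "emeasure (limit_law k) G = ennreal (measure lborel (limit_map k -` G \<inter> good_dom k) / (pi\<^sup>2 / 12))"
    by (simp add: divide_ennreal)
  then have "measure (limit_law k) G = measure lborel (limit_map k -` G \<inter> good_dom k) / (pi\<^sup>2 / 12)"
    by (intro measure_eq_emeasure_eq_ennreal) simp_all
  then show "measure (limit_law k) G = 12 / pi\<^sup>2 * measure lborel (limit_map k -` G \<inter> good_dom k)"
    by simp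
qed

lemma emeasure_domW_subset:
  assumes "open S" "S \<subseteq> domW"
  shows "emeasure lborel S < \<infinity>"
proof -
  have "emeasure lborel S \<le> emeasure lborel domW" by (rule emeasure_mono) (use assms open_domW in auto)
  also have "\<dots> < \<infinity>" by (simp add: emeasure_domW)
  finally show ?thesis .
qed

section \<open>The triples\<close>

text \<open>The numerator is characterised by its range and by \<open>a1 * b\<close> being congruent
  to \<open>a2\<close>, so the modular inverse never has to be computed.\<close>

lemma rho_of_eq:
  assumes c: "0 < c" and cop: "coprime a1 c" and b: "0 \<le> b" "b < c" and cong: "[a1 * b = a2] (mod c)"
  shows "rho_of (a1, a2, c) = real_of_int b / real_of_int c"
proof -
  let ?i = "modular_inverse c a1"
  have "[?i * a2 = ?i * (a1 * b)] (mod c)" using cong by (intro cong_mult cong_refl) (rule cong_sym)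
  also have "?i * (a1 * b) = (?i * a1) * b" by simp
  also have "[(?i * a1) * b = 1 * b] (mod c)" by (intro cong_mult cong_refl cong_modular_inverse2 cop)
  finally have "(?i * a2) mod c = b mod c" by (simp add: cong_def)
  then show ?thesis using b by (simp add: rho_of_def)
qed

definition six_scale :: "real \<Rightarrow> int six \<Rightarrow> real six" where
  "six_scale R = (\<lambda>((p, q), (y, x), (n, m)). ((p / R, q / R), (y / R, x / R), (n / R, m / R)))"

definition six_good :: "int six \<Rightarrow> bool" where
  "six_good z \<longleftrightarrow> coprime (fst (fst z)) (snd (fst z)) \<and> six_gcd z = 1"

definition triple_of :: "int \<Rightarrow> int six \<Rightarrow> int \<times> int \<times> int" where
  "triple_of \<sigma> = (\<lambda>((p, q), (y, x), (n, m)). (m * q + n * p, \<sigma> * (n * x - m * y), x * q + y * p))"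

lemma six_region_int:
  assumes S: "S \<subseteq> domW" and R: "R > 0" and z: "six_scale R ((p, q), (y, x), (n, m)) \<in> six_region (real_of_int \<sigma>) S"
  shows "0 < p" "real_of_int p < R" "R < real_of_int q" "0 < y" "y < x"
    "0 < x * q + y * p" "real_of_int (x * q + y * p) < R\<^sup>2"
    "0 < m * q + n * p" "real_of_int (m * q + n * p) < R\<^sup>2"
    "0 < \<sigma> * (n * x - m * y)" "real_of_int (\<sigma> * (n * x - m * y)) < R\<^sup>2"
    "(real_of_int p / R, real_of_int q / R, R\<^sup>2 * real_of_int y / (real_of_int q * real_of_int (x * q + y * p))) \<in> S"
proof -
  have e: "(x / R) * (q / R) + (y / R) * (p / R) = real_of_int (x * q + y * p) / R\<^sup>2"
    "(m / R) * (q / R) + (n / R) * (p / R) = real_of_int (m * q + n * p) / R\<^sup>2"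
    "real_of_int \<sigma> * ((n / R) * (x / R) - (m / R) * (y / R)) = real_of_int (\<sigma> * (n * x - m * y)) / R\<^sup>2"
    by (simp_all add: power2_eq_square add_divide_distrib diff_divide_distrib right_diff_distrib)
  have t: "y / R / (q / R * (real_of_int (x * q + y * p) / R\<^sup>2)) = R\<^sup>2 * real_of_int y / (real_of_int q * real_of_int (x * q + y * p))"
    using R by (simp add: power2_eq_square)
  have R2: "0 < R\<^sup>2" using R by simp
  have z': "0 < real_of_int (x * q + y * p) / R\<^sup>2" "real_of_int (x * q + y * p) / R\<^sup>2 < 1"
    "(real_of_int p / R, real_of_int q / R, R\<^sup>2 * real_of_int y / (real_of_int q * real_of_int (x * q + y * p))) \<in> S"
    "0 < real_of_int (m * q + n * p) / R\<^sup>2" "real_of_int (m * q + n * p) / R\<^sup>2 < 1"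
    "0 < real_of_int (\<sigma> * (n * x - m * y)) / R\<^sup>2" "real_of_int (\<sigma> * (n * x - m * y)) / R\<^sup>2 < 1"
    using z unfolding six_scale_def six_region_def prod.case mem_Collect_eq e t by blast+
  show "(real_of_int p / R, real_of_int q / R, R\<^sup>2 * real_of_int y / (real_of_int q * real_of_int (x * q + y * p))) \<in> S" by fact
  show c0: "0 < x * q + y * p" using z'(1) R2 by (simp only: zero_less_divide_iff of_int_0_less_iff) simp
  show "0 < m * q + n * p" using z'(4) R2 by (simp only: zero_less_divide_iff of_int_0_less_iff) simp
  show "0 < \<sigma> * (n * x - m * y)" using z'(6) R2 by (simp only: zero_less_divide_iff of_int_0_less_iff) simp
  show "real_of_int (x * q + y * p) < R\<^sup>2" "real_of_int (m * q + n * p) < R\<^sup>2" "real_of_int (\<sigma> * (n * x - m * y)) < R\<^sup>2"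
    using z'(2,5,7) R2 by (simp_all only: pos_divide_less_eq mult_1)
  have W: "(real_of_int p / R, real_of_int q / R, R\<^sup>2 * real_of_int y / (real_of_int q * real_of_int (x * q + y * p))) \<in> domW" using z'(3) S by blast
  then have w: "0 < real_of_int p / R" "real_of_int p / R < 1" "1 < real_of_int q / R" "0 < R\<^sup>2 * real_of_int y / (real_of_int q * real_of_int (x * q + y * p))"
    "R\<^sup>2 * real_of_int y / (real_of_int q * real_of_int (x * q + y * p)) * (real_of_int q / R * (real_of_int q / R + real_of_int p / R)) < 1" by (auto simp: domW_def)
  have "0 < real_of_int p" using w(1) R by (simp add: zero_less_divide_iff)
  then show "0 < p" by simp
  show "real_of_int p < R" using w(2) R by simp
  show qR: "R < real_of_int q" using w(3) R by simp
  then have "0 < real_of_int q" using R by linarith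
  then have q0: "0 < q" by simp
  have cr: "0 < real_of_int q * real_of_int (x * q + y * p)" using c0 q0 by (intro mult_pos_pos) (simp_all only: of_int_0_less_iff)
  have "0 < R\<^sup>2 * real_of_int y" using w(4) cr by (simp add: zero_less_divide_iff)
  then have "0 < real_of_int y" using R2 by (simp add: zero_less_mult_iff)
  then show "0 < y" by simp
  \<comment> \<open>The last condition of \<open>domW\<close> becomes
    \<open>y * (q + p) < x * q + y * p\<close>, that is, \<open>y < x\<close>: the tail
    \<open>y / x\<close> is less than 1.\<close>
  have "real_of_int q / R * (real_of_int q / R + real_of_int p / R) = real_of_int q * real_of_int (q + p) / R\<^sup>2"
    by (simp add: power2_eq_square add_divide_distrib distrib_left)
  then have "R\<^sup>2 * real_of_int y / (real_of_int q * real_of_int (x * q + y * p)) * (real_of_int q / R * (real_of_int q / R + real_of_int p / R)) = real_of_int (y * (q + p)) / real_of_int (x * q + y * p)"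
    using q0 R by simp
  then have "real_of_int (y * (q + p)) / real_of_int (x * q + y * p) < 1" using w(5) by linarith
  then have "y * (q + p) < x * q + y * p" using c0 by (simp only: pos_divide_less_eq of_int_0_less_iff mult_1 of_int_less_iff)
  then have "y * q < x * q" by (simp add: algebra_simps)
  then show "y < x" using q0 by simp
qed

text \<open>Of the two words with denominators \<open>(p, q)\<close>, the sign
  \<open>\<sigma>\<close> selects the one of determinant \<open>\<sigma>\<close>. With its
  numerators \<open>P\<close>, \<open>P'\<close> and \<open>b = x * P + y * P'\<close>, the value of
  the word at the tail \<open>y / x\<close> is \<open>b / c\<close>, and \<open>b\<close> turns out
  to be the residue defining \<open>\<rho>\<close>.\<close>

lemma triple_of_state:
  assumes S: "S \<subseteq> domW" and N: "N \<ge> 1" and \<sigma>: "\<sigma> = 1 \<or> \<sigma> = -1"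
    and z: "six_scale (sqrt (real N)) ((p, q), (y, x), (n, m)) \<in> six_region (real_of_int \<sigma>) S"
    and good: "six_good ((p, q), (y, x), (n, m))"
  obtains s where "triple_of \<sigma> ((p, q), (y, x), (n, m)) \<in> Q0 N"
    "\<And>s'. straddles (sqrt (real N)) (rho_of (triple_of \<sigma> ((p, q), (y, x), (n, m)))) s' \<longleftrightarrow> s' = s"
    "\<sigma> = 1 \<longleftrightarrow> odd s"
    "cf_state (sqrt (real N)) (rho_of (triple_of \<sigma> ((p, q), (y, x), (n, m)))) s =
       (real_of_int p / sqrt (real N), real_of_int q / sqrt (real N), real N * real_of_int y / (real_of_int q * real_of_int (x * q + y * p)))"
proof -
  define R where "R = sqrt (real N)"
  have R: "R > 0" "R\<^sup>2 = real N" using N by (auto simp: R_def)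
  note F = six_region_int[OF S R(1) z[folded R_def]]
  define c where "c = x * q + y * p"
  define a1 where "a1 = m * q + n * p"
  define a2 where "a2 = \<sigma> * (n * x - m * y)"
  have tr: "triple_of \<sigma> ((p, q), (y, x), (n, m)) = (a1, a2, c)" by (simp add: triple_of_def a1_def a2_def c_def)
  have cop: "coprime p q" and g: "gcd c a1 = 1"
    using good F(6) by (auto simp: six_good_def six_gcd_def c_def a1_def nat_eq_iff)
  have cop1: "coprime a1 c" using g by (simp add: coprime_iff_gcd_eq_1 gcd.commute)
  have bounds: "0 < c" "c \<le> int N" "0 < a1" "a1 \<le> int N" "0 < a2" "a2 \<le> int N"
  proof -
    have "real_of_int c < real N" "real_of_int a1 < real N" "real_of_int a2 < real N"
      using F(7,9,11) unfolding R(2) c_def a1_def a2_def .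
    then show "c \<le> int N" "a1 \<le> int N" "a2 \<le> int N" by linarith+
    show "0 < c" "0 < a1" "0 < a2" using F(6,8,10) by (simp_all add: c_def a1_def a2_def)
  qed
  have Q: "(a1, a2, c) \<in> Q0 N"
  proof -
    have "gcd a1 (gcd a2 c) = gcd a2 (gcd a1 c)" by (simp add: gcd.left_commute)
    then show ?thesis using bounds g by (simp add: Q0_def gcd.commute)
  qed
  have q0: "0 < q" and pq: "p < q" using F(2,3) R(1) by linarith+
  have "coprime (nat p) (nat q)" "0 < nat p" "nat p < nat q" using cop F(1) q0 pq coprime_int_iff[of "nat p" "nat q"] by auto
  then obtain w where w: "pos_word w" "w \<noteq> []" "even (length w) = (\<sigma> = -1)" "cden' w = nat p" "cden w = nat q"
    using exists_word[of "nat p" "nat q" "\<sigma> = -1"] by auto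
  have wp: "int (cden' w) = p" "int (cden w) = q" using w F(1) q0 by auto
  define P P' where "P = int (cnum w)" and "P' = int (cnum' w)"
  have sg: "(-1) ^ length w = - \<sigma>" using w(3) \<sigma> by auto
  have det: "P * p - P' * q = \<sigma>"
    using cnum_cden_det[of w] unfolding wp P_def P'_def by (simp add: sg)
  define b where "b = x * P + y * P'"
  define t where "t = real_of_int y / real_of_int x"
  have t: "0 < t" "t < 1" using F(4,5) by (auto simp: t_def)
  have x0: "0 < x" using F(4,5) by linarith
  have cfe: "cfe w t = real_of_int b / real_of_int c"
  proof -
    have "cfe w t = (real_of_int P + t * real_of_int P') / (real_of_int q + t * real_of_int p)"
      using cfe_eq[OF w(1), of t] t unfolding P_def P'_def wp[symmetric] by simp
    also have "\<dots> = (real_of_int x * (real_of_int P + t * real_of_int P')) / (real_of_int x * (real_of_int q + t * real_of_int p))"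
      using x0 by simp
    also have "real_of_int x * (real_of_int P + t * real_of_int P') = real_of_int b"
      using x0 by (simp add: b_def t_def distrib_left)
    also have "real_of_int x * (real_of_int q + t * real_of_int p) = real_of_int c"
      using x0 by (simp add: c_def t_def distrib_left)
    finally show ?thesis .
  qed
  have b: "0 \<le> b" "b < c"
  proof -
    have "0 < real_of_int b / real_of_int c" "real_of_int b / real_of_int c < 1"
      using cfe_in_01[OF w(1) t] unfolding cfe by auto
    then show "0 \<le> b" "b < c" using bounds(1) by (auto simp: zero_less_divide_iff)
  qed
  have cong: "[a1 * b = a2] (mod c)"
  proof -
    \<comment> \<open>A polynomial identity whose second product vanishes because the determinant of
      the word is \<open>\<sigma>\<close>.\<close>
    have "a1 * b - a2 = (m * P + n * P') * c + (m * y - n * x) * (\<sigma> - (P * p - P' * q)) "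
      unfolding a1_def b_def a2_def c_def by (simp add: algebra_simps)
    then have "a1 * b - a2 = (m * P + n * P') * c" by (simp add: det)
    then show ?thesis by (simp add: cong_iff_dvd_diff)
  qed
  have rho: "rho_of (triple_of \<sigma> ((p, q), (y, x), (n, m))) = cfe w t"
    unfolding tr cfe by (rule rho_of_eq[OF bounds(1) cop1 b cong])
  have str: "straddles R (cfe w t) s' \<longleftrightarrow> s' = length w" for s'
  proof (rule straddles_cfe_iff[OF w(1) t w(2)])
    show "real (cden' w) < R" "R < real (cden w)" using F(2,3) wp by (metis of_int_of_nat_eq)+
  qed
  have "real N * t / (real_of_int q * (real_of_int q + t * real_of_int p)) = real N * real_of_int y / (real_of_int q * real_of_int (x * q + y * p))"
  proof -
    have "real_of_int q + t * real_of_int p = real_of_int (x * q + y * p) / real_of_int x"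
      using x0 by (simp add: t_def add_divide_distrib)
    then show ?thesis using x0 by (simp add: t_def)
  qed
  then have state: "cf_state R (cfe w t) (length w) = (real_of_int p / R, real_of_int q / R, real N * real_of_int y / (real_of_int q * real_of_int (x * q + y * p)))"
    unfolding cf_state_cfe[OF w(1,2) t] R(2) using wp by (metis of_int_of_nat_eq)
  show ?thesis
  proof (rule that[of "length w"])
    show "triple_of \<sigma> ((p, q), (y, x), (n, m)) \<in> Q0 N" unfolding tr by (rule Q)
    show "\<And>s'. straddles (sqrt (real N)) (rho_of (triple_of \<sigma> ((p, q), (y, x), (n, m)))) s' \<longleftrightarrow> s' = length w"
      unfolding rho using str unfolding R_def .
    show "\<sigma> = 1 \<longleftrightarrow> odd (length w)" using w(3) \<sigma> by auto
    show "cf_state (sqrt (real N)) (rho_of (triple_of \<sigma> ((p, q), (y, x), (n, m)))) (length w) =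
       (real_of_int p / sqrt (real N), real_of_int q / sqrt (real N), real N * real_of_int y / (real_of_int q * real_of_int (x * q + y * p)))"
      unfolding rho using state unfolding R_def .
  qed
qed

text \<open>The triple determines \<open>\<rho>\<close>, hence the straddling index, whose parity is
  \<open>\<sigma>\<close>, and the state, which gives \<open>p\<close> and \<open>q\<close>. From
  \<open>\<tau>\<close> and \<open>c\<close> one recovers \<open>y\<close>, from \<open>c\<close>
  then \<open>x\<close>, and \<open>(n, m)\<close> solves a linear system whose determinant is
  \<open>c\<close> up to sign.\<close>

lemma triple_of_inj:
  assumes S: "S \<subseteq> domW" and N: "N \<ge> 1" and \<sigma>: "\<sigma> = 1 \<or> \<sigma> = -1" "\<sigma>' = 1 \<or> \<sigma>' = -1"
    and z: "six_scale (sqrt (real N)) z \<in> six_region (real_of_int \<sigma>) S" "six_good z"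
    and z': "six_scale (sqrt (real N)) z' \<in> six_region (real_of_int \<sigma>') S" "six_good z'"
    and eq: "triple_of \<sigma> z = triple_of \<sigma>' z'"
  shows "\<sigma> = \<sigma>' \<and> z = z'"
proof -
  obtain p q y x n m where zz: "z = ((p, q), (y, x), (n, m))" by (metis surj_pair)
  obtain p' q' y' x' n' m' where zz': "z' = ((p', q'), (y', x'), (n', m'))" by (metis surj_pair)
  have R: "sqrt (real N) > 0" using N by simp
  note F = six_region_int[OF S R z(1)[unfolded zz]]
  obtain s where s: "\<And>i. straddles (sqrt (real N)) (rho_of (triple_of \<sigma> z)) i \<longleftrightarrow> i = s" "\<sigma> = 1 \<longleftrightarrow> odd s"
    "cf_state (sqrt (real N)) (rho_of (triple_of \<sigma> z)) s = (real_of_int p / sqrt (real N), real_of_int q / sqrt (real N), real N * real_of_int y / (real_of_int q * real_of_int (x * q + y * p)))"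
    unfolding zz by (rule triple_of_state[OF S N \<sigma>(1) z(1)[unfolded zz] z(2)[unfolded zz]]) (rule that[unfolded zz])
  obtain s' where s': "\<And>i. straddles (sqrt (real N)) (rho_of (triple_of \<sigma>' z')) i \<longleftrightarrow> i = s'" "\<sigma>' = 1 \<longleftrightarrow> odd s'"
    "cf_state (sqrt (real N)) (rho_of (triple_of \<sigma>' z')) s' = (real_of_int p' / sqrt (real N), real_of_int q' / sqrt (real N), real N * real_of_int y' / (real_of_int q' * real_of_int (x' * q' + y' * p')))"
    unfolding zz' by (rule triple_of_state[OF S N \<sigma>(2) z'(1)[unfolded zz'] z'(2)[unfolded zz']]) (rule that[unfolded zz'])
  have ss: "s' = s" using s(1)[of s'] s'(1)[of s'] unfolding eq by simp
  have \<sigma>e: "\<sigma> = \<sigma>'" using s(2) s'(2) ss \<sigma> by auto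
  have st: "p / sqrt (real N) = p' / sqrt (real N)" "q / sqrt (real N) = q' / sqrt (real N)"
    "real N * real_of_int y / (real_of_int q * real_of_int (x * q + y * p)) = real N * real_of_int y' / (real_of_int q' * real_of_int (x' * q' + y' * p'))"
    using trans[OF sym[OF s(3)[unfolded eq]] s'(3)[unfolded ss]] unfolding prod.inject by blast+
  have pq: "p' = p" "q' = q" using st(1,2) R by simp_all
  have tr: "m * q + n * p = m' * q + n' * p" "\<sigma> * (n * x - m * y) = \<sigma> * (n' * x' - m' * y')" "x * q + y * p = x' * q + y' * p"
    using eq unfolding zz zz' pq \<sigma>e[symmetric] triple_of_def by simp_all
  have q0: "0 < q" using F(3) R by linarith
  have D: "real_of_int q * real_of_int (x * q + y * p) \<noteq> 0" using F(6) q0 by (simp only: mult_eq_0_iff of_int_eq_0_iff) simp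
  have "real N * real_of_int y = real N * real_of_int y'"
    using st(3) D unfolding pq tr(3)[symmetric] of_int_add[symmetric] of_int_mult[symmetric]
    by (simp only: divide_cancel_right of_int_mult) simp
  then have yy: "y' = y" using N by simp
  have "x * q = x' * q" using tr(3) yy by simp
  then have xx: "x' = x" using q0 by simp
  have "n * x - m * y = n' * x - m' * y" using tr(2) \<sigma>(1) unfolding xx yy by auto
  then have l: "(n - n') * x = (m - m') * y" by (simp add: algebra_simps)
  have l2: "(m - m') * q = - (n - n') * p" using tr(1) by (simp add: algebra_simps)
  \<comment> \<open>Eliminating \<open>m - m'\<close> from the two linear equations leaves the
    determinant as a factor of \<open>n - n'\<close>.\<close>
  have "(n - n') * (x * q + y * p) = ((n - n') * x) * q + (n - n') * y * p" by (simp add: algebra_simps)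
  also have "\<dots> = ((m - m') * q) * y + (n - n') * y * p" by (simp add: l)
  also have "\<dots> = 0" unfolding l2 by (simp add: algebra_simps)
  finally have nn: "n' = n" using F(6) by simp
  then have "(m - m') * q = 0" using l2 by simp
  then have "m' = m" using q0 by simp
  then show ?thesis using \<sigma>e pq yy xx nn by (simp add: zz zz')
qed

text \<open>Coprime pairs \<open>(a\<^sub>1, a\<^sub>3)\<close> combine with every
  \<open>a\<^sub>2 \<le> N\<close>. The scale is \<open>N + 1\<close> because the open interval from
  0 to \<open>N + 1\<close> contains exactly the integers \<open>1..N\<close>.\<close>

lemma card_Q0_tendsto: "(\<lambda>N. real (card (Q0 N)) / real N ^ 3) \<longlonglongrightarrow> 6 / pi\<^sup>2"
proof -
  have rng: "int_in (real (Suc N)) 0 1 = {1..int N}" for N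
    by (auto simp: int_in_def)
  have cQ: "card (Q0 N) = N * card (prim_pairs (real (Suc N)) 0 1 0 1)" for N
  proof -
    have "Q0 N = (\<lambda>((i, j), k). (i, k, j)) ` (prim_pairs (real (Suc N)) 0 1 0 1 \<times> {1..int N})"
    proof (intro equalityI subsetI)
      fix a assume a: "a \<in> Q0 N"
      obtain a1 a2 a3 where aa: "a = (a1, a2, a3)" by (cases a)
      have "((a1, a3), a2) \<in> prim_pairs (real (Suc N)) 0 1 0 1 \<times> {1..int N}"
        using a unfolding aa Q0_def prim_pairs_def rng by (simp add: coprime_iff_gcd_eq_1)
      then show "a \<in> (\<lambda>((i, j), k). (i, k, j)) ` (prim_pairs (real (Suc N)) 0 1 0 1 \<times> {1..int N})"
        unfolding aa by (rule rev_image_eqI) simp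
    next
      fix a assume "a \<in> (\<lambda>((i, j), k). (i, k, j)) ` (prim_pairs (real (Suc N)) 0 1 0 1 \<times> {1..int N})"
      then obtain i j k where a: "a = (i, k, j)" "(i, j) \<in> prim_pairs (real (Suc N)) 0 1 0 1" "k \<in> {1..int N}" by auto
      have g: "gcd i j = 1" using a(2) by (simp add: prim_pairs_def coprime_iff_gcd_eq_1)
      have "gcd i (gcd k j) = gcd k (gcd i j)" by (simp add: gcd.left_commute)
      then have "gcd i (gcd k j) = 1" using g by simp
      then show "a \<in> Q0 N" using a g unfolding Q0_def prim_pairs_def rng by simp
    qed
    moreover have "inj_on (\<lambda>((i, j), k). (i, k, j)) A" for A :: "((int \<times> int) \<times> int) set"
      by (auto simp: inj_on_def)
    ultimately show ?thesis by (simp add: card_image card_cartesian_product)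
  qed
  have f1: "filterlim (\<lambda>N. real (Suc N)) at_top sequentially"
    by (rule filterlim_compose[OF filterlim_real_sequentially filterlim_Suc])
  have "(\<lambda>N. real (card (prim_pairs (real (Suc N)) 0 1 0 1)) / (real (Suc N))\<^sup>2) \<longlonglongrightarrow> (1 - 0) * (1 - 0) * (6 / pi\<^sup>2)"
    by (rule filterlim_compose[OF card_prim_pairs_tendsto f1]) auto
  moreover have "(\<lambda>N. (real (Suc N) / real N)\<^sup>2) \<longlonglongrightarrow> 1\<^sup>2"
    by (intro tendsto_power LIMSEQ_Suc_n_over_n)
  ultimately have "(\<lambda>N. real (card (prim_pairs (real (Suc N)) 0 1 0 1)) / (real (Suc N))\<^sup>2 * (real (Suc N) / real N)\<^sup>2) \<longlonglongrightarrow> (1 - 0) * (1 - 0) * (6 / pi\<^sup>2) * 1\<^sup>2"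
    by (rule tendsto_mult)
  moreover have "eventually (\<lambda>N. real (card (prim_pairs (real (Suc N)) 0 1 0 1)) / (real (Suc N))\<^sup>2 * (real (Suc N) / real N)\<^sup>2
      = real (card (Q0 N)) / real N ^ 3) sequentially"
    using eventually_gt_at_top[of 0]
    by eventually_elim (simp add: cQ power_divide power2_eq_square power3_eq_cube del: of_nat_Suc)
  ultimately show ?thesis by (simp add: tendsto_cong)
qed

lemma finite_Q0: "finite (Q0 N)"
  by (rule finite_subset[of _ "{1..int N} \<times> {1..int N} \<times> {1..int N}"]) (auto simp: Q0_def)

lemma Q0_nonempty: "N \<ge> 1 \<Longrightarrow> Q0 N \<noteq> {}"
proof -
  assume "N \<ge> 1"
  then have "(1, 1, 1) \<in> Q0 N" by (simp add: Q0_def)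
  then show ?thesis by blast
qed

text \<open>The free set \<open>A\<close> turns the count into a superadditive set function, to
  which the reduction to boxes applies. The intersection with \<open>six_region\<close> keeps it
  within the domain where \<open>triple_of\<close> is injective.\<close>

definition six_count :: "int \<Rightarrow> (real \<times> real \<times> real) set \<Rightarrow> nat \<Rightarrow> real six set \<Rightarrow> int six set" where
  "six_count \<sigma> S N A = {z. six_scale (sqrt (real N)) z \<in> A \<inter> six_region (real_of_int \<sigma>) S \<and> six_good z}"

lemma finite_six_count:
  assumes "S \<subseteq> domW" "N \<ge> 1" "\<sigma> = 1 \<or> \<sigma> = -1"
  shows "finite (six_count \<sigma> S N A)" "triple_of \<sigma> ` six_count \<sigma> S N A \<subseteq> Q0 N"
    "inj_on (triple_of \<sigma>) (six_count \<sigma> S N A)"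
proof -
  show sub: "triple_of \<sigma> ` six_count \<sigma> S N A \<subseteq> Q0 N"
  proof (rule image_subsetI)
    fix z assume z: "z \<in> six_count \<sigma> S N A"
    obtain p q y x n m where zz: "z = ((p, q), (y, x), (n, m))" by (metis surj_pair)
    show "triple_of \<sigma> z \<in> Q0 N"
      using z unfolding zz six_count_def by (auto intro: triple_of_state[OF assms])
  qed
  show inj: "inj_on (triple_of \<sigma>) (six_count \<sigma> S N A)"
  proof (rule inj_onI)
    fix z z' assume "z \<in> six_count \<sigma> S N A" "z' \<in> six_count \<sigma> S N A" "triple_of \<sigma> z = triple_of \<sigma> z'"
    then show "z = z'" using triple_of_inj[OF assms(1,2,3,3), of z z'] by (simp add: six_count_def)
  qed
  show "finite (six_count \<sigma> S N A)"
    using inj_on_finite[OF inj sub finite_Q0] .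
qed

text \<open>For a box inside the region only the box constraints and the two coprimality conditions
  remain, which is the count evaluated by the nested sieve.\<close>

lemma six_count_box:
  assumes N: "N \<ge> 1" and sub: "cbox A B \<subseteq> six_region (real_of_int \<sigma>) S"
  shows "six_count \<sigma> S N (box A B) = {z \<in> six_points (sqrt (real N)) A B. six_gcd z = 1}"
proof -
  obtain u1 v1 y1 x1 n1 m1 where A: "A = ((u1, v1), (y1, x1), (n1, m1))" by (metis surj_pair)
  obtain u2 v2 y2 x2 n2 m2 where B: "B = ((u2, v2), (y2, x2), (n2, m2))" by (metis surj_pair)
  have R: "sqrt (real N) > 0" using N by simp
  have in_div: "k \<in> int_in (sqrt (real N)) c d \<longleftrightarrow> c < real_of_int k / sqrt (real N) \<and> real_of_int k / sqrt (real N) < d" for k c d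
    using R by (simp add: int_in_def pos_less_divide_eq pos_divide_less_eq mult.commute)
  have box_iff: "((u, v), (y, x), (n, m)) \<in> box A B \<longleftrightarrow>
      u1 < u \<and> u < u2 \<and> v1 < v \<and> v < v2 \<and> y1 < y \<and> y < y2 \<and> x1 < x \<and> x < x2 \<and> n1 < n \<and> n < n2 \<and> m1 < m \<and> m < m2" for u v y x n m
    by (auto simp: A B mem_box Basis_prod_def)
  have "box A B \<subseteq> six_region (real_of_int \<sigma>) S" using sub box_subset_cbox by blast
  then have "six_count \<sigma> S N (box A B) = {z. six_scale (sqrt (real N)) z \<in> box A B \<and> six_good z}"
    by (auto simp: six_count_def)
  also have "\<dots> = {z \<in> six_points (sqrt (real N)) A B. six_gcd z = 1}"
  proof (rule Set.set_eqI)
    fix z :: "int six"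
    obtain p q y x n m where zz: "z = ((p, q), (y, x), (n, m))" by (metis surj_pair)
    show "z \<in> {z. six_scale (sqrt (real N)) z \<in> box A B \<and> six_good z} \<longleftrightarrow> z \<in> {z \<in> six_points (sqrt (real N)) A B. six_gcd z = 1}"
      by (simp add: zz six_scale_def six_good_def six_points_def prim_pairs_def sol_pairs_def in_div box_iff[unfolded A B] A B) blast
  qed
  finally show ?thesis .
qed

text \<open>The region is in general unbounded, which is harmless for a lower bound:
  \<open>lim_ge_open_of_boxes\<close> asks for finite volume, and that volume is the one of
  \<open>S\<close>. Lower corners of closed boxes in it satisfy \<open>u1 \<ge> 0\<close> and
  \<open>v1 > 0\<close>, as the count in a box requires.\<close>

lemma six_count_lim_ge:
  assumes S: "open S" "S \<subseteq> domW" and \<sigma>: "\<sigma> = 1 \<or> \<sigma> = -1"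
  shows "lim_ge (\<lambda>N. real (card (six_count \<sigma> S N UNIV)) / real N ^ 3) ((6 / pi\<^sup>2)\<^sup>2 * measure lborel S) sequentially"
proof -
  let ?U = "six_region (real_of_int \<sigma>) S"
  have s1: "\<bar>real_of_int \<sigma>\<bar> = 1" using \<sigma> by auto
  have em: "emeasure lborel ?U = emeasure lborel S" by (rule emeasure_six_region[OF S s1])
  have "lim_ge (\<lambda>N. real (card (six_count \<sigma> S N ?U)) / real N ^ 3) ((6 / pi\<^sup>2)\<^sup>2 * measure lborel ?U) sequentially"
  proof (rule lim_ge_open_of_boxes[where P = "\<lambda>N A. real (card (six_count \<sigma> S N A)) / real N ^ 3"])
    show "open ?U" by (rule open_six_region[OF S(1)])
    show "emeasure lborel ?U < \<infinity>" unfolding em by (rule emeasure_domW_subset[OF S])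
    show "real (card (six_count \<sigma> S N A)) / real N ^ 3 + real (card (six_count \<sigma> S N B)) / real N ^ 3 \<le> real (card (six_count \<sigma> S N (A \<union> B))) / real N ^ 3"
      if AB: "A \<inter> B = {}" for N A B
    proof (cases "N = 0")
      case False
      then have N: "N \<ge> 1" by simp
      have "six_count \<sigma> S N (A \<union> B) = six_count \<sigma> S N A \<union> six_count \<sigma> S N B" by (auto simp: six_count_def)
      moreover have "six_count \<sigma> S N A \<inter> six_count \<sigma> S N B = {}" using AB by (auto simp: six_count_def)
      ultimately have "card (six_count \<sigma> S N (A \<union> B)) = card (six_count \<sigma> S N A) + card (six_count \<sigma> S N B)"
        using finite_six_count(1)[OF S(2) N \<sigma>] by (simp add: card_Un_disjoint)
      then show ?thesis by (simp add: add_divide_distrib)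
    qed simp
    show "real (card (six_count \<sigma> S N A)) / real N ^ 3 \<le> real (card (six_count \<sigma> S N B)) / real N ^ 3"
      if AB: "A \<subseteq> B" for N A B
    proof (cases "N = 0")
      case False
      then have N: "N \<ge> 1" by simp
      have "six_count \<sigma> S N A \<subseteq> six_count \<sigma> S N B" using AB by (auto simp: six_count_def)
      then have "card (six_count \<sigma> S N A) \<le> card (six_count \<sigma> S N B)"
        using finite_six_count(1)[OF S(2) N \<sigma>] by (rule card_mono[rotated])
      then show ?thesis by (simp add: divide_right_mono)
    qed simp
    show "lim_ge (\<lambda>N. real (card (six_count \<sigma> S N (box A B))) / real N ^ 3) ((6 / pi\<^sup>2)\<^sup>2 * measure lborel (box A B)) sequentially"
      if ne: "box A B \<noteq> {}" and sub: "cbox A B \<subseteq> ?U" for A B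
    proof (rule tendsto_imp_lim_ge)
      obtain u1 v1 y1 x1 n1 m1 where A: "A = ((u1, v1), (y1, x1), (n1, m1))" by (metis surj_pair)
      obtain u2 v2 y2 x2 n2 m2 where B: "B = ((u2, v2), (y2, x2), (n2, m2))" by (metis surj_pair)
      have lt: "u1 < u2" "v1 < v2" "y1 < y2" "x1 < x2" "n1 < n2" "m1 < m2"
        using ne unfolding A B box_ne_empty by (auto simp: Basis_prod_def)
      have "cbox A B \<noteq> {}" using ne box_subset_cbox by blast
      then have "A \<in> cbox A B" by (simp add: box_ne_empty mem_box)
      then have "A \<in> ?U" using sub by blast
      then have uv: "0 \<le> u1" "0 < v1" using S(2) by (auto simp: A six_region_def domW_def)
      have pos: "0 < x * v + y * u \<and> 0 < m * v + n * u" if "((u, v), (y, x), (n, m)) \<in> box A B" for u v y x n m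
      proof -
        have "((u, v), (y, x), (n, m)) \<in> ?U" using that sub box_subset_cbox by blast
        then show ?thesis by (simp add: six_region_def)
      qed
      have f: "filterlim (\<lambda>N. sqrt (real N)) at_top sequentially"
        by (rule filterlim_compose[OF sqrt_at_top filterlim_real_sequentially])
      have "((\<lambda>R. real (card {z \<in> six_points R A B. six_gcd z = 1}) / R ^ 6) \<longlongrightarrow> (6 / pi\<^sup>2)\<^sup>2 * measure lborel (box A B)) at_top"
        by (rule card_six_points_tendsto) (use lt uv pos in \<open>simp_all add: A B\<close>)
      from filterlim_compose[OF this f]
      have "(\<lambda>N. real (card {z \<in> six_points (sqrt (real N)) A B. six_gcd z = 1}) / (sqrt (real N)) ^ 6) \<longlonglongrightarrow> (6 / pi\<^sup>2)\<^sup>2 * measure lborel (box A B)" .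
      moreover have "eventually (\<lambda>N. real (card {z \<in> six_points (sqrt (real N)) A B. six_gcd z = 1}) / (sqrt (real N)) ^ 6
          = real (card (six_count \<sigma> S N (box A B))) / real N ^ 3) sequentially"
        using eventually_ge_at_top[of 1]
      proof eventually_elim
        case (elim N)
        have "(sqrt (real N)) ^ 6 = ((sqrt (real N))\<^sup>2) ^ 3" by (simp add: power_mult[symmetric] del: real_sqrt_pow2)
        then show ?case by (simp add: six_count_box[OF elim sub])
      qed
      ultimately show "(\<lambda>N. real (card (six_count \<sigma> S N (box A B))) / real N ^ 3) \<longlonglongrightarrow> (6 / pi\<^sup>2)\<^sup>2 * measure lborel (box A B)"
        by (rule Lim_transform_eventually)
    qed
  qed simp_all
  moreover have "six_count \<sigma> S N ?U = six_count \<sigma> S N UNIV" for N by (simp add: six_count_def)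
  ultimately show ?thesis by (simp add: measure_def em)
qed

text \<open>The triples obtained from \<open>\<sigma> = 1\<close> and from
  \<open>\<sigma> = -1\<close> are disjoint, since \<open>\<sigma>\<close> is read off from the
  parity of the straddling index. Their share of \<open>Q0 N\<close> is
  \<open>2 * (6 / pi\<^sup>2)\<^sup>2 / (6 / pi\<^sup>2)\<close> times the volume.\<close>

theorem Q0_lim_ge:
  assumes S: "open S" "S \<subseteq> domW"
  shows "lim_ge (\<lambda>N. measure (measure_pmf (pmf_of_set (Q0 N))) {a. \<exists>s. cf_state (sqrt (real N)) (rho_of a) s \<in> S})
    (12 / pi\<^sup>2 * measure lborel S) sequentially"
proof -
  let ?X = "\<lambda>N. {a. \<exists>s. cf_state (sqrt (real N)) (rho_of a) s \<in> S}"
  let ?T = "\<lambda>\<sigma> N. six_count \<sigma> S N UNIV"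
  have "lim_ge (\<lambda>N. real (card (?T 1 N)) / real N ^ 3 + real (card (?T (-1) N)) / real N ^ 3)
      ((6 / pi\<^sup>2)\<^sup>2 * measure lborel S + (6 / pi\<^sup>2)\<^sup>2 * measure lborel S) sequentially"
    by (intro lim_ge_add six_count_lim_ge S) auto
  moreover have "(\<lambda>N. inverse (real (card (Q0 N)) / real N ^ 3)) \<longlonglongrightarrow> inverse (6 / pi\<^sup>2)"
    by (intro tendsto_inverse card_Q0_tendsto) simp
  ultimately have L: "lim_ge (\<lambda>N. (real (card (?T 1 N)) / real N ^ 3 + real (card (?T (-1) N)) / real N ^ 3) * inverse (real (card (Q0 N)) / real N ^ 3))
      (((6 / pi\<^sup>2)\<^sup>2 * measure lborel S + (6 / pi\<^sup>2)\<^sup>2 * measure lborel S) * inverse (6 / pi\<^sup>2)) sequentially"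
    by (rule lim_ge_mult_tendsto) (auto intro!: always_eventually)
  show ?thesis
  proof (rule lim_ge_mono[OF L])
    show "eventually (\<lambda>N. (real (card (?T 1 N)) / real N ^ 3 + real (card (?T (-1) N)) / real N ^ 3) * inverse (real (card (Q0 N)) / real N ^ 3)
        \<le> measure (measure_pmf (pmf_of_set (Q0 N))) (?X N)) sequentially"
      using eventually_ge_at_top[of 1]
    proof eventually_elim
      case (elim N)
      note fin1 = finite_six_count[OF S(2) elim, of 1 UNIV, simplified]
      note fin2 = finite_six_count[OF S(2) elim, of "-1" UNIV, simplified]
      have disj: "triple_of 1 ` ?T 1 N \<inter> triple_of (-1) ` ?T (-1) N = {}"
      proof (rule equals0I)
        fix a assume "a \<in> triple_of 1 ` ?T 1 N \<inter> triple_of (-1) ` ?T (-1) N"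
        then obtain z z' where z: "a = triple_of 1 z" "z \<in> ?T 1 N" "a = triple_of (-1) z'" "z' \<in> ?T (-1) N" by blast
        have "triple_of 1 z = triple_of (-1) z'" using z by simp
        then have "(1::int) = -1 \<and> z = z'"
          by (intro triple_of_inj[OF S(2) elim]) (use z in \<open>auto simp: six_count_def\<close>)
        then show False by simp
      qed
      have inX: "triple_of \<sigma> ` ?T \<sigma> N \<subseteq> Q0 N \<inter> ?X N" if \<sigma>: "\<sigma> = 1 \<or> \<sigma> = -1" for \<sigma>
      proof (rule image_subsetI)
        fix z assume z: "z \<in> ?T \<sigma> N"
        obtain p q y x n m where zz: "z = ((p, q), (y, x), (n, m))" by (metis surj_pair)
        have R: "sqrt (real N) > 0" "(sqrt (real N))\<^sup>2 = real N" using elim by auto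
        have reg: "six_scale (sqrt (real N)) ((p, q), (y, x), (n, m)) \<in> six_region (real_of_int \<sigma>) S"
          and good: "six_good ((p, q), (y, x), (n, m))" using z by (simp_all add: zz six_count_def)
        show "triple_of \<sigma> z \<in> Q0 N \<inter> ?X N"
        proof (rule triple_of_state[OF S(2) elim \<sigma> reg good])
          fix s assume "triple_of \<sigma> ((p, q), (y, x), (n, m)) \<in> Q0 N"
            and st: "cf_state (sqrt (real N)) (rho_of (triple_of \<sigma> ((p, q), (y, x), (n, m)))) s =
              (real_of_int p / sqrt (real N), real_of_int q / sqrt (real N), real N * real_of_int y / (real_of_int q * real_of_int (x * q + y * p)))"
          moreover have "cf_state (sqrt (real N)) (rho_of (triple_of \<sigma> ((p, q), (y, x), (n, m)))) s \<in> S"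
            unfolding st using six_region_int(12)[OF S(2) R(1) reg] unfolding R(2) .
          ultimately show "triple_of \<sigma> z \<in> Q0 N \<inter> ?X N" unfolding zz by blast
        qed
      qed
      have "card (?T 1 N) + card (?T (-1) N) = card (triple_of 1 ` ?T 1 N \<union> triple_of (-1) ` ?T (-1) N)"
        using fin1 fin2 disj by (simp add: card_Un_disjoint card_image)
      also have "\<dots> \<le> card (Q0 N \<inter> ?X N)"
        using inX[of 1] inX[of "-1"] finite_Q0 by (intro card_mono) auto
      finally have le: "real (card (?T 1 N)) + real (card (?T (-1) N)) \<le> real (card (Q0 N \<inter> ?X N))" by linarith
      have m: "measure (measure_pmf (pmf_of_set (Q0 N))) (?X N) = real (card (Q0 N \<inter> ?X N)) / real (card (Q0 N))"
        using Q0_nonempty[OF elim] finite_Q0 by (simp add: measure_pmf_of_set)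
      have cancel: "(a / d + b / d) * inverse (c / d) = (a + b) / c" if "0 < d" for a b c d :: real
        using that by (simp add: add_divide_distrib[symmetric] del: add_divide_distrib)
      have r: "(real (card (?T 1 N)) / real N ^ 3 + real (card (?T (-1) N)) / real N ^ 3) * inverse (real (card (Q0 N)) / real N ^ 3)
          = (real (card (?T 1 N)) + real (card (?T (-1) N))) / real (card (Q0 N))" by (rule cancel) (use elim in simp)
      show ?case unfolding m r by (rule divide_right_mono[OF le]) simp
    qed
    show "12 / pi\<^sup>2 * measure lborel S \<le> ((6 / pi\<^sup>2)\<^sup>2 * measure lborel S + (6 / pi\<^sup>2)\<^sup>2 * measure lborel S) * inverse (6 / pi\<^sup>2)"
      by (simp add: power2_eq_square)
  qed
qed

section \<open>The Gauss measure\<close>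

lemma measurable_gauss_map [measurable]: "gauss_map \<in> borel_measurable borel"
  unfolding gauss_map_def[abs_def] frac_def by measurable

lemma measurable_gauss_map_funpow [measurable]: "gauss_map ^^ n \<in> borel_measurable borel"
proof (induction n)
  case (Suc n)
  have "(gauss_map ^^ Suc n) = (\<lambda>x. gauss_map ((gauss_map ^^ n) x))" by (simp add: o_def)
  then show ?case using measurable_compose[OF Suc measurable_gauss_map] by simp
qed (simp add: id_def)

lemma measurable_cf_digit: "(\<lambda>\<rho>. cf_digit \<rho> j) \<in> borel \<rightarrow>\<^sub>M count_space UNIV"
proof -
  have "(\<lambda>\<rho>. nat \<lfloor>1 / (gauss_map ^^ nat (j - 1)) \<rho>\<rfloor>) \<in> borel \<rightarrow>\<^sub>M count_space UNIV"
  proof -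
    have "(\<lambda>\<rho>. 1 / (gauss_map ^^ nat (j - 1)) \<rho>) \<in> borel_measurable borel" by measurable
    then have "(\<lambda>\<rho>. \<lfloor>1 / (gauss_map ^^ nat (j - 1)) \<rho>\<rfloor>) \<in> borel \<rightarrow>\<^sub>M count_space UNIV" by measurable
    then show ?thesis by (rule measurable_compose) simp
  qed
  then show ?thesis by (cases "1 \<le> j") (simp_all add: cf_digit_def[abs_def])
qed

lemma measurable_cf_denom: "(\<lambda>\<rho>. cf_denom \<rho> s) \<in> borel \<rightarrow>\<^sub>M count_space UNIV"
proof (induction s rule: less_induct)
  case (less s)
  show ?case
  proof (cases s)
    case (Suc n)
    note [measurable] = measurable_cf_digit less[of n] less[of "n - 1"]
    have [measurable]: "(\<lambda>\<rho>. cf_denom \<rho> n) \<in> borel \<rightarrow>\<^sub>M count_space UNIV" "(\<lambda>\<rho>. if n = 0 then 0 else cf_denom \<rho> (n - 1)) \<in> borel \<rightarrow>\<^sub>M count_space UNIV"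
      using less[of n] less[of "n - 1"] Suc by auto
    show ?thesis unfolding Suc cf_denom_Suc by measurable
  qed simp
qed

lemma measurable_real_cf_denom: "(\<lambda>\<rho>. real (cf_denom \<rho> s)) \<in> borel_measurable borel"
  by (rule measurable_compose[OF measurable_cf_denom]) simp

lemma measurable_cf_state: "(\<lambda>\<rho>. cf_state R \<rho> s) \<in> borel \<rightarrow>\<^sub>M borel"
proof -
  note [measurable] = measurable_real_cf_denom
  show ?thesis unfolding cf_state_def Let_def by (intro borel_measurable_Pair) measurable
qed

lemma measurable_renewal_index: "renewal_index R \<in> borel \<rightarrow>\<^sub>M count_space UNIV"
proof -
  note [measurable] = measurable_real_cf_denom
  show ?thesis unfolding renewal_index_def[abs_def] by measurable
qed

lemma measurable_renewal_vector: "renewal_vector k R \<in> borel \<rightarrow>\<^sub>M borel"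
proof -
  have w: "(\<lambda>\<rho>. cf_window k \<rho> s) \<in> borel \<rightarrow>\<^sub>M borel" for s
  proof (rule measurable_coordinatewise_then_product)
    fix j
    have "(\<lambda>\<rho>. cf_window k \<rho> s j) \<in> borel \<rightarrow>\<^sub>M count_space UNIV"
      using measurable_cf_digit by (cases "\<bar>j\<bar> \<le> int k") (simp_all add: cf_window_def)
    then show "(\<lambda>\<rho>. cf_window k \<rho> s j) \<in> borel \<rightarrow>\<^sub>M borel"
      by (rule measurable_compose) simp
  qed
  have "(\<lambda>\<rho>. (real (cf_denom \<rho> s) / R, cf_window k \<rho> s)) \<in> borel \<rightarrow>\<^sub>M borel" for s
    by (intro borel_measurable_Pair w borel_measurable_divide measurable_real_cf_denom borel_measurable_const)
  then have "(\<lambda>\<rho>. (\<lambda>s \<rho>. (real (cf_denom \<rho> s) / R, cf_window k \<rho> s)) (renewal_index R \<rho>) \<rho>) \<in> borel \<rightarrow>\<^sub>M borel"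
    by (rule measurable_compose_countable[OF _ measurable_renewal_index])
  then show ?thesis by (simp add: renewal_vector_def[abs_def] Let_def)
qed

lemma sets_gauss_measure [simp, measurable_cong]: "sets gauss_measure = sets borel"
  by (simp add: gauss_measure_def)

lemma space_gauss_measure [simp]: "space gauss_measure = UNIV"
  by (simp add: gauss_measure_def)

lemma emeasure_gauss_interval:
  assumes "0 \<le> a" "a \<le> b" "b \<le> 1"
  shows "emeasure gauss_measure {a<..<b} = ennreal ((ln (1 + b) - ln (1 + a)) / ln 2)"
proof -
  have "emeasure gauss_measure {a<..<b} = (\<integral>\<^sup>+x. ennreal (indicator {0<..<1} x / (ln 2 * (1 + x))) * indicator {a<..<b} x \<partial>lborel)"
    unfolding gauss_measure_def by (rule emeasure_density) simp_all
  also have "\<dots> = (\<integral>\<^sup>+x. ennreal (1 / (ln 2 * (1 + x))) * indicator {a..b} x \<partial>lborel)"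
  proof (rule nn_integral_cong_AE)
    have "AE x in lborel. x \<noteq> a \<and> x \<noteq> b" using AE_lborel_singleton[of a] AE_lborel_singleton[of b] by eventually_elim simp
    then show "AE x in lborel. ennreal (indicator {0<..<1} x / (ln 2 * (1 + x))) * indicator {a<..<b} x = ennreal (1 / (ln 2 * (1 + x))) * indicator {a..b} x"
      by eventually_elim (use assms in \<open>auto simp: indicator_def\<close>)
  qed
  also have "\<dots> = ennreal (ln (1 + b) / ln 2 - ln (1 + a) / ln 2)"
  proof (rule nn_integral_FTC_Icc[where f = "\<lambda>x. 1 / (ln 2 * (1 + x))" and F = "\<lambda>x. ln (1 + x) / ln 2"])
    show "(\<lambda>x::real. 1 / (ln 2 * (1 + x))) \<in> borel_measurable borel" by measurable
    show "((\<lambda>x. ln (1 + x) / ln 2) has_real_derivative 1 / (ln 2 * (1 + x))) (at x)" if "x \<in> {a..b}" for x :: real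
      using that assms by (auto intro!: derivative_eq_intros simp: divide_simps)
    show "0 \<le> 1 / (ln 2 * (1 + x))" if "x \<in> {a..b}" for x :: real using that assms by simp
  qed (use assms in simp)
  finally show ?thesis by (simp add: diff_divide_distrib)
qed

lemma prob_space_gauss_measure: "prob_space gauss_measure"
proof (rule prob_spaceI)
  have "emeasure gauss_measure UNIV = emeasure gauss_measure {0<..<1}"
    unfolding gauss_measure_def
    by (subst (1 2) emeasure_density) (auto intro!: nn_integral_cong simp: indicator_def)
  then show "emeasure gauss_measure (space gauss_measure) = 1"
    using emeasure_gauss_interval[of 0 1] by simp
qed

interpretation gauss: prob_space gauss_measure by (rule prob_space_gauss_measure)

lemma measure_gauss_interval:
  assumes "0 \<le> a" "a \<le> b" "b \<le> 1"
  shows "measure gauss_measure {a<..<b} = (ln (1 + b) - ln (1 + a)) / ln 2"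
proof -
  have "ln (1 + a) \<le> ln (1 + b)" using assms by simp
  then have "0 \<le> (ln (1 + b) - ln (1 + a)) / ln 2" by simp
  then show ?thesis using emeasure_gauss_interval[OF assms] by (simp add: measure_def)
qed

lemma ln_diff_bounds:
  fixes a b :: real
  assumes "0 \<le> a" "a \<le> b"
  shows "(b - a) / (1 + b) \<le> ln (1 + b) - ln (1 + a)" "ln (1 + b) - ln (1 + a) \<le> (b - a) / (1 + a)"
proof -
  have "ln ((1 + b) / (1 + a)) \<le> (1 + b) / (1 + a) - 1" using assms by (intro ln_le_minus_one) auto
  moreover have "(1 + b) / (1 + a) - 1 = (b - a) / (1 + a)" using assms by (simp add: field_simps)
  ultimately show "ln (1 + b) - ln (1 + a) \<le> (b - a) / (1 + a)" using assms by (simp add: ln_div)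
  have "ln ((1 + a) / (1 + b)) \<le> (1 + a) / (1 + b) - 1" using assms by (intro ln_le_minus_one) auto
  moreover have "(1 + a) / (1 + b) - 1 = - ((b - a) / (1 + b))" using assms by (simp add: field_simps)
  ultimately show "(b - a) / (1 + b) \<le> ln (1 + b) - ln (1 + a)" using assms by (simp add: ln_div)
qed

text \<open>Each digit reverses the orientation of the interval; \<open>min\<close> and
  \<open>max\<close> avoid a distinction by the parity of the length.\<close>

lemma cfe_image:
  assumes "pos_word w" "0 \<le> a" "a < b"
  shows "cfe w ` {a<..<b} = {min (cfe w a) (cfe w b)<..<max (cfe w a) (cfe w b)} \<and> 0 \<le> cfe w a \<and> 0 \<le> cfe w b \<and> cfe w a \<noteq> cfe w b"
  using assms(1)
proof (induction w)
  case Nil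
  then show ?case using assms by auto
next
  case (Cons h w)
  define c d where "c = min (cfe w a) (cfe w b)" and "d = max (cfe w a) (cfe w b)"
  have IH: "cfe w ` {a<..<b} = {c<..<d}" "0 \<le> cfe w a" "0 \<le> cfe w b" "cfe w a \<noteq> cfe w b" using Cons by (auto simp: c_def d_def)
  have cd: "0 \<le> c" "c < d" using IH by (auto simp: c_def d_def)
  have h: "0 < real h" using Cons.prems by auto
  have "(\<lambda>y. 1 / (real h + y)) ` {c<..<d} = {1 / (real h + d)<..<1 / (real h + c)}"
  proof (intro equalityI subsetI)
    fix z assume "z \<in> (\<lambda>y. 1 / (real h + y)) ` {c<..<d}"
    then show "z \<in> {1 / (real h + d)<..<1 / (real h + c)}" using cd h by (auto intro!: divide_strict_left_mono mult_pos_pos)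
  next
    fix z assume z: "z \<in> {1 / (real h + d)<..<1 / (real h + c)}"
    have "0 < 1 / (real h + d)" "1 / (real h + d) < z" using cd h z by auto
    then have z0: "0 < z" by (rule less_trans)
    have "real h + c < 1 / z" "1 / z < real h + d" using z z0 cd h by (auto simp: field_simps)
    then show "z \<in> (\<lambda>y. 1 / (real h + y)) ` {c<..<d}" using z0 by (intro image_eqI[of _ _ "1 / z - real h"]) auto
  qed
  moreover have "cfe (h # w) ` {a<..<b} = (\<lambda>y. 1 / (real h + y)) ` (cfe w ` {a<..<b})" by (simp add: image_image)
  moreover have "1 / (real h + d) = min (cfe (h # w) a) (cfe (h # w) b)" "1 / (real h + c) = max (cfe (h # w) a) (cfe (h # w) b)"
  proof -
    have lt: "1 / (real h + d) < 1 / (real h + c)" using cd h by (intro divide_strict_left_mono mult_pos_pos) auto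
    show "1 / (real h + d) = min (cfe (h # w) a) (cfe (h # w) b)" "1 / (real h + c) = max (cfe (h # w) a) (cfe (h # w) b)"
      using lt IH(4) by (cases "cfe w a < cfe w b"; simp add: c_def d_def)+
  qed
  ultimately show ?case using IH h by auto
qed

section \<open>Gauss measure of cylinders\<close>

lemma cfe_le_1:
  assumes "pos_word w" "0 \<le> x" "x \<le> 1"
  shows "cfe w x \<le> 1"
proof (cases w)
  case (Cons h w')
  have "0 \<le> cfe w' x" using assms(2) by (induction w') auto
  moreover have "1 \<le> real h" using assms(1) Cons by auto
  ultimately show ?thesis by (simp add: Cons)
qed (use assms in simp)

text \<open>The mass of the numbers that begin with the digits \<open>w\<close> and have their tail
  between \<open>a\<close> and \<open>b\<close>; \<open>gm w 0 1\<close> is the mass of the whole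
  cylinder.\<close>

definition gm :: "nat list \<Rightarrow> real \<Rightarrow> real \<Rightarrow> real" where
  "gm w a b = measure gauss_measure (cfe w ` {a<..<b})"

lemma gm_eq:
  assumes "pos_word w" "0 \<le> a" "a < b" "b \<le> 1"
  shows "gm w a b = \<bar>ln (1 + cfe w b) - ln (1 + cfe w a)\<bar> / ln 2"
    "gm w a b = (ln (1 + max (cfe w a) (cfe w b)) - ln (1 + min (cfe w a) (cfe w b))) / ln 2"
proof -
  note I = cfe_image[OF assms(1-3)]
  have le: "cfe w a \<le> 1" "cfe w b \<le> 1" using assms by (auto intro!: cfe_le_1)
  show 2: "gm w a b = (ln (1 + max (cfe w a) (cfe w b)) - ln (1 + min (cfe w a) (cfe w b))) / ln 2"
    unfolding gm_def I[THEN conjunct1] using I le by (intro measure_gauss_interval) auto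
  then show "gm w a b = \<bar>ln (1 + cfe w b) - ln (1 + cfe w a)\<bar> / ln 2"
    using I by (auto simp: min_def max_def)
qed

lemma cfe_abs_diff:
  assumes "pos_word w" "0 \<le> a" "a \<le> b"
  shows "\<bar>cfe w b - cfe w a\<bar> = (b - a) / ((real (cden w) + a * real (cden' w)) * (real (cden w) + b * real (cden' w)))"
proof -
  have pos: "0 < (real (cden w) + a * real (cden' w)) * (real (cden w) + b * real (cden' w))"
    using cden_pos[OF assms(1)] assms by (intro mult_pos_pos add_pos_nonneg) auto
  have sg: "\<bar>(-1) ^ length w * (b - a)\<bar> = b - a" using assms(3) by (cases "even (length w)") auto
  show ?thesis unfolding cfe_diff[OF assms(1,2) order_trans[OF assms(2,3)]] abs_divide sg abs_of_pos[OF pos] ..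
qed

lemma gm_bounds:
  assumes "pos_word w" "0 \<le> a" "a < b" "b \<le> 1"
  shows "\<bar>cfe w b - cfe w a\<bar> / (ln 2 * (1 + max (cfe w a) (cfe w b))) \<le> gm w a b"
    "gm w a b \<le> \<bar>cfe w b - cfe w a\<bar> / (ln 2 * (1 + min (cfe w a) (cfe w b)))"
proof -
  note I = cfe_image[OF assms(1-3)]
  have e: "max (cfe w a) (cfe w b) - min (cfe w a) (cfe w b) = \<bar>cfe w b - cfe w a\<bar>" by (auto simp: min_def max_def)
  have l: "0 \<le> min (cfe w a) (cfe w b)" "min (cfe w a) (cfe w b) \<le> max (cfe w a) (cfe w b)" using I by auto
  show "\<bar>cfe w b - cfe w a\<bar> / (ln 2 * (1 + max (cfe w a) (cfe w b))) \<le> gm w a b"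
    using divide_right_mono[OF ln_diff_bounds(1)[OF l], of "ln 2"] unfolding gm_eq(2)[OF assms] e by (simp add: mult.commute)
  show "gm w a b \<le> \<bar>cfe w b - cfe w a\<bar> / (ln 2 * (1 + min (cfe w a) (cfe w b)))"
    using divide_right_mono[OF ln_diff_bounds(2)[OF l], of "ln 2"] unfolding gm_eq(2)[OF assms] e by (simp add: mult.commute)
qed

lemma gm_nonneg: "0 \<le> gm w a b"
  by (simp add: gm_def)

lemma gm_Nil: "gm [] 0 1 = 1"
  using gm_eq(1)[of "[]" 0 1] by simp

lemma gm_add:
  assumes "pos_word w" "0 \<le> a" "a < b" "b < c" "c \<le> 1"
  shows "gm w a c = gm w a b + gm w b c"
proof -
  have d: "cfe w b - cfe w a = (-1) ^ length w * \<bar>cfe w b - cfe w a\<bar>" if "0 \<le> a" "a \<le> b" for a b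
    unfolding cfe_abs_diff[OF assms(1) that] unfolding cfe_diff[OF assms(1) that(1) order_trans[OF that]] by simp
  have "(cfe w a \<le> cfe w b \<and> cfe w b \<le> cfe w c) \<or> (cfe w c \<le> cfe w b \<and> cfe w b \<le> cfe w a)"
    using d[of a b] d[of b c] assms by (cases "even (length w)") auto
  moreover have "0 \<le> cfe w a" "0 \<le> cfe w b" "0 \<le> cfe w c" using cfe_image[OF assms(1,2,3)] cfe_image[OF assms(1) _ assms(4)] assms by auto
  ultimately have "\<bar>ln (1 + cfe w c) - ln (1 + cfe w a)\<bar> = \<bar>ln (1 + cfe w b) - ln (1 + cfe w a)\<bar> + \<bar>ln (1 + cfe w c) - ln (1 + cfe w b)\<bar>"
    by (auto simp: abs_if)
  then show ?thesis using assms by (simp add: gm_eq(1) add_divide_distrib)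
qed

lemma gm_snoc:
  assumes "0 < h"
  shows "gm (w @ [h]) 0 1 = gm w (1 / real (Suc h)) (1 / real h)"
proof -
  have "cfe [h] ` {0<..<1} = {1 / real (Suc h)<..<1 / real h}"
    using cfe_image[of "[h]" 0 1] assms by (simp add: min_def max_def divide_simps add.commute)
  moreover have "cfe (w @ [h]) = cfe w \<circ> cfe [h]" by (rule ext) (simp add: cfe_append)
  then have "cfe (w @ [h]) ` {0<..<1} = cfe w ` (cfe [h] ` {0<..<1})" by (simp only: image_comp)
  ultimately show ?thesis by (simp add: gm_def)
qed

text \<open>Appending the digit \<open>h\<close> confines the tail to the interval from
  \<open>1 / (h + 1)\<close> to \<open>1 / h\<close>, so the sum telescopes; end points carry no
  mass.\<close>

lemma sum_gm_snoc:
  assumes w: "pos_word w" and a: "0 < a"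
  shows "(\<Sum>h\<in>{a..<a + n}. gm (w @ [h]) 0 1) = (if n = 0 then 0 else gm w (1 / real (a + n)) (1 / real a))"
proof (induction n)
  case (Suc n)
  have "(\<Sum>h\<in>{a..<a + Suc n}. gm (w @ [h]) 0 1) = (\<Sum>h\<in>{a..<a + n}. gm (w @ [h]) 0 1) + gm w (1 / real (Suc (a + n))) (1 / real (a + n))"
    using a by (simp add: gm_snoc)
  also have "\<dots> = gm w (1 / real (a + Suc n)) (1 / real a)"
  proof (cases "n = 0")
    case False
    have "gm w (1 / real (a + Suc n)) (1 / real a) = gm w (1 / real (a + Suc n)) (1 / real (a + n)) + gm w (1 / real (a + n)) (1 / real a)"
      using a False by (intro gm_add w) (auto intro!: divide_strict_left_mono)
    then show ?thesis using Suc False by simp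
  qed (use Suc in simp)
  finally show ?case by simp
qed simp

section \<open>States inside a cylinder\<close>

definition state_set :: "real \<Rightarrow> (real \<times> real \<times> real) set \<Rightarrow> real set" where
  "state_set R S = {\<rho>. \<exists>s. cf_state R \<rho> s \<in> S}"

definition cyl_state :: "nat list \<Rightarrow> real \<Rightarrow> (real \<times> real \<times> real) set \<Rightarrow> real set" where
  "cyl_state w R S = cfe w ` {0<..<1} \<inter> state_set R S"

lemma state_set_sets: "open S \<Longrightarrow> state_set R S \<in> sets borel"
proof -
  assume S: "open S"
  have "state_set R S = (\<Union>s. (\<lambda>\<rho>. cf_state R \<rho> s) -` S)" unfolding state_set_def by blast
  moreover have "(\<lambda>\<rho>. cf_state R \<rho> s) -` S \<in> sets borel" for s
    using measurable_sets[OF measurable_cf_state, of S R s] S by simp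
  ultimately show ?thesis by auto
qed

lemma cfe_image_sets: "pos_word w \<Longrightarrow> 0 \<le> a \<Longrightarrow> a < b \<Longrightarrow> cfe w ` {a<..<b} \<in> sets borel"
  using cfe_image[of w a b] by simp

lemma cyl_state_sets: "open S \<Longrightarrow> pos_word w \<Longrightarrow> cyl_state w R S \<in> sets borel"
  using state_set_sets[of S R] cfe_image_sets[of w 0 1] by (auto simp: cyl_state_def)

text \<open>When \<open>q'\<close> is small against \<open>q\<close>, the tail is nearly Lebesgue
  distributed in the cylinder. One factor \<open>1 + \<epsilon>\<close> comes from the denominators
  \<open>q + t * q'\<close>, which lie between \<open>q\<close> and
  \<open>(1 + \<epsilon>) * q\<close>; the other comes from the Gauss density, as the cylinder has
  length at most \<open>1 / q \<le> \<epsilon>\<close>.\<close>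

lemma gm_lower:
  assumes w: "pos_word w" and e: "0 < \<epsilon>" "real (cden' w) \<le> \<epsilon> * real (cden w)" "1 \<le> \<epsilon> * real (cden w)"
    and ab: "0 \<le> a" "a < b" "b \<le> 1"
  shows "gm w 0 1 / (1 + \<epsilon>)\<^sup>2 * (b - a) \<le> gm w a b"
proof -
  define q q' where "q = real (cden w)" and "q' = real (cden' w)"
  have q: "1 \<le> q" "0 \<le> q'" using cden_pos[OF w] by (auto simp: q_def q'_def)
  have qe: "q' \<le> \<epsilon> * q" "1 \<le> \<epsilon> * q" using e by (auto simp: q_def q'_def)
  define m where "m = min (cfe w 0) (cfe w 1)"
  have L: "\<bar>cfe w 1 - cfe w 0\<bar> = 1 / (q * (q + q'))" using cfe_abs_diff[OF w, of 0 1] by (simp add: q_def q'_def)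
  have m0: "0 \<le> m" "max (cfe w 0) (cfe w 1) = m + 1 / (q * (q + q'))"
    using cfe_image[OF w, of 0 1] L[symmetric] by (auto simp: m_def min_def max_def)
  have sub: "cfe w ` {a<..<b} \<subseteq> cfe w ` {0<..<1}" using ab by (intro image_mono) auto
  have I: "cfe w ` {a<..<b} = {min (cfe w a) (cfe w b)<..<max (cfe w a) (cfe w b)}" "cfe w a \<noteq> cfe w b"
    using cfe_image[OF w ab(1,2)] by auto
  have "cfe w ` {0<..<1} = {m<..<m + 1 / (q * (q + q'))}"
    using cfe_image[OF w, of 0 1] m0(2) by (simp add: m_def)
  then have "{min (cfe w a) (cfe w b)<..<max (cfe w a) (cfe w b)} \<subseteq> {m<..<m + 1 / (q * (q + q'))}" using sub I by simp
  moreover have "min (cfe w a) (cfe w b) < max (cfe w a) (cfe w b)" using I(2) by (simp add: min_def max_def)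
  ultimately have "max (cfe w a) (cfe w b) \<le> m + 1 / (q * (q + q'))"
    by (subst (asm) greaterThanLessThan_subseteq_greaterThanLessThan) auto
  moreover have q2: "1 / (q * (q + q')) \<le> \<epsilon>"
  proof -
    have "1 / (q * (q + q')) \<le> 1 / (q * 1)" using q by (intro divide_left_mono mult_left_mono mult_pos_pos) auto
    also have "\<dots> \<le> \<epsilon>" using qe(2) q by (simp add: pos_divide_le_eq)
    finally show ?thesis .
  qed
  ultimately have M: "1 + max (cfe w a) (cfe w b) \<le> (1 + m) * (1 + \<epsilon>)"
  proof -
    have "1 + m + \<epsilon> \<le> (1 + m) * (1 + \<epsilon>)" using m0(1) e(1) by (simp add: distrib_left distrib_right)
    with \<open>max (cfe w a) (cfe w b) \<le> _\<close> q2 show ?thesis by linarith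
  qed
  have M0: "0 < 1 + max (cfe w a) (cfe w b)" using cfe_image[OF w ab(1,2)] by (auto simp: max_def)
  have "gm w 0 1 \<le> 1 / (q * (q + q')) / (ln 2 * (1 + m))"
    using gm_bounds(2)[OF w, of 0 1] by (simp add: L m_def)
  moreover have "0 \<le> (b - a) / (1 + \<epsilon>)\<^sup>2" using ab by simp
  ultimately have "gm w 0 1 * ((b - a) / (1 + \<epsilon>)\<^sup>2) \<le> 1 / (q * (q + q')) / (ln 2 * (1 + m)) * ((b - a) / (1 + \<epsilon>)\<^sup>2)"
    by (rule mult_right_mono)
  also have "\<dots> = (b - a) / ((q * (1 + \<epsilon>)) * (q + q')) / (ln 2 * ((1 + m) * (1 + \<epsilon>)))"
    by (simp add: power2_eq_square)
  also have "\<dots> \<le> (b - a) / ((q + a * q') * (q + b * q')) / (ln 2 * (1 + max (cfe w a) (cfe w b)))"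
  proof (intro frac_le)
    have "a * q' \<le> 1 * q'" "b * q' \<le> 1 * q'" using ab q by (intro mult_right_mono; simp)+
    then have "q + a * q' \<le> q + 1 * q'" "q + b * q' \<le> q + 1 * q'" by simp_all
    moreover have "q + 1 * q' \<le> q * (1 + \<epsilon>)" using qe(1) by (simp add: algebra_simps)
    ultimately show "(q + a * q') * (q + b * q') \<le> (q * (1 + \<epsilon>)) * (q + q')"
      using q ab e(1) by (intro mult_mono) auto
    show "ln 2 * (1 + max (cfe w a) (cfe w b)) \<le> ln 2 * ((1 + m) * (1 + \<epsilon>))" using M by (intro mult_left_mono) auto
    have "0 < q + a * q'" "0 < q + b * q'" using q ab by (auto intro!: add_pos_nonneg)
    then show "0 < (q + a * q') * (q + b * q')" by simp
    show "0 \<le> (b - a) / ((q + a * q') * (q + b * q'))" using \<open>0 < q + a * q'\<close> \<open>0 < q + b * q'\<close> ab by simp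
    show "0 < ln 2 * (1 + max (cfe w a) (cfe w b))" using M0 by simp
    show "0 \<le> b - a" "b - a \<le> b - a" using ab by simp_all
  qed
  also have "\<dots> = \<bar>cfe w b - cfe w a\<bar> / (ln 2 * (1 + max (cfe w a) (cfe w b)))"
    using cfe_abs_diff[OF w ab(1)] ab by (simp add: q_def q'_def)
  also have "\<dots> \<le> gm w a b" by (rule gm_bounds(1)[OF w ab])
  finally show ?thesis by simp
qed

text \<open>As a function of the tail, \<open>\<tau>\<close> is an increasing Moebius function
  \<open>T\<close> with inverse \<open>g\<close>, and differences of \<open>cfe w\<close> are
  differences of \<open>T\<close> divided by \<open>R\<^sup>2\<close>, up to sign. A range of
  \<open>\<tau>\<close> thus occupies a length that does not depend on the word. The upper end lying
  in \<open>domW\<close> keeps \<open>g \<beta>\<close> below 1.\<close>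

lemma cfe_state_interval:
  fixes R \<alpha> \<beta> :: real
  assumes w: "pos_word w" "w \<noteq> []" and R: "R > 0"
    and W: "0 < cden' w" "real (cden' w) < R" "R < real (cden w)"
    and \<alpha>\<beta>: "0 < \<alpha>" "\<alpha> < \<beta>" and \<beta>: "(real (cden' w) / R, real (cden w) / R, \<beta>) \<in> domW"
  obtains a b where "0 < a" "a < b" "b < 1"
    "\<And>t. a < t \<Longrightarrow> t < b \<Longrightarrow> \<alpha> < R\<^sup>2 * t / (real (cden w) * (real (cden w) + t * real (cden' w)))
      \<and> R\<^sup>2 * t / (real (cden w) * (real (cden w) + t * real (cden' w))) < \<beta>"
    "\<bar>cfe w b - cfe w a\<bar> = (\<beta> - \<alpha>) / R\<^sup>2"
proof -
  define q q' where "q = real (cden w)" and "q' = real (cden' w)"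
  have q: "0 < q" "0 < q'" using cden_pos[OF w(1)] W by (auto simp: q_def q'_def)
  define T where "T t = R\<^sup>2 * t / (q * (q + t * q'))" for t
  define g where "g \<tau> = \<tau> * q\<^sup>2 / (R\<^sup>2 - \<tau> * (q' * q))" for \<tau>
  have R2: "0 < R\<^sup>2" using R by simp
  have \<beta>c: "\<beta> * (q * (q + q')) < R\<^sup>2"
  proof -
    have "\<beta> * (q / R * (q / R + q' / R)) < 1" using \<beta> by (simp add: domW_def q_def q'_def)
    moreover have "\<beta> * (q / R * (q / R + q' / R)) = \<beta> * (q * (q + q')) / R\<^sup>2"
      by (simp add: power2_eq_square add_divide_distrib distrib_left)
    ultimately show ?thesis using R2 by simp
  qed
  have g: "0 < R\<^sup>2 - \<tau> * (q' * q)" "0 < g \<tau>" "g \<tau> < 1" "T (g \<tau>) = \<tau>" if \<tau>: "0 < \<tau>" "\<tau> \<le> \<beta>" for \<tau>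
  proof -
    have le: "\<tau> * (q * (q + q')) < R\<^sup>2"
    proof -
      have "\<tau> * (q * (q + q')) \<le> \<beta> * (q * (q + q'))" using \<tau> q by (intro mult_right_mono) auto
      then show ?thesis using \<beta>c by linarith
    qed
    have e: "\<tau> * (q * (q + q')) = \<tau> * q\<^sup>2 + \<tau> * (q' * q)" by (simp add: power2_eq_square algebra_simps)
    have p: "0 < \<tau> * q\<^sup>2" using \<tau> q by simp
    show D: "0 < R\<^sup>2 - \<tau> * (q' * q)" using le e p by linarith
    show "0 < g \<tau>" using D p by (simp add: g_def)
    show "g \<tau> < 1" using D le e by (simp add: g_def)
    have "q + g \<tau> * q' = q * R\<^sup>2 / (R\<^sup>2 - \<tau> * (q' * q))"
    proof -
      have "q + g \<tau> * q' = (q * (R\<^sup>2 - \<tau> * (q' * q)) + \<tau> * q\<^sup>2 * q') / (R\<^sup>2 - \<tau> * (q' * q))"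
        using D by (simp add: g_def add_divide_distrib)
      also have "q * (R\<^sup>2 - \<tau> * (q' * q)) + \<tau> * q\<^sup>2 * q' = q * R\<^sup>2" by (simp add: power2_eq_square algebra_simps)
      finally show ?thesis .
    qed
    then show "T (g \<tau>) = \<tau>" using D q R unfolding T_def g_def by (simp add: power2_eq_square)
  qed
  have Tdiff: "T y - T x = R\<^sup>2 * (y - x) / ((q + x * q') * (q + y * q'))" if "0 \<le> x" "0 \<le> y" for x y
  proof -
    have p: "0 < q + x * q'" "0 < q + y * q'" using that q by (auto intro!: add_pos_nonneg)
    have "T y - T x = (R\<^sup>2 * y * (q * (q + x * q')) - R\<^sup>2 * x * (q * (q + y * q'))) / ((q * (q + y * q')) * (q * (q + x * q')))"
      unfolding T_def using p q by (intro diff_frac_eq) auto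
    also have "R\<^sup>2 * y * (q * (q + x * q')) - R\<^sup>2 * x * (q * (q + y * q')) = q * q * (R\<^sup>2 * (y - x))" by (simp add: algebra_simps)
    also have "(q * (q + y * q')) * (q * (q + x * q')) = q * q * ((q + x * q') * (q + y * q'))" by simp
    finally show ?thesis using q by simp
  qed
  have mono: "x < y \<longleftrightarrow> T x < T y" if "0 \<le> x" "0 \<le> y" for x y
  proof -
    have p: "0 < (q + x * q') * (q + y * q')" using that q by (intro mult_pos_pos add_pos_nonneg) auto
    have "T x < T y \<longleftrightarrow> 0 < T y - T x" by simp
    also have "\<dots> \<longleftrightarrow> 0 < R\<^sup>2 * (y - x)" unfolding Tdiff[OF that] using p by (simp add: zero_less_divide_iff)
    finally show ?thesis using R2 by (simp add: zero_less_mult_iff)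
  qed
  have \<alpha>: "\<alpha> \<le> \<beta>" using \<alpha>\<beta> by simp
  show ?thesis
  proof (rule that[of "g \<alpha>" "g \<beta>"])
    show "0 < g \<alpha>" using g(2)[OF \<alpha>\<beta>(1) \<alpha>] .
    show "g \<beta> < 1" using g(3)[of \<beta>] \<alpha>\<beta> by simp
    have g0: "0 \<le> g \<alpha>" "0 \<le> g \<beta>" using g(2)[of \<alpha>] g(2)[of \<beta>] \<alpha>\<beta> by auto
    show lt: "g \<alpha> < g \<beta>" using mono[OF g0] g(4)[of \<alpha>] g(4)[of \<beta>] \<alpha>\<beta> by simp
    show "\<alpha> < R\<^sup>2 * t / (real (cden w) * (real (cden w) + t * real (cden' w)))
      \<and> R\<^sup>2 * t / (real (cden w) * (real (cden w) + t * real (cden' w))) < \<beta>" if t: "g \<alpha> < t" "t < g \<beta>" for t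
    proof -
      have t0: "0 \<le> t" using t g0 by simp
      have "T (g \<alpha>) < T t" "T t < T (g \<beta>)" using mono[OF g0(1) t0] mono[OF t0 g0(2)] t by auto
      then show ?thesis using g(4)[of \<alpha>] g(4)[of \<beta>] \<alpha>\<beta> by (simp add: T_def q_def q'_def)
    qed
    have "\<bar>cfe w (g \<beta>) - cfe w (g \<alpha>)\<bar> = (g \<beta> - g \<alpha>) / ((q + g \<alpha> * q') * (q + g \<beta> * q'))"
      unfolding q_def q'_def using g0 lt by (intro cfe_abs_diff w) auto
    also have "\<dots> = (T (g \<beta>) - T (g \<alpha>)) / R\<^sup>2" unfolding Tdiff[OF g0] using R by simp
    also have "\<dots> = (\<beta> - \<alpha>) / R\<^sup>2" using g(4)[of \<alpha>] g(4)[of \<beta>] \<alpha>\<beta> by simp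
    finally show "\<bar>cfe w (g \<beta>) - cfe w (g \<alpha>)\<bar> = (\<beta> - \<alpha>) / R\<^sup>2" .
  qed
qed

text \<open>The straddling index of the common value fixes the length, and its digits fix the
  entries.\<close>

lemma straddling_word_unique:
  assumes "pos_word w" "0 < x" "x < 1" "w \<noteq> []" "real (cden' w) < R" "R < real (cden w)"
    and "pos_word w'" "0 < x'" "x' < 1" "w' \<noteq> []" "real (cden' w') < R" "R < real (cden w')"
    and eq: "cfe w x = cfe w' x'"
  shows "w = w'"
proof (rule nth_equalityI)
  have "straddles R (cfe w x) (length w)" using straddles_cfe_iff[OF assms(1-6)] by blast
  then show len: "length w = length w'" using straddles_cfe_iff[OF assms(7-12)] unfolding eq by blast
  fix i assume i: "i < length w"
  show "w ! i = w' ! i"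
    using cf_digit_cfe[OF assms(1-3) i] cf_digit_cfe[OF assms(7-9), of i] i len unfolding eq by simp
qed

text \<open>With \<open>q0 = cden w\<close>, the denominators of \<open>w @ w1\<close> are
  \<open>q0\<close> times those of \<open>w1\<close>, up to a factor between 1 and
  \<open>1 + \<epsilon>\<close>, so \<open>w1\<close> is to be used at scale \<open>R / q0\<close>.
  The deviation goes one way: \<open>u\<close> and \<open>v\<close> can only grow and
  \<open>\<tau>\<close> can only shrink, the latter by the square of the factor. Hence only the
  upper ends for \<open>u\<close>, \<open>v\<close> and the lower end for \<open>\<tau>\<close> are
  tightened.\<close>

lemma state_interval_in_cylinder:
  fixes R \<epsilon> :: real
  assumes w: "pos_word w" and e: "0 < \<epsilon>" "real (cden' w) \<le> \<epsilon> * real (cden w)" "1 \<le> \<epsilon> * real (cden w)"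
    and R: "R > 0"
    and w1: "pos_word w1" "w1 \<noteq> []"
    and box: "cbox (u1, v1, \<alpha>1) (u2, v2, \<alpha>2) \<subseteq> domW"
    and \<alpha>: "(1 + \<epsilon>)\<^sup>2 * \<alpha>1 < \<alpha>2" "0 < \<alpha>1"
    and u: "u1 < real (cden' w1) / (R / real (cden w))" "real (cden' w1) / (R / real (cden w)) < u2 / (1 + \<epsilon>)"
    and v: "v1 < real (cden w1) / (R / real (cden w))" "real (cden w1) / (R / real (cden w)) < v2 / (1 + \<epsilon>)"
  shows "\<exists>J. J \<in> sets borel \<and> J \<subseteq> cyl_state w R (box (u1, v1, \<alpha>1) (u2, v2, \<alpha>2)) \<and> J \<subseteq> cfe (w @ w1) ` {0<..<1} \<and>
     gm w 0 1 / (1 + \<epsilon>)\<^sup>2 * ((\<alpha>2 - (1 + \<epsilon>)\<^sup>2 * \<alpha>1) / (R / real (cden w))\<^sup>2) \<le> measure gauss_measure J \<and>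
     real (cden' (w @ w1)) < R \<and> R < real (cden (w @ w1))"
proof -
  define q0 where "q0 = real (cden w)"
  define R' where "R' = R / q0"
  define q q' where "q = real (cden w1)" and "q' = real (cden' w1)"
  define Q Q' where "Q = real (cden (w @ w1))" and "Q' = real (cden' (w @ w1))"
  define E where "E = 1 + \<epsilon>"
  have E: "1 < E" "0 < E" using e by (auto simp: E_def)
  have q0: "0 < q0" using cden_pos[OF w] by (simp add: q0_def)
  have R': "0 < R'" using R q0 by (simp add: R'_def)
  have q: "0 < q" using cden_pos[OF w1(1)] by (simp add: q_def)
  have u': "u1 < q' / R'" "q' / R' < u2 / E" and v': "v1 < q / R'" "q / R' < v2 / E"
    using u v by (simp_all only: q_def q'_def R'_def q0_def E_def)
  have u2: "q' / R' * E < u2" and v2: "q / R' * E < v2" using u'(2) v'(2) E by (simp_all only: pos_less_divide_eq)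
  have qE: "q / R' \<le> q / R' * E" "q' / R' \<le> q' / R' * E"
    using mult_left_mono[of 1 E "q / R'"] mult_left_mono[of 1 E "q' / R'"] E R' q by (simp_all add: q'_def)
  have "0 < (E * E - 1) * \<alpha>1" using E \<alpha>(2) by (intro mult_pos_pos) (auto simp: less_1_mult)
  then have \<alpha>12: "\<alpha>1 < \<alpha>2" using \<alpha>(1) unfolding E_def[symmetric] power2_eq_square by (simp add: left_diff_distrib)
  have inW: "(a, b, c) \<in> domW" if "u1 \<le> a" "a \<le> u2" "v1 \<le> b" "b \<le> v2" "\<alpha>1 \<le> c" "c \<le> \<alpha>2" for a b c
  proof -
    have "(a, b, c) \<in> cbox (u1, v1, \<alpha>1) (u2, v2, \<alpha>2)" using that by (simp add: cbox_Pair_eq)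
    then show ?thesis using box by blast
  qed
  have st: "(q' / R', q / R', \<alpha>2) \<in> domW"
    using u' v' u2 v2 qE \<alpha>12 by (intro inW) linarith+
  have ne12: "u1 < u2" "v1 < v2" using u' u2 v' v2 qE by linarith+
  have "(u1, v1, \<alpha>2) \<in> domW" "(u2, v1, \<alpha>2) \<in> domW" using ne12 \<alpha>12 by (intro inW; simp)+
  then have dom: "0 < u1" "u2 < 1" "1 < v1" by (auto simp: domW_def)
  have q'R: "0 < q'" "q' < R'" "R' < q"
  proof -
    have "0 < q' / R'" "q' / R' < 1" "1 < q / R'" using st by (auto simp: domW_def)
    then show "0 < q'" "q' < R'" "R' < q" using R' by (auto simp: zero_less_divide_iff)
  qed
  obtain a b where ab: "0 < a" "a < b" "b < 1"
    "\<And>t. a < t \<Longrightarrow> t < b \<Longrightarrow> E\<^sup>2 * \<alpha>1 < R'\<^sup>2 * t / (q * (q + t * q')) \<and> R'\<^sup>2 * t / (q * (q + t * q')) < \<alpha>2"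
    "\<bar>cfe w1 b - cfe w1 a\<bar> = (\<alpha>2 - E\<^sup>2 * \<alpha>1) / R'\<^sup>2"
  proof (rule cfe_state_interval[OF w1 R', of "E\<^sup>2 * \<alpha>1" \<alpha>2])
    show "0 < cden' w1" using q'R by (simp add: q'_def)
    show "real (cden' w1) < R'" "R' < real (cden w1)" using q'R by (simp_all add: q_def q'_def)
    show "0 < E\<^sup>2 * \<alpha>1" using E \<alpha> by simp
    show "E\<^sup>2 * \<alpha>1 < \<alpha>2" using \<alpha> by (simp add: E_def)
    show "(real (cden' w1) / R', real (cden w1) / R', \<alpha>2) \<in> domW" using st by (simp add: q_def q'_def)
  qed (use that in \<open>simp add: q_def q'_def\<close>)
  define J where "J = cfe (w @ w1) ` {a<..<b}"
  have ww: "pos_word (w @ w1)" "w @ w1 \<noteq> []" using w w1 by auto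
  \<comment> \<open>The mixed terms of the matrix product are \<open>cden' w\<close> times a
    numerator of \<open>w1\<close>. Numerators of the nonempty word \<open>w1\<close> do not exceed
    the corresponding denominators, and \<open>cden' w\<close> is at most
    \<open>\<epsilon> * q0\<close>.\<close>
  have QQ: "q0 * q \<le> Q" "Q \<le> q0 * q * E" "q0 * q' \<le> Q'" "Q' \<le> q0 * q' * E"
  proof -
    have c: "real (cden' w) * real (cnum w1) \<le> (\<epsilon> * q0) * q" "real (cden' w) * real (cnum' w1) \<le> (\<epsilon> * q0) * q'"
      using e q0 cnum_le_cden[OF w1(1)] cnum'_le_cden'[OF w1] by (auto intro!: mult_mono simp: q0_def q_def q'_def)
    have Q: "Q = real (cden' w) * real (cnum w1) + q0 * q" "Q' = real (cden' w) * real (cnum' w1) + q0 * q'"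
      by (simp_all add: Q_def Q'_def cden_append cden'_append q0_def q_def q'_def)
    show "q0 * q \<le> Q" "q0 * q' \<le> Q'" using Q by simp_all
    show "Q \<le> q0 * q * E" "Q' \<le> q0 * q' * E" using c Q by (simp_all add: E_def algebra_simps)
  qed
  have qR: "q0 * q / R = q / R'" "q0 * q' / R = q' / R'" using q0 R by (simp_all add: R'_def)
  have Qu: "u1 < Q' / R" "Q' / R < u2" and Qv: "v1 < Q / R" "Q / R < v2"
  proof -
    have "q0 * q / R \<le> Q / R" "Q / R \<le> q0 * q * E / R" "q0 * q' / R \<le> Q' / R" "Q' / R \<le> q0 * q' * E / R"
      using QQ R by (auto intro!: divide_right_mono)
    moreover have "q0 * q * E / R = q / R' * E" "q0 * q' * E / R = q' / R' * E" using qR by (metis times_divide_eq_left)+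
    ultimately show "u1 < Q' / R" "Q' / R < u2" "v1 < Q / R" "Q / R < v2"
      using u'(1) v'(1) u2 v2 unfolding qR by linarith+
  qed
  have QR: "Q' < R" "R < Q"
  proof -
    have "Q' / R < 1" "1 < Q / R" using Qu Qv dom by linarith+
    then show "Q' < R" "R < Q" using R by simp_all
  qed
  have Q0: "0 < Q" "0 \<le> Q'" using QR R by (auto simp: Q'_def)
  have sub: "J \<subseteq> cyl_state w R (box (u1, v1, \<alpha>1) (u2, v2, \<alpha>2))"
  proof
    fix \<rho> assume "\<rho> \<in> J"
    then obtain t where t: "a < t" "t < b" "\<rho> = cfe (w @ w1) t" by (auto simp: J_def)
    have t01: "0 < t" "t < 1" using t ab by auto
    have "cfe w1 t \<in> {0<..<1}" using cfe_in_01[OF w1(1) t01] by auto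
    then have 1: "\<rho> \<in> cfe w ` {0<..<1}" unfolding t(3) cfe_append by blast
    define \<tau> where "\<tau> = R\<^sup>2 * t / (Q * (Q + t * Q'))"
    \<comment> \<open>The denominator of \<open>\<tau>\<close> if the denominators of
      \<open>w @ w1\<close> were exactly \<open>q0\<close> times those of \<open>w1\<close>; the
      true one lies between \<open>P\<close> and \<open>E\<^sup>2 * P\<close>.\<close>
    define P where "P = q0 * q * (q0 * q + t * (q0 * q'))"
    have P: "0 < P" unfolding P_def using q0 q q'R t01 by (intro mult_pos_pos add_pos_pos) auto
    have "R\<^sup>2 * t / P = R'\<^sup>2 * t / (q * (q + t * q'))"
    proof -
      have "P = (q0 * q0) * (q * (q + t * q'))" by (simp add: P_def algebra_simps)
      then show ?thesis using q0 by (simp add: R'_def power2_eq_square)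
    qed
    then have \<tau>0: "E\<^sup>2 * \<alpha>1 < R\<^sup>2 * t / P" "R\<^sup>2 * t / P < \<alpha>2" using ab(4)[OF t(1,2)] by auto
    have PQ: "P \<le> Q * (Q + t * Q')" unfolding P_def using QQ q0 q t01 q'R Q0
      by (intro mult_mono add_mono mult_left_mono) auto
    have QP: "Q * (Q + t * Q') \<le> E\<^sup>2 * P"
    proof -
      have "Q * (Q + t * Q') \<le> (q0 * q * E) * (q0 * q * E + t * (q0 * q' * E))"
        using QQ q0 q t01 q'R Q0 E by (intro mult_mono add_mono mult_left_mono) auto
      also have "\<dots> = E\<^sup>2 * P" by (simp add: P_def power2_eq_square algebra_simps)
      finally show ?thesis .
    qed
    have Rt: "0 \<le> R\<^sup>2 * t" using t01 by simp
    have PQ0: "0 < Q * (Q + t * Q')" using P PQ by linarith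
    have "\<tau> \<le> R\<^sup>2 * t / P" unfolding \<tau>_def by (rule divide_left_mono[OF PQ Rt mult_pos_pos[OF PQ0 P]])
    then have "\<tau> < \<alpha>2" using \<tau>0 by linarith
    moreover have "\<alpha>1 < \<tau>"
    proof -
      have E2: "0 < E\<^sup>2" using E by simp
      have "R\<^sup>2 * t / (E\<^sup>2 * P) \<le> \<tau>" unfolding \<tau>_def by (rule divide_left_mono[OF QP Rt mult_pos_pos[OF mult_pos_pos[OF E2 P] PQ0]])
      moreover have "\<alpha>1 < R\<^sup>2 * t / (E\<^sup>2 * P)"
      proof -
        have "E\<^sup>2 * \<alpha>1 * P < R\<^sup>2 * t" using \<tau>0(1) P by (simp add: pos_less_divide_eq)
        then show ?thesis using P E2 by (simp add: pos_less_divide_eq mult_ac)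
      qed
      ultimately show ?thesis by linarith
    qed
    ultimately have "(Q' / R, Q / R, \<tau>) \<in> box (u1, v1, \<alpha>1) (u2, v2, \<alpha>2)"
      using Qu Qv by (auto simp: mem_box Basis_prod_def)
    moreover have "cf_state R \<rho> (length (w @ w1)) = (Q' / R, Q / R, \<tau>)"
      unfolding t(3) cf_state_cfe[OF ww t01] \<tau>_def Q_def Q'_def ..
    ultimately have "\<rho> \<in> state_set R (box (u1, v1, \<alpha>1) (u2, v2, \<alpha>2))"
      unfolding state_set_def by (intro CollectI exI[of _ "length (w @ w1)"]) simp
    with 1 show "\<rho> \<in> cyl_state w R (box (u1, v1, \<alpha>1) (u2, v2, \<alpha>2))" by (simp add: cyl_state_def)
  qed
  have meas: "gm w 0 1 / E\<^sup>2 * ((\<alpha>2 - E\<^sup>2 * \<alpha>1) / R'\<^sup>2) \<le> measure gauss_measure J"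
  proof -
    have a0: "0 \<le> a" using ab by simp
    have I: "cfe w1 ` {a<..<b} = {min (cfe w1 a) (cfe w1 b)<..<max (cfe w1 a) (cfe w1 b)}" "0 \<le> cfe w1 a" "0 \<le> cfe w1 b" "cfe w1 a \<noteq> cfe w1 b"
      using cfe_image[OF w1(1) a0 ab(2)] by auto
    have le: "cfe w1 a \<le> 1" "cfe w1 b \<le> 1" using ab by (auto intro!: cfe_le_1 w1)
    have d: "max (cfe w1 a) (cfe w1 b) - min (cfe w1 a) (cfe w1 b) = (\<alpha>2 - E\<^sup>2 * \<alpha>1) / R'\<^sup>2"
      unfolding ab(5)[symmetric] by (auto simp: min_def max_def)
    have "cfe (w @ w1) = cfe w \<circ> cfe w1" by (rule ext) (simp add: cfe_append)
    then have "J = cfe w ` {min (cfe w1 a) (cfe w1 b)<..<max (cfe w1 a) (cfe w1 b)}"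
      unfolding J_def I(1)[symmetric] image_comp by simp
    then have "measure gauss_measure J = gm w (min (cfe w1 a) (cfe w1 b)) (max (cfe w1 a) (cfe w1 b))" by (simp add: gm_def)
    moreover have "gm w 0 1 / (1 + \<epsilon>)\<^sup>2 * (max (cfe w1 a) (cfe w1 b) - min (cfe w1 a) (cfe w1 b)) \<le> gm w (min (cfe w1 a) (cfe w1 b)) (max (cfe w1 a) (cfe w1 b))"
      using I le by (intro gm_lower[OF w e]) (auto simp: min_def max_def)
    ultimately show ?thesis unfolding d E_def by simp
  qed
  have "J \<in> sets borel" unfolding J_def using ab by (intro cfe_image_sets ww) auto
  moreover have "J \<subseteq> cfe (w @ w1) ` {0<..<1}" unfolding J_def using ab by (intro image_mono) auto
  ultimately show ?thesis using sub meas QR unfolding R'_def q0_def E_def Q_def Q'_def by blast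
qed

text \<open>Every coprime pair in the shrunken rectangle at scale \<open>R / q0\<close> yields two
  words \<open>w1\<close> and hence two disjoint sets of numbers in the cylinder. Their number grows
  like the square of this scale and cancels the inverse square in the mass of each set.\<close>

theorem cyl_state_lim_ge:
  assumes w: "pos_word w" and e: "0 < \<epsilon>" "real (cden' w) \<le> \<epsilon> * real (cden w)" "1 \<le> \<epsilon> * real (cden w)"
    and box: "cbox (u1, v1, \<alpha>1) (u2, v2, \<alpha>2) \<subseteq> domW" and pos: "0 \<le> u1" "0 \<le> v1" "0 < \<alpha>1"
    and lt: "u1 < u2 / (1 + \<epsilon>)" "v1 < v2 / (1 + \<epsilon>)" "(1 + \<epsilon>)\<^sup>2 * \<alpha>1 < \<alpha>2"
    and small: "u2 \<le> 1" "1 \<le> v1"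
  shows "lim_ge (\<lambda>R. measure gauss_measure (cyl_state w R (box (u1, v1, \<alpha>1) (u2, v2, \<alpha>2))))
    (gm w 0 1 * (12 / pi\<^sup>2 * ((u2 / (1 + \<epsilon>) - u1) * (v2 / (1 + \<epsilon>) - v1) * (\<alpha>2 - (1 + \<epsilon>)\<^sup>2 * \<alpha>1)) / (1 + \<epsilon>)\<^sup>2)) at_top"
proof -
  let ?B = "box (u1, v1, \<alpha>1) (u2, v2, \<alpha>2)"
  define q0 where "q0 = real (cden w)"
  have q0: "0 < q0" using cden_pos[OF w] by (simp add: q0_def)
  define Pr where "Pr R = prim_pairs (R / q0) u1 (u2 / (1 + \<epsilon>)) v1 (v2 / (1 + \<epsilon>))" for R
  define c where "c = gm w 0 1 / (1 + \<epsilon>)\<^sup>2"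
  define L where "L = \<alpha>2 - (1 + \<epsilon>)\<^sup>2 * \<alpha>1"
  have main: "real (card (Pr R)) * 2 * (c * (L / (R / q0)\<^sup>2)) \<le> measure gauss_measure (cyl_state w R ?B)" if R: "R > 0" for R
  proof -
    have R': "0 < R / q0" using R q0 by simp
    define good where "good w1 e p q \<longleftrightarrow> pos_word w1 \<and> w1 \<noteq> [] \<and> even (length w1) = e \<and> int (cden' w1) = p \<and> int (cden w1) = q" for w1 e p q
    have ex: "\<exists>w1. good w1 b p q" if "(p, q) \<in> Pr R" for p q b
    proof -
      have in_pr: "coprime p q" "R / q0 * u1 < real_of_int p" "real_of_int p < R / q0 * (u2 / (1 + \<epsilon>))" "R / q0 * v1 < real_of_int q"
        using that by (auto simp: Pr_def prim_pairs_def int_in_def)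
      have "0 \<le> R / q0 * u1" by (rule mult_nonneg_nonneg[OF less_imp_le[OF R'] pos(1)])
      then have p: "0 < p" using in_pr(2) by linarith
      have "u2 / (1 + \<epsilon>) \<le> 1" using small(1) e(1) by (simp add: divide_le_eq)
      then have "R / q0 * (u2 / (1 + \<epsilon>)) \<le> R / q0 * v1" using R' small(2) by (intro mult_left_mono) auto
      then have pq: "p < q" using in_pr by linarith
      have "coprime (nat p) (nat q)" using in_pr(1) p pq coprime_int_iff[of "nat p" "nat q"] by simp
      then obtain w1 where "pos_word w1" "w1 \<noteq> []" "even (length w1) = b" "cden' w1 = nat p" "cden w1 = nat q"
        using exists_word[of "nat p" "nat q" b] p pq by auto
      then show ?thesis using p pq unfolding good_def by (intro exI[of _ w1]) auto
    qed
    define W where "W = (\<lambda>((p, q), b). SOME w1. good w1 b p q)"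
    have W: "good (W ((p, q), b)) b p q" if "(p, q) \<in> Pr R" for p q b
      unfolding W_def prod.case by (rule someI_ex[OF ex[OF that]])
    \<comment> \<open>The boolean is the parity of the length; using each pair twice produces the 2
      in \<open>12 = 2 * 6\<close>.\<close>
    define K where "K = Pr R \<times> (UNIV :: bool set)"
    have finK: "finite K" by (simp add: K_def Pr_def)
    have "\<exists>J. J \<in> sets borel \<and> J \<subseteq> cyl_state w R ?B \<and> J \<subseteq> cfe (w @ W k) ` {0<..<1} \<and>
       c * (L / (R / q0)\<^sup>2) \<le> measure gauss_measure J \<and> real (cden' (w @ W k)) < R \<and> R < real (cden (w @ W k))"
      if k: "k \<in> K" for k
    proof -
      obtain p q b where kk: "k = ((p, q), b)" by (metis surj_pair)
      have pq: "(p, q) \<in> Pr R" using k by (simp add: K_def kk)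
      have g: "pos_word (W k)" "W k \<noteq> []" "real (cden' (W k)) = real_of_int p" "real (cden (W k)) = real_of_int q"
        using W[OF pq, of b] by (auto simp: good_def kk)
      have in_pr: "u1 < real_of_int p / (R / q0)" "real_of_int p / (R / q0) < u2 / (1 + \<epsilon>)" "v1 < real_of_int q / (R / q0)" "real_of_int q / (R / q0) < v2 / (1 + \<epsilon>)"
        using pq R' unfolding Pr_def prim_pairs_def int_in_def by (simp_all only: pos_less_divide_eq pos_divide_less_eq mem_Collect_eq prod.case mem_Times_iff fst_conv snd_conv mult.commute)
      show ?thesis unfolding c_def L_def q0_def
        by (rule state_interval_in_cylinder[OF w e R g(1,2) box lt(3) pos(3)])
           (use in_pr in \<open>simp_all only: g q0_def\<close>)
    qed
    then obtain J where J: "\<And>k. k \<in> K \<Longrightarrow> J k \<in> sets borel \<and> J k \<subseteq> cyl_state w R ?B \<and> J k \<subseteq> cfe (w @ W k) ` {0<..<1} \<and>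
       c * (L / (R / q0)\<^sup>2) \<le> measure gauss_measure (J k) \<and> real (cden' (w @ W k)) < R \<and> R < real (cden (w @ W k))"
      by metis
    have disj: "disjoint_family_on J K"
      unfolding disjoint_family_on_def
    proof (intro ballI impI)
      fix k k' assume k: "k \<in> K" "k' \<in> K" "k \<noteq> k'"
      obtain p q b where kk: "k = ((p, q), b)" by (metis surj_pair)
      obtain p' q' b' where kk': "k' = ((p', q'), b')" by (metis surj_pair)
      have g: "good (W k) b p q" "good (W k') b' p' q'" using W[of p q b] W[of p' q' b'] k by (auto simp: K_def kk kk')
      show "J k \<inter> J k' = {}"
      proof (rule equals0I)
        fix \<rho> assume "\<rho> \<in> J k \<inter> J k'"
        then have \<rho>: "\<rho> \<in> cfe (w @ W k) ` {0<..<1}" "\<rho> \<in> cfe (w @ W k') ` {0<..<1}"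
          using J[OF k(1)] J[OF k(2)] by blast+
        from \<rho>(1) obtain x where x1: "\<rho> = cfe (w @ W k) x" "x \<in> {0<..<1}" by (rule imageE)
        from \<rho>(2) obtain x' where x2: "\<rho> = cfe (w @ W k') x'" "x' \<in> {0<..<1}" by (rule imageE)
        have x: "0 < x" "x < 1" "\<rho> = cfe (w @ W k) x" "0 < x'" "x' < 1" "\<rho> = cfe (w @ W k') x'" using x1 x2 by simp_all
        have "w @ W k = w @ W k'"
          by (rule straddling_word_unique[of _ x R _ x']) (use x g w J[OF k(1)] J[OF k(2)] in \<open>auto simp: good_def\<close>)
        then have "W k = W k'" by simp
        then have "k = k'" using g by (simp add: good_def kk kk')
        then show False using k(3) by simp
      qed
    qed
    have "real (card (Pr R)) * 2 * (c * (L / (R / q0)\<^sup>2)) = (\<Sum>k\<in>K. c * (L / (R / q0)\<^sup>2))"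
      by (simp add: K_def card_cartesian_product)
    also have "\<dots> \<le> (\<Sum>k\<in>K. measure gauss_measure (J k))" using J by (intro sum_mono) auto
    also have "\<dots> = measure gauss_measure (\<Union>k\<in>K. J k)"
      using J disj finK by (intro gauss.finite_measure_finite_Union[symmetric]) auto
    also have "\<dots> \<le> measure gauss_measure (cyl_state w R ?B)"
    proof (rule gauss.finite_measure_mono)
      show "(\<Union>k\<in>K. J k) \<subseteq> cyl_state w R ?B" using J by blast
    qed (use cyl_state_sets[OF open_box w] in simp)
    finally show ?thesis .
  qed
  have f: "filterlim (\<lambda>R. R / q0) at_top at_top"
    using q0 filterlim_tendsto_pos_mult_at_top[OF tendsto_const[of "1 / q0"] _ filterlim_ident] by simp
  have "((\<lambda>R. real (card (Pr R)) / (R / q0)\<^sup>2) \<longlongrightarrow> (u2 / (1 + \<epsilon>) - u1) * (v2 / (1 + \<epsilon>) - v1) * (6 / pi\<^sup>2)) at_top"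
    unfolding Pr_def by (rule filterlim_compose[OF card_prim_pairs_tendsto[OF pos(1) lt(1) pos(2) lt(2)] f])
  then have "((\<lambda>R. real (card (Pr R)) / (R / q0)\<^sup>2 * (2 * c * L)) \<longlongrightarrow> (u2 / (1 + \<epsilon>) - u1) * (v2 / (1 + \<epsilon>) - v1) * (6 / pi\<^sup>2) * (2 * c * L)) at_top"
    by (rule tendsto_mult_right)
  then have lim: "lim_ge (\<lambda>R. real (card (Pr R)) / (R / q0)\<^sup>2 * (2 * c * L)) ((u2 / (1 + \<epsilon>) - u1) * (v2 / (1 + \<epsilon>) - v1) * (6 / pi\<^sup>2) * (2 * c * L)) at_top"
    by (rule tendsto_imp_lim_ge)
  show ?thesis
  proof (rule lim_ge_mono[OF lim])
    show "eventually (\<lambda>R. real (card (Pr R)) / (R / q0)\<^sup>2 * (2 * c * L) \<le> measure gauss_measure (cyl_state w R ?B)) at_top"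
      using eventually_gt_at_top[of 0]
    proof eventually_elim
      case (elim R)
      have "real (card (Pr R)) / (R / q0)\<^sup>2 * (2 * c * L) = real (card (Pr R)) * 2 * (c * (L / (R / q0)\<^sup>2))" by simp
      then show ?case using main[OF elim] by simp
    qed
    show "gm w 0 1 * (12 / pi\<^sup>2 * ((u2 / (1 + \<epsilon>) - u1) * (v2 / (1 + \<epsilon>) - v1) * (\<alpha>2 - (1 + \<epsilon>)\<^sup>2 * \<alpha>1)) / (1 + \<epsilon>)\<^sup>2)
      \<le> (u2 / (1 + \<epsilon>) - u1) * (v2 / (1 + \<epsilon>) - v1) * (6 / pi\<^sup>2) * (2 * c * L)"
    proof -
      have "g * (12 / p * (X * Y * Z) / E) = X * Y * (6 / p) * (2 * (g / E) * Z)" for g p X Y Z E :: real by simp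
      then show ?thesis unfolding c_def L_def by (rule eq_refl)
    qed
  qed
qed

text \<open>A tail below \<open>1 / H\<close> means that the next digit is at least
  \<open>H\<close>. The factor 2 absorbs the variation of the Gauss density over the unit
  interval.\<close>

lemma gm_first_digit_large:
  assumes w: "pos_word w" and H: "H \<ge> (2::nat)"
  shows "gm w 0 1 / (2 * real H) \<le> gm w 0 (1 / real H)"
proof -
  define q q' where "q = real (cden w)" and "q' = real (cden' w)"
  have q: "0 < q" "0 \<le> q'" using cden_pos[OF w] by (auto simp: q_def q'_def)
  have H0: "0 < 1 / real H" "1 / real H \<le> 1" "1 / real H < 1" using H by auto
  have le: "cfe w 0 \<le> 1" "cfe w (1 / real H) \<le> 1" using H0 by (auto intro!: cfe_le_1 w)
  have ge: "0 \<le> cfe w 0" "0 \<le> cfe w 1" using cfe_image[OF w, of 0 1] by auto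
  have "gm w 0 1 \<le> \<bar>cfe w 1 - cfe w 0\<bar> / (ln 2 * (1 + min (cfe w 0) (cfe w 1)))"
    by (rule gm_bounds(2)[OF w]) auto
  also have "\<dots> \<le> \<bar>cfe w 1 - cfe w 0\<bar> / (ln 2 * 1)"
    using ge by (intro divide_left_mono mult_left_mono mult_pos_pos) (auto simp: min_def)
  also have "\<bar>cfe w 1 - cfe w 0\<bar> = 1 / (q * (q + q'))" using cfe_abs_diff[OF w, of 0 1] by (simp add: q_def q'_def)
  finally have 1: "gm w 0 1 \<le> 1 / (q * (q + q')) / (ln 2 * 1)" .
  have "gm w 0 1 / (2 * real H) \<le> 1 / (q * (q + q')) / (ln 2 * 1) / (2 * real H)"
    using 1 H by (intro divide_right_mono) auto
  also have "\<dots> = (1 / real H) / (q * (q + q')) / (ln 2 * 2)" by simp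
  also have "\<dots> \<le> (1 / real H) / (q * (q + 1 / real H * q')) / (ln 2 * 2)"
  proof (intro divide_right_mono divide_left_mono)
    have "1 / real H * q' \<le> 1 * q'" using H0(2) q(2) by (rule mult_right_mono)
    then show "q * (q + 1 / real H * q') \<le> q * (q + q')" using q by (intro mult_left_mono) auto
    have "0 \<le> 1 / real H * q'" using q H0 by simp
    then show "0 < q * (q + q') * (q * (q + 1 / real H * q'))" using q by (intro mult_pos_pos add_pos_nonneg) auto
  qed (use H in auto)
  also have "(1 / real H) / (q * (q + 1 / real H * q')) = \<bar>cfe w (1 / real H) - cfe w 0\<bar>"
    using cfe_abs_diff[OF w, of 0 "1 / real H"] H0 by (simp add: q_def q'_def)
  also have "\<bar>cfe w (1 / real H) - cfe w 0\<bar> / (ln 2 * 2) \<le> \<bar>cfe w (1 / real H) - cfe w 0\<bar> / (ln 2 * (1 + max (cfe w 0) (cfe w (1 / real H))))"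
    using le ge by (intro divide_left_mono mult_left_mono mult_pos_pos) (auto simp: max_def)
  also have "\<dots> \<le> gm w 0 (1 / real H)" by (rule gm_bounds(1)[OF w]) (use H0 in auto)
  finally show ?thesis .
qed

lemma gm_first_digit_tail:
  assumes w: "pos_word w"
  shows "(\<lambda>L. gm w (1 / real (Suc (Suc L))) 1) \<longlonglongrightarrow> gm w 0 1"
proof -
  define x where "x L = 1 / real (Suc (Suc L))" for L
  have x: "0 < x L" "x L < 1" for L by (auto simp: x_def)
  have "(\<lambda>L. gm w 0 1 - gm w 0 (x L)) \<longlonglongrightarrow> gm w 0 1 - 0"
  proof (intro tendsto_diff tendsto_const)
    have bd: "norm (gm w 0 (x L)) \<le> x L / ln 2" for L
    proof -
      have ge: "0 \<le> cfe w 0" "0 \<le> cfe w (x L)" using cfe_image[OF w, of 0 "x L"] x by auto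
      have q: "1 \<le> real (cden w)" using cden_pos[OF w] by simp
      have "gm w 0 (x L) \<le> \<bar>cfe w (x L) - cfe w 0\<bar> / (ln 2 * (1 + min (cfe w 0) (cfe w (x L))))"
        by (rule gm_bounds(2)[OF w]) (use x[of L] in auto)
      also have "\<dots> \<le> \<bar>cfe w (x L) - cfe w 0\<bar> / (ln 2 * 1)"
        using ge by (intro divide_left_mono mult_left_mono mult_pos_pos) (auto simp: min_def)
      also have "\<bar>cfe w (x L) - cfe w 0\<bar> = x L / (real (cden w) * (real (cden w) + x L * real (cden' w)))"
        using cfe_abs_diff[OF w, of 0 "x L"] x[of L] by simp
      also have "\<dots> \<le> x L / (1 * (1 + 0))"
        using q x[of L] by (intro divide_left_mono mult_mono add_mono mult_pos_pos add_pos_nonneg) auto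
      finally show ?thesis using gm_nonneg[of w 0 "x L"] by (simp add: divide_right_mono)
    qed
    have "(\<lambda>L. x L / ln 2) \<longlonglongrightarrow> 0 / ln 2"
      unfolding x_def by (intro tendsto_divide tendsto_const LIMSEQ_Suc[OF lim_1_over_n, THEN LIMSEQ_Suc]) simp
    then show "(\<lambda>L. gm w 0 (x L)) \<longlonglongrightarrow> 0"
      using bd by (intro Lim_null_comparison[of "\<lambda>L. gm w 0 (x L)" "\<lambda>L. x L / ln 2"]) auto
  qed
  moreover have "gm w 0 1 - gm w 0 (x L) = gm w (x L) 1" for L
    using gm_add[OF w, of 0 "x L" 1] x[of L] by simp
  ultimately show ?thesis by (simp add: x_def)
qed

text \<open>Almost every number has a digit at least \<open>H\<close>; in the cylinder of such a digit the tail is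
  nearly Lebesgue distributed, and the denominators are nearly proportional to those of the tail.
  Each step of the induction exhausts a fixed proportion of what remains.\<close>
lemma cyl_state_lim_ge_induct:
  assumes S: "open S" and H: "H \<ge> (2::nat)" and \<kappa>: "0 \<le> \<kappa>"
    and base: "\<And>w h. pos_word w \<Longrightarrow> H \<le> h \<Longrightarrow> lim_ge (\<lambda>R. measure gauss_measure (cyl_state (w @ [h]) R S)) (gm (w @ [h]) 0 1 * \<kappa>) at_top"
    and w: "pos_word w"
  shows "lim_ge (\<lambda>R. measure gauss_measure (cyl_state w R S)) (gm w 0 1 * \<kappa> * (1 - (1 - 1 / (2 * real H)) ^ n)) at_top"
  using w
proof (induction n arbitrary: w)
  case 0
  show ?case by (rule lim_ge_mono[OF tendsto_imp_lim_ge[OF tendsto_const[of 0]]]) auto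
next
  case (Suc n)
  define \<delta> where "\<delta> = 1 / (2 * real H)"
  have \<delta>: "0 \<le> 1 - \<delta>" using H by (simp add: \<delta>_def)
  define r where "r = (1 - \<delta>) ^ n"
  have r: "0 \<le> r" using \<delta> by (simp add: r_def)
  have ww: "pos_word (w @ [h])" if "0 < h" for h using Suc.prems that by auto
  have step: "lim_ge (\<lambda>R. measure gauss_measure (cyl_state w R S)) (\<kappa> * (gm w (1 / real (Suc (H + L))) 1 - r * ((1 - \<delta>) * gm w 0 1))) at_top" for L
  proof -
    let ?K = "{1..<1 + (H + L)}"
    \<comment> \<open>Digits from \<open>H\<close> on are fully covered by \<open>base\<close>; for
      smaller ones the induction hypothesis leaves the share \<open>r\<close> uncovered. Only the
      digits up to \<open>H + L\<close> are summed at this point, and \<open>L\<close> tends to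
      infinity afterwards.\<close>
    define val where "val h = (if h < H then gm (w @ [h]) 0 1 * \<kappa> * (1 - r) else gm (w @ [h]) 0 1 * \<kappa>)" for h
    have "lim_ge (\<lambda>R. \<Sum>h\<in>?K. measure gauss_measure (cyl_state (w @ [h]) R S)) (\<Sum>h\<in>?K. val h) at_top"
    proof (rule lim_ge_sum)
      fix h assume h: "h \<in> ?K"
      show "lim_ge (\<lambda>R. measure gauss_measure (cyl_state (w @ [h]) R S)) (val h) at_top"
        using Suc.IH[of "w @ [h]"] ww[of h] base[OF Suc.prems, of h] h by (simp add: val_def r_def \<delta>_def)
    qed
    then show ?thesis
    proof (rule lim_ge_mono)
      show "eventually (\<lambda>R. (\<Sum>h\<in>?K. measure gauss_measure (cyl_state (w @ [h]) R S)) \<le> measure gauss_measure (cyl_state w R S)) at_top"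
      proof (rule always_eventually, rule allI)
        fix R
        have disj: "disjoint_family_on (\<lambda>h. cyl_state (w @ [h]) R S) ?K"
          unfolding disjoint_family_on_def
        proof (intro ballI impI)
          fix h h' :: nat assume h: "h \<in> ?K" "h' \<in> ?K" "h \<noteq> h'"
          show "cyl_state (w @ [h]) R S \<inter> cyl_state (w @ [h']) R S = {}"
          proof (rule equals0I)
            fix \<rho> assume "\<rho> \<in> cyl_state (w @ [h]) R S \<inter> cyl_state (w @ [h']) R S"
            then obtain x y where x: "0 < x" "x < 1" "\<rho> = cfe (w @ [h]) x" and y: "0 < y" "y < 1" "\<rho> = cfe (w @ [h']) y"
              by (auto simp: cyl_state_def)
            have "cf_digit \<rho> (int (Suc (length w))) = h" "cf_digit \<rho> (int (Suc (length w))) = h'"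
              using cf_digit_cfe[OF ww x(1,2), of h "length w"] cf_digit_cfe[OF ww y(1,2), of h' "length w"] h x(3) y(3) by auto
            then show False using h(3) by simp
          qed
        qed
        have "(\<Sum>h\<in>?K. measure gauss_measure (cyl_state (w @ [h]) R S)) = measure gauss_measure (\<Union>h\<in>?K. cyl_state (w @ [h]) R S)"
          using disj cyl_state_sets[OF S ww] by (intro gauss.finite_measure_finite_Union[symmetric]) auto
        also have "\<dots> \<le> measure gauss_measure (cyl_state w R S)"
        proof (rule gauss.finite_measure_mono)
          show "(\<Union>h\<in>?K. cyl_state (w @ [h]) R S) \<subseteq> cyl_state w R S"
          proof (intro UN_least subsetI)
            fix h \<rho> assume h: "h \<in> ?K" and "\<rho> \<in> cyl_state (w @ [h]) R S"
            then obtain x where x: "0 < x" "x < 1" "\<rho> = cfe (w @ [h]) x" "\<rho> \<in> state_set R S" by (auto simp: cyl_state_def)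
            have "cfe [h] x \<in> {0<..<1}" using cfe_in_01[of "[h]" x] x h by auto
            then show "\<rho> \<in> cyl_state w R S" using x unfolding cyl_state_def cfe_append by blast
          qed
        qed (use cyl_state_sets[OF S Suc.prems] in simp)
        finally show "(\<Sum>h\<in>?K. measure gauss_measure (cyl_state (w @ [h]) R S)) \<le> measure gauss_measure (cyl_state w R S)" .
      qed
      have "(\<Sum>h\<in>?K. val h) = (\<Sum>h\<in>?K. gm (w @ [h]) 0 1 * \<kappa>) - (\<Sum>h\<in>?K. if h < H then gm (w @ [h]) 0 1 * \<kappa> * r else 0)"
        unfolding sum_subtractf[symmetric] by (intro sum.cong) (auto simp: val_def algebra_simps)
      also have "(\<Sum>h\<in>?K. gm (w @ [h]) 0 1 * \<kappa>) = \<kappa> * gm w (1 / real (Suc (H + L))) 1"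
        using sum_gm_snoc[OF Suc.prems, of 1 "H + L"] H by (simp add: sum_distrib_right[symmetric])
      also have "(\<Sum>h\<in>?K. if h < H then gm (w @ [h]) 0 1 * \<kappa> * r else 0) = (\<Sum>h\<in>{1..<1 + (H - 1)}. gm (w @ [h]) 0 1 * \<kappa> * r)"
        using H by (intro sum.mono_neutral_cong_right) auto
      also have "\<dots> = \<kappa> * r * (\<Sum>h\<in>{1..<1 + (H - 1)}. gm (w @ [h]) 0 1)"
        unfolding sum_distrib_left by (intro sum.cong) (simp_all only: mult_ac)
      also have "(\<Sum>h\<in>{1..<1 + (H - 1)}. gm (w @ [h]) 0 1) = gm w (1 / real H) 1"
        using sum_gm_snoc[OF Suc.prems, of 1 "H - 1"] H by (simp add: of_nat_diff)
      finally have val: "(\<Sum>h\<in>?K. val h) = \<kappa> * gm w (1 / real (Suc (H + L))) 1 - \<kappa> * r * gm w (1 / real H) 1" .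
      \<comment> \<open>The digits below \<open>H\<close> carry at most the share
        \<open>1 - \<delta>\<close> of the cylinder, which reduces the uncovered share from
        \<open>r\<close> to \<open>r * (1 - \<delta>)\<close>.\<close>
      have "gm w 0 1 = gm w 0 (1 / real H) + gm w (1 / real H) 1" using H by (intro gm_add Suc.prems) auto
      then have "gm w (1 / real H) 1 \<le> (1 - \<delta>) * gm w 0 1"
        using gm_first_digit_large[OF Suc.prems H] unfolding \<delta>_def left_diff_distrib by simp
      then have "\<kappa> * r * gm w (1 / real H) 1 \<le> \<kappa> * r * ((1 - \<delta>) * gm w 0 1)" using \<kappa> r by (intro mult_left_mono) auto
      then show "\<kappa> * (gm w (1 / real (Suc (H + L))) 1 - r * ((1 - \<delta>) * gm w 0 1)) \<le> (\<Sum>h\<in>?K. val h)"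
        unfolding val by (simp add: right_diff_distrib mult_ac)
    qed
  qed
  have "(\<lambda>L. gm w (1 / real (Suc (H + L))) 1) \<longlonglongrightarrow> gm w 0 1"
  proof -
    have "(\<lambda>L. gm w (1 / real (Suc (Suc (L + (H - 1))))) 1) \<longlonglongrightarrow> gm w 0 1"
      by (rule LIMSEQ_ignore_initial_segment[OF gm_first_digit_tail[OF Suc.prems]])
    moreover have "Suc (Suc (L + (H - 1))) = Suc (H + L)" for L using H by simp
    ultimately show ?thesis by (simp only:)
  qed
  then have "(\<lambda>L. \<kappa> * (gm w (1 / real (Suc (H + L))) 1 - r * ((1 - \<delta>) * gm w 0 1))) \<longlonglongrightarrow> \<kappa> * (gm w 0 1 - r * ((1 - \<delta>) * gm w 0 1))"
    by (intro tendsto_intros)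
  from lim_ge_LIMSEQ[OF step this]
  have "lim_ge (\<lambda>R. measure gauss_measure (cyl_state w R S)) (\<kappa> * (gm w 0 1 - r * ((1 - \<delta>) * gm w 0 1))) at_top" .
  moreover have "\<kappa> * (gm w 0 1 - r * ((1 - \<delta>) * gm w 0 1)) = gm w 0 1 * \<kappa> * (1 - (1 - \<delta>) ^ Suc n)"
    by (simp add: r_def algebra_simps)
  ultimately show ?case by (simp only: \<delta>_def)
qed

text \<open>Three limits are taken in this order: \<open>R\<close> to infinity, the depth
  \<open>j\<close> of the exhaustion to infinity, and \<open>eps\<close> to 0. The threshold
  \<open>H = 1 / eps N\<close> ensures that a word ending in a digit at least \<open>H\<close>
  satisfies \<open>cden' \<le> eps N * cden\<close>.\<close>

lemma box_lim_ge:
  assumes ne: "box (u1, v1, \<alpha>1) (u2, v2, \<alpha>2) \<noteq> {}" and box: "cbox (u1, v1, \<alpha>1) (u2, v2, \<alpha>2) \<subseteq> domW"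
  shows "lim_ge (\<lambda>R. measure gauss_measure (cyl_state [] R (box (u1, v1, \<alpha>1) (u2, v2, \<alpha>2))))
    (12 / pi\<^sup>2 * ((u2 - u1) * (v2 - v1) * (\<alpha>2 - \<alpha>1))) at_top"
proof -
  let ?B = "box (u1, v1, \<alpha>1) (u2, v2, \<alpha>2)"
  have lt: "u1 < u2" "v1 < v2" "\<alpha>1 < \<alpha>2" using ne by (auto simp: box_ne_empty Basis_prod_def)
  have "(u1, v1, \<alpha>1) \<in> domW" "(u2, v1, \<alpha>1) \<in> domW" using box lt by (auto simp: cbox_Pair_eq)
  then have dom: "0 < u1" "u2 < 1" "1 < v1" "0 < \<alpha>1" by (auto simp: domW_def)
  define eps where "eps n = 1 / real (Suc (Suc n))" for n
  define \<kappa> where "\<kappa> n = 12 / pi\<^sup>2 * ((u2 / (1 + eps n) - u1) * (v2 / (1 + eps n) - v1) * (\<alpha>2 - (1 + eps n)\<^sup>2 * \<alpha>1)) / (1 + eps n)\<^sup>2" for n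
  have eps0: "eps \<longlonglongrightarrow> 0"
    unfolding eps_def by (intro LIMSEQ_Suc[OF lim_1_over_n, THEN LIMSEQ_Suc])
  have epos: "0 < eps n" for n by (simp add: eps_def)
  have l1: "(\<lambda>n. u2 / (1 + eps n)) \<longlonglongrightarrow> u2 / (1 + 0)" "(\<lambda>n. v2 / (1 + eps n)) \<longlonglongrightarrow> v2 / (1 + 0)"
    "(\<lambda>n. (1 + eps n)\<^sup>2 * \<alpha>1) \<longlonglongrightarrow> (1 + 0)\<^sup>2 * \<alpha>1"
    by (intro tendsto_intros eps0; simp)+
  have \<kappa>lim: "\<kappa> \<longlonglongrightarrow> 12 / pi\<^sup>2 * ((u2 / (1 + 0) - u1) * (v2 / (1 + 0) - v1) * (\<alpha>2 - (1 + 0)\<^sup>2 * \<alpha>1)) / (1 + 0)\<^sup>2"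
    unfolding \<kappa>_def by (intro tendsto_intros l1 eps0) simp
  have "eventually (\<lambda>n. u1 < u2 / (1 + eps n) \<and> v1 < v2 / (1 + eps n) \<and> (1 + eps n)\<^sup>2 * \<alpha>1 < \<alpha>2) sequentially"
    using order_tendstoD(1)[OF l1(1), of u1] order_tendstoD(1)[OF l1(2), of v1] order_tendstoD(2)[OF l1(3), of \<alpha>2] lt
    by (auto simp: eventually_conj_iff)
  \<comment> \<open>From \<open>n0\<close> on, the shrunken rectangle and the shortened range of
    \<open>\<tau>\<close> are nonempty.\<close>
  then obtain n0 where n0: "\<And>n. n0 \<le> n \<Longrightarrow> u1 < u2 / (1 + eps n) \<and> v1 < v2 / (1 + eps n) \<and> (1 + eps n)\<^sup>2 * \<alpha>1 < \<alpha>2"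
    by (auto simp: eventually_sequentially)
  have step: "lim_ge (\<lambda>R. measure gauss_measure (cyl_state [] R ?B)) (\<kappa> (n + n0)) at_top" for n
  proof -
    define N where "N = n + n0"
    define H where "H = Suc (Suc N)"
    have ln: "u1 < u2 / (1 + eps N)" "v1 < v2 / (1 + eps N)" "(1 + eps N)\<^sup>2 * \<alpha>1 < \<alpha>2" using n0[of N] by (auto simp: N_def)
    have \<kappa>0: "0 \<le> \<kappa> N" unfolding \<kappa>_def using ln epos[of N] by (intro divide_nonneg_nonneg mult_nonneg_nonneg) auto
    have base: "lim_ge (\<lambda>R. measure gauss_measure (cyl_state (w @ [h]) R ?B)) (gm (w @ [h]) 0 1 * \<kappa> N) at_top"
      if w: "pos_word w" and h: "H \<le> h" for w h
    proof -
      have eh: "eps N * real h \<ge> 1" using h by (simp add: eps_def H_def)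
      have q: "1 \<le> real (cden w)" using cden_pos[OF w] by simp
      have h0: "0 < h" using h by (simp add: H_def)
      have c1: "real (cden' (w @ [h])) = real (cden w)" "real h * real (cden w) \<le> real (cden (w @ [h]))"
        by (simp_all add: cden_snoc)
      have m: "eps N * (real h * real (cden w)) \<le> eps N * real (cden (w @ [h]))" using c1(2) epos[of N] by (intro mult_left_mono) auto
      have "1 * real (cden w) \<le> (eps N * real h) * real (cden w)" using eh by (rule mult_right_mono) simp
      then have e2: "real (cden' (w @ [h])) \<le> eps N * real (cden (w @ [h]))" using m c1(1) by (simp add: mult.assoc)
      then have e3: "1 \<le> eps N * real (cden (w @ [h]))" using q c1(1) by linarith
      have "pos_word (w @ [h])" using w h0 by auto
      from cyl_state_lim_ge[OF this epos e2 e3 box _ _ dom(4) ln] dom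
      show ?thesis by (simp add: \<kappa>_def)
    qed
    have ind: "lim_ge (\<lambda>R. measure gauss_measure (cyl_state [] R ?B)) (gm [] 0 1 * \<kappa> N * (1 - (1 - 1 / (2 * real H)) ^ j)) at_top" for j
      by (rule cyl_state_lim_ge_induct[OF open_box _ \<kappa>0 base]) (auto simp: H_def)
    have p0: "(\<lambda>j. (1 - 1 / (2 * real H)) ^ j) \<longlonglongrightarrow> 0"
    proof (rule LIMSEQ_power_zero)
      have "0 < 1 / (2 * real H)" "1 / (2 * real H) < 1" by (simp_all add: H_def)
      then show "norm (1 - 1 / (2 * real H)) < 1" by (simp only: real_norm_def abs_less_iff) linarith
    qed
    have "(\<lambda>j. gm [] 0 1 * \<kappa> N * (1 - (1 - 1 / (2 * real H)) ^ j)) \<longlonglongrightarrow> gm [] 0 1 * \<kappa> N * (1 - 0)"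
      by (intro tendsto_mult tendsto_diff tendsto_const p0)
    from lim_ge_LIMSEQ[OF ind this] show ?thesis by (simp add: gm_Nil N_def)
  qed
  have "(\<lambda>n. \<kappa> (n + n0)) \<longlonglongrightarrow> 12 / pi\<^sup>2 * ((u2 / (1 + 0) - u1) * (v2 / (1 + 0) - v1) * (\<alpha>2 - (1 + 0)\<^sup>2 * \<alpha>1)) / (1 + 0)\<^sup>2"
    by (rule LIMSEQ_ignore_initial_segment[OF \<kappa>lim])
  from lim_ge_LIMSEQ[OF step this] show ?thesis by simp
qed

theorem gauss_lim_ge:
  assumes S: "open S" "S \<subseteq> domW"
  shows "lim_ge (\<lambda>R. measure gauss_measure (cyl_state [] R S)) (12 / pi\<^sup>2 * measure lborel S) at_top"
proof -
  \<comment> \<open>Intersecting with \<open>S\<close> keeps the states in \<open>domW\<close>,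
    where the straddling index is unique; disjoint sets of states then give disjoint events, hence
    superadditivity. The value 0 for \<open>R \<le> 0\<close> makes the conditions hold at every
    index.\<close>
  define P where "P R A = (if R > 0 then measure gauss_measure (cyl_state [] R (A \<inter> S)) else 0)" for R A
  have sets: "cyl_state [] R A \<in> sets gauss_measure" if "open A" for R A
    using cyl_state_sets[OF that, of "[]" R] by simp
  have "lim_ge (\<lambda>R. P R S) (12 / pi\<^sup>2 * measure lborel S) at_top"
  proof (rule lim_ge_open_of_boxes[where P = P])
    show "0 \<le> P R A" for R A by (simp add: P_def)
    show "P R A + P R B \<le> P R (A \<union> B)" if AB: "open A" "open B" "A \<inter> B = {}" for R A B
    proof (cases "R > 0")
      case R: True
      have "cyl_state [] R (A \<inter> S) \<inter> cyl_state [] R (B \<inter> S) = {}"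
      proof (rule equals0I)
        fix \<rho> assume r: "\<rho> \<in> cyl_state [] R (A \<inter> S) \<inter> cyl_state [] R (B \<inter> S)"
        have \<rho>: "0 \<le> \<rho>" "\<rho> < 1" using r by (auto simp: cyl_state_def)
        obtain s s' where s: "cf_state R \<rho> s \<in> A \<inter> S" "cf_state R \<rho> s' \<in> B \<inter> S" using r by (auto simp: cyl_state_def state_set_def)
        have "cf_state R \<rho> s \<in> domW" "cf_state R \<rho> s' \<in> domW" using s S(2) by blast+
        obtain w x where w: "pos_word w" "w \<noteq> []" "length w = s" "0 < x" "x < 1" "\<rho> = cfe w x"
          "0 < cden' w" "real (cden' w) < R" "R < real (cden w)" by (rule cf_state_domW[OF R \<rho> \<open>cf_state R \<rho> s \<in> domW\<close>])
        obtain w' x' where w': "pos_word w'" "w' \<noteq> []" "length w' = s'" "0 < x'" "x' < 1" "\<rho> = cfe w' x'"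
          "0 < cden' w'" "real (cden' w') < R" "R < real (cden w')" by (rule cf_state_domW[OF R \<rho> \<open>cf_state R \<rho> s' \<in> domW\<close>])
        have "w = w'"
          by (rule straddling_word_unique[OF w(1,4,5,2,8,9) w'(1,4,5,2,8,9)]) (rule trans[OF sym[OF w(6)] w'(6)])
        then have "s = s'" using w(3) w'(3) by simp
        then show False using s AB(3) by blast
      qed
      then have "measure gauss_measure (cyl_state [] R (A \<inter> S)) + measure gauss_measure (cyl_state [] R (B \<inter> S))
          = measure gauss_measure (cyl_state [] R (A \<inter> S) \<union> cyl_state [] R (B \<inter> S))"
        by (intro gauss.finite_measure_Union[symmetric] sets open_Int AB S)
      also have "cyl_state [] R (A \<inter> S) \<union> cyl_state [] R (B \<inter> S) = cyl_state [] R ((A \<union> B) \<inter> S)"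
        unfolding cyl_state_def state_set_def by blast
      finally show ?thesis using R by (simp add: P_def)
    qed (simp add: P_def)
    show "P R A \<le> P R B" if AB: "open A" "open B" "A \<subseteq> B" for R A B
    proof -
      have "cyl_state [] R (A \<inter> S) \<subseteq> cyl_state [] R (B \<inter> S)" using AB(3) unfolding cyl_state_def state_set_def by blast
      then have "measure gauss_measure (cyl_state [] R (A \<inter> S)) \<le> measure gauss_measure (cyl_state [] R (B \<inter> S))"
        using AB S(1) by (intro gauss.finite_measure_mono sets open_Int)
      then show ?thesis by (simp add: P_def)
    qed
    show "emeasure lborel S < \<infinity>" by (rule emeasure_domW_subset[OF S])
    show "lim_ge (\<lambda>R. P R (box a b)) (12 / pi\<^sup>2 * measure lborel (box a b)) at_top"
      if ne: "box a b \<noteq> {}" and sub: "cbox a b \<subseteq> S" for a b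
    proof -
      obtain u1 v1 \<alpha>1 where a: "a = (u1, v1, \<alpha>1)" by (cases a)
      obtain u2 v2 \<alpha>2 where b: "b = (u2, v2, \<alpha>2)" by (cases b)
      have lt: "u1 < u2" "v1 < v2" "\<alpha>1 < \<alpha>2" using ne by (auto simp: a b box_ne_empty Basis_prod_def)
      have "measure lborel (box a b) = (\<Prod>i\<in>Basis. (b - a) \<bullet> i)"
        using lt by (subst measure_lborel_box_eq) (auto simp: a b Basis_prod_def)
      also have "\<dots> = (u2 - u1) * (v2 - v1) * (\<alpha>2 - \<alpha>1)"
        by (simp add: a b Basis_prod_def prod.union_disjoint image_Un image_image disjoint_iff zero_prod_def)
      finally have vol: "measure lborel (box a b) = (u2 - u1) * (v2 - v1) * (\<alpha>2 - \<alpha>1)" .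
      have e: "box a b \<inter> S = box a b" using sub box_subset_cbox[of a b] by blast
      have ev: "eventually (\<lambda>R. measure gauss_measure (cyl_state [] R (box a b)) \<le> P R (box a b)) at_top"
        using eventually_gt_at_top[of 0] by eventually_elim (simp add: P_def e)
      have "cbox (u1, v1, \<alpha>1) (u2, v2, \<alpha>2) \<subseteq> domW" using sub S(2) unfolding a b by (rule order_trans)
      from lim_ge_mono[OF box_lim_ge[OF ne[unfolded a b] this] ev[unfolded a b] order_refl]
      show ?thesis unfolding vol unfolding a b .
    qed
  qed (use S in auto)
  then show ?thesis
    by (rule lim_ge_mono) (auto simp: P_def intro!: always_eventually)
qed

section \<open>Weak convergence of both laws\<close>

theorem gauss_law_weakly_converges: "weakly_converges (\<lambda>R. gauss_law k R) (limit_law k) at_top"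
proof (rule weakly_converges_of_open)
  show "prob_space (gauss_law k R)" for R
    unfolding gauss_law_def by (rule gauss.prob_space_distr) (use measurable_renewal_vector in simp)
  show "lim_ge (\<lambda>R. measure (gauss_law k R) G) (measure (limit_law k) G) at_top" if G: "open G" for G
  proof -
    \<comment> \<open>The good states whose vector lies in \<open>G\<close>. A state in this open
      set forces the random vector into \<open>G\<close>, and an inclusion in this direction is all
      that a lower limit requires.\<close>
    let ?S = "limit_map k -` G \<inter> good_dom k"
    have S: "open ?S" "?S \<subseteq> domW" using measure_limit_law(2)[OF G, of k] by (auto simp: good_dom_def)
    show ?thesis
      unfolding measure_limit_law(1)[OF G]
    proof (rule lim_ge_mono[OF gauss_lim_ge[OF S] _ order_refl])
      show "eventually (\<lambda>R. measure gauss_measure (cyl_state [] R ?S) \<le> measure (gauss_law k R) G) at_top"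
        using eventually_gt_at_top[of 0]
      proof eventually_elim
        case (elim R)
        have m: "renewal_vector k R \<in> gauss_measure \<rightarrow>\<^sub>M borel" using measurable_renewal_vector by simp
        have "cyl_state [] R ?S \<subseteq> renewal_vector k R -` G \<inter> space gauss_measure"
        proof
          fix \<rho> assume r: "\<rho> \<in> cyl_state [] R ?S"
          then have \<rho>: "0 \<le> \<rho>" "\<rho> < 1" by (auto simp: cyl_state_def)
          obtain s where s: "cf_state R \<rho> s \<in> good_dom k" "limit_map k (cf_state R \<rho> s) \<in> G"
            using r by (auto simp: cyl_state_def state_set_def)
          then show "\<rho> \<in> renewal_vector k R -` G \<inter> space gauss_measure"
            using vectors_eq_limit_map(1)[OF elim \<rho> s(1)] by simp
        qed
        then have "measure gauss_measure (cyl_state [] R ?S) \<le> measure gauss_measure (renewal_vector k R -` G \<inter> space gauss_measure)"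
          using m G by (intro gauss.finite_measure_mono measurable_sets[OF m]) auto
        also have "\<dots> = measure (gauss_law k R) G"
          unfolding gauss_law_def using G by (intro measure_distr[OF m, symmetric]) simp
        finally show ?case .
      qed
    qed
  qed
qed (simp_all add: gauss_law_def prob_space_limit_law, simp add: limit_law_def)

theorem Q0_law_weakly_converges: "weakly_converges (\<lambda>N. Q0_law k N) (limit_law k) sequentially"
proof (rule weakly_converges_of_open)
  show "prob_space (Q0_law k N)" for N
    unfolding Q0_law_def by (rule prob_space.prob_space_distr[OF measure_pmf.prob_space_axioms]) simp
  show "lim_ge (\<lambda>N. measure (Q0_law k N) G) (measure (limit_law k) G) sequentially" if G: "open G" for G
  proof -
    let ?S = "limit_map k -` G \<inter> good_dom k"
    have S: "open ?S" "?S \<subseteq> domW" using measure_limit_law(2)[OF G, of k] by (auto simp: good_dom_def)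
    show ?thesis
      unfolding measure_limit_law(1)[OF G]
    proof (rule lim_ge_mono[OF Q0_lim_ge[OF S] _ order_refl])
      show "eventually (\<lambda>N. measure (measure_pmf (pmf_of_set (Q0 N))) {a. \<exists>s. cf_state (sqrt (real N)) (rho_of a) s \<in> ?S} \<le> measure (Q0_law k N) G) sequentially"
        using eventually_ge_at_top[of 1]
      proof eventually_elim
        case (elim N)
        let ?V = "\<lambda>a. straddle_vector k (sqrt (real N)) (rho_of a)"
        let ?M = "measure_pmf (pmf_of_set (Q0 N))"
        have R: "sqrt (real N) > 0" using elim by simp
        \<comment> \<open>Intersecting with the support \<open>Q0 N\<close> supplies
          \<open>a3 > 0\<close> and with it \<open>0 \<le> rho_of a < 1\<close>.\<close>
        have "Q0 N \<inter> {a. \<exists>s. cf_state (sqrt (real N)) (rho_of a) s \<in> ?S} \<subseteq> ?V -` G"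
        proof
          fix a assume a: "a \<in> Q0 N \<inter> {a. \<exists>s. cf_state (sqrt (real N)) (rho_of a) s \<in> ?S}"
          obtain a1 a2 a3 where aa: "a = (a1, a2, a3)" by (cases a)
          have a3: "0 < a3" using a by (auto simp: aa Q0_def)
          have \<rho>: "0 \<le> rho_of a" "rho_of a < 1" using a3 by (simp_all add: aa rho_of_def)
          obtain s where s: "cf_state (sqrt (real N)) (rho_of a) s \<in> good_dom k" "limit_map k (cf_state (sqrt (real N)) (rho_of a) s) \<in> G"
            using a by blast
          then show "a \<in> ?V -` G" using vectors_eq_limit_map(2)[OF R \<rho> s(1)] by simp
        qed
        then have "measure ?M (Q0 N \<inter> {a. \<exists>s. cf_state (sqrt (real N)) (rho_of a) s \<in> ?S}) \<le> measure ?M (?V -` G)"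
          by (intro measure_pmf.finite_measure_mono) auto
        moreover have "measure ?M {a. \<exists>s. cf_state (sqrt (real N)) (rho_of a) s \<in> ?S} = measure ?M (Q0 N \<inter> {a. \<exists>s. cf_state (sqrt (real N)) (rho_of a) s \<in> ?S})"
          using Q0_nonempty[OF elim] finite_Q0 by (simp add: measure_pmf_of_set Int_left_absorb)
        moreover have "measure ?M (?V -` G) = measure (Q0_law k N) G"
          unfolding Q0_law_def using G by (subst measure_distr) auto
        ultimately show ?case by simp
      qed
    qed
  qed
qed (simp_all add: Q0_law_def prob_space_limit_law, simp add: limit_law_def)

text \<open>The common limit is the explicit law \<open>limit_law k\<close>, in whose definition
  neither of the two models occurs.\<close>

theorem theorem3:
  fixes k :: nat
  assumes "k > 0"
  shows "\<exists>\<mu> :: (real \<times> (int \<Rightarrow> nat)) measure.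
           prob_space \<mu> \<and> sets \<mu> = sets borel \<and>
           weakly_converges (\<lambda>R. gauss_law k R) \<mu> at_top \<and>
           weakly_converges (\<lambda>N. Q0_law k N) \<mu> sequentially"
proof (intro exI conjI)
  show "sets (limit_law k) = sets borel" by (simp add: limit_law_def)
qed (rule prob_space_limit_law gauss_law_weakly_converges Q0_law_weakly_converges)+

end
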